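(* Let $X$ be an unweighted graph on $n$ vertices and let $M\in\{L(X),Q(X)\}$. Suppose local $\epsilon$-uniform mixing occurs at a vertex $u$ of $X$ relative to $M$. Then the following hold. (1) If $X$ is $k$-cyclic, then $\deg u\le 4+\frac{4(k-1)}{n}$. In particular, if $X$ is a tree, then $\deg u\le 3$, while if $0\le 4(k-1)<n$ (e.g., when $X$ is unicyclic), then $\deg u\le 4$. (2) If $X$ is a planar graph, then $\deg u\le 12-\frac{24}{n}$. In particular, $\deg u\le 9$ whenever $n\le 11$, $\deg u\le 10$ whenever $12\le n\le 23$, and $\deg u\le 11$ otherwise. (3) If $X$ is a triangle-free planar graph with $n\ge 3$ vertices, then $\deg u\le 8-\frac{16}{n}$. In particular, $\deg u\le 5$ whenever $n\le 7$, $\deg u\le 6$ whenever $8\le n\le 15$, and $\deg u\le 7$ otherwise. (4) If $X$ is a $C_4$-free planar graph with $n\ge 4$ vertices, then $\deg u\le \frac{60}{7n}(n-2)$. In particular, $\deg u\le 6$ whenever $n\le 10$, $\deg u\le 7$ whenever $11\le n\le 29$, and $\deg u\le 8$ otherwise. (5) If $X$ is a $C_5$-free planar graph with $n\ge 11$ vertices, then $\deg u\le \frac{4}{5n}(12n-33)$. In particular, $\deg u\le 7$ whenever $n\le 16$, $\deg u\le 8$ whenever $17\le n\le 43$, and $\deg u\le 9$ otherwise.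
   Context: Graphs are finite, simple, undirected and connected; unweighted means all edges have weight $1$. $A(X)$ is the adjacency matrix, $D(X)$ the diagonal matrix of vertex degrees, $L(X)=D(X)-A(X)$, $Q(X)=D(X)+A(X)$, and $U(t)=e^{\mathrm{i}tM}$. $\mathbf{e}_u$ is the characteristic vector of $u$, $\mathbf{1}$ the all-ones vector, $\circ$ the entrywise product. Local $\epsilon$-uniform mixing occurs at $u$ relative to $M$ if for each $\epsilon>0$ there is a time $\tau\in\mathbb{R}$ such that $\big\|(U(\tau)\mathbf{e}_u)\circ(\overline{U(\tau)}\mathbf{e}_u)-\tfrac1n\mathbf{1}\big\|<\epsilon$. For an integer $k\ge0$, a connected unweighted graph on $n$ vertices is $k$-cyclic if it has $(n-1)+k$ edges (a tree if $k=0$, unicyclic if $k=1$). A graph is $C_m$-free if it contains no (not necessarily induced) subgraph isomorphic to the cycle $C_m$ on $m$ vertices.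
   Formalization: In (2), the bound deg u ≤ 12 − 24/n is stated only for n ≥ 3, since it fails for the planar graphs K_1 and K_2, where mixing occurs; the "in particular" bounds of (2) are kept for all n. *)

theory Defs
  imports "HOL-Analysis.Analysis"
begin

text \<open>
  A graph on \<open>n\<close> vertices is given by a finite vertex type \<open>'v\<close> with \<open>CARD('v) = n\<close> and a set
  \<open>E :: 'v set set\<close> of edges; every element of \<open>'v\<close> is a vertex.
\<close>

definition simple_graph :: "'v::finite set set \<Rightarrow> bool" where
  "simple_graph E \<longleftrightarrow> (\<forall>e\<in>E. card e = 2)"

definition adjacent :: "'v::finite set set \<Rightarrow> 'v \<Rightarrow> 'v \<Rightarrow> bool" where
  "adjacent E u v \<longleftrightarrow> {u, v} \<in> E"

definition connected_graph :: "'v::finite set set \<Rightarrow> bool" where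
  "connected_graph E \<longleftrightarrow> (\<forall>u v. (adjacent E)\<^sup>*\<^sup>* u v)"

definition vertex_degree :: "'v::finite set set \<Rightarrow> 'v \<Rightarrow> nat" where
  "vertex_degree E u = card {v. adjacent E u v}"

definition k_cyclic :: "nat \<Rightarrow> 'v::finite set set \<Rightarrow> bool" where
  "k_cyclic k E \<longleftrightarrow> connected_graph E \<and> card E = (CARD('v) - 1) + k"

abbreviation tree :: "'v::finite set set \<Rightarrow> bool" where
  "tree E \<equiv> k_cyclic 0 E"

abbreviation unicyclic :: "'v::finite set set \<Rightarrow> bool" where
  "unicyclic E \<equiv> k_cyclic 1 E"

text \<open>
  The map \<open>c\<close> embeds the cycle on the vertices \<open>0, \<dots>, m - 1\<close> as a (not necessarily induced)
  subgraph. This is meaningful for \<open>m \<ge> 3\<close> only.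
\<close>

definition cycle_free :: "nat \<Rightarrow> 'v::finite set set \<Rightarrow> bool" where
  "cycle_free m E \<longleftrightarrow>
     \<not> (\<exists>c :: nat \<Rightarrow> 'v. inj_on c {..<m} \<and> (\<forall>i<m. adjacent E (c i) (c (Suc i mod m))))"

text \<open>
  Planarity is topological, with \<open>complex\<close> as the plane: vertices are drawn as distinct points and
  edges as arbitrary arcs (injective paths) joining their ends. An edge meets the vertex points
  only at its own ends, and two edges meet at most in common ends.
\<close>

definition planar_drawing ::
  "'v::finite set set \<Rightarrow> ('v \<Rightarrow> complex) \<Rightarrow> ('v set \<Rightarrow> real \<Rightarrow> complex) \<Rightarrow> bool" where
  "planar_drawing E p g \<longleftrightarrow>
     inj p \<and>
     (\<forall>e\<in>E. arc (g e) \<and> {pathstart (g e), pathfinish (g e)} = p ` e \<and>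
            path_image (g e) \<inter> range p = p ` e) \<and>
     (\<forall>e\<in>E. \<forall>f\<in>E. e \<noteq> f \<longrightarrow> path_image (g e) \<inter> path_image (g f) \<subseteq> p ` (e \<inter> f))"

definition planar :: "'v::finite set set \<Rightarrow> bool" where
  "planar E \<longleftrightarrow> (\<exists>p g. planar_drawing E p g)"

definition adjacency_matrix :: "'v::finite set set \<Rightarrow> real^'v^'v" where
  "adjacency_matrix E = (\<chi> u v. if adjacent E u v then 1 else 0)"

definition degree_matrix :: "'v::finite set set \<Rightarrow> real^'v^'v" where
  "degree_matrix E = (\<chi> u v. if u = v then real (vertex_degree E u) else 0)"

definition laplacian :: "'v::finite set set \<Rightarrow> real^'v^'v" where
  "laplacian E = degree_matrix E - adjacency_matrix E"

definition signless_laplacian :: "'v::finite set set \<Rightarrow> real^'v^'v" where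
  "signless_laplacian E = degree_matrix E + adjacency_matrix E"

text \<open>
  The multiplication of the type \<open>complex^'v^'v\<close> is entrywise, so the exponential series is spelled
  out here for the matrix product \<open>**\<close>.
\<close>

primrec matrix_pow :: "complex^'v^'v \<Rightarrow> nat \<Rightarrow> complex^'v^'v::finite" where
  "matrix_pow A 0 = mat 1"
| "matrix_pow A (Suc k) = A ** matrix_pow A k"

definition matrix_exp :: "complex^'v^'v \<Rightarrow> complex^'v^'v::finite" where
  "matrix_exp A = (\<Sum>k. matrix_pow A k /\<^sub>R fact k)"

definition transition_matrix :: "real^'v^'v \<Rightarrow> real \<Rightarrow> complex^'v^'v::finite" where
  "transition_matrix M t = matrix_exp (\<chi> a b. \<i> * complex_of_real t * complex_of_real (M $ a $ b))"

definition matrix_cnj :: "complex^'v^'v \<Rightarrow> complex^'v^'v::finite" where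
  "matrix_cnj A = (\<chi> a b. cnj (A $ a $ b))"

text \<open>
  On vectors, \<open>*\<close> is the entrywise product and \<open>1\<close> the all-ones vector; \<open>axis u 1\<close> is the
  characteristic vector of \<open>u\<close>.
\<close>

definition local_eps_uniform_mixing :: "real^'v^'v \<Rightarrow> 'v::finite \<Rightarrow> bool" where
  "local_eps_uniform_mixing M u \<longleftrightarrow>
     (\<forall>\<epsilon>>0. \<exists>\<tau>::real.
        norm ((transition_matrix M \<tau> *v axis u 1) * (matrix_cnj (transition_matrix M \<tau>) *v axis u 1)
              - (1 / real CARD('v)) *\<^sub>R 1) < \<epsilon>)"

end

theory Submission
  imports Defs
begin

text \<open>
  For \<open>w = U(\<tau>) e\<^sub>u\<close> the energy \<open>w\<^sup>* M w\<close> does not depend on \<open>\<tau>\<close>, so it equals \<open>deg u\<close>. If all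
  \<open>|w\<^sub>a|\<^sup>2\<close> are close to \<open>1/n\<close>, it is also a sum of \<open>|w\<^sub>a \<mp> w\<^sub>b|\<^sup>2 \<le> 2 |w\<^sub>a|\<^sup>2 + 2 |w\<^sub>b|\<^sup>2\<close> over the
  edges, whence \<open>n deg u \<le> 4 e\<close>, and everything reduces to upper bounds for the number \<open>e\<close> of edges.

  For planar graphs the faces are the components of the complement of a drawing. By Janiszewski's
  theorem an edge that closes a cycle splits a face into at most two pieces, which bounds the number of
  faces, while the interiors of the fundamental cycles of a spanning tree are independent. Counting
  yields Euler's formula, and that the boundary of every union of faces, taken modulo 2, is an even set
  of edges (as in MacLane's planarity criterion). Bounds for planar, triangle-free and \<open>C\<^sub>4\<close>-free graphs
  follow by counting edges on face boundaries, since an even set of 3, 4 or 5 edges is a cycle.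

  For \<open>C\<^sub>5\<close>-free graphs (a theorem of Dowden) a minimal counterexample is 3-edge-connected and has no cut
  vertex. Two faces then share at most one edge, and no union of faces has a boundary of five edges.
  Hence triangular faces form blocks with at most three faces, all other neighbours of these blocks have
  at least six edges, and discharging over faces and vertices finishes the proof.
\<close>

section \<open>Even edge sets and walks\<close>

text \<open>The drawing consists of arbitrary arcs, from which a rotation system would be hard to
  extract. Instead, the two sides of an edge are represented by a pair of points that is separated
  exactly by the cycles through this edge. The faces of these points suffice to define boundaries
  modulo 2. The bound 5 e <= 12 n - 33 fails for small graphs: \<open>K4\<close> has 6 edges on 4
  vertices. An induction over subgraphs therefore needs a second alternative, and e <= 2 n - 2 is
  the one that survives joining two parts by two edges, since (2 n1 - 2) + (2 n2 - 2) + 2 = 2 n - 2.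
  This is why exactly cuts of at most two edges and cut vertices can be excluded from a minimal
  counterexample. Sparse local configurations are excluded in the same way: deleting k vertices has
  to destroy more than 2 k edges, and this controls vertices of degree three in the
  discharging.\<close>

lemma even_sum_cong:
  fixes f h :: "'a \<Rightarrow> nat"
  assumes "\<And>i. i \<in> I \<Longrightarrow> even (f i) = even (h i)"
  shows "even (sum f I) = even (sum h I)"
  using assms by (induction I rule: infinite_finite_induct) auto

lemma card_filter_sum: "finite I \<Longrightarrow> card {i\<in>I. P i} = (\<Sum>i\<in>I. of_bool (P i))"
  by (simp add: Int_def)

lemma simple_graph_edgeE:
  assumes "simple_graph E" "e \<in> E"
  obtains a b where "a \<noteq> b" "e = {a, b}"
  using assms by (auto simp: simple_graph_def card_2_iff)

definition deg_in :: "'v set set \<Rightarrow> 'v \<Rightarrow> nat" where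
  "deg_in W v = card {e\<in>W. v \<in> e}"

definition even_set :: "'v set set \<Rightarrow> bool" where
  "even_set W \<longleftrightarrow> (\<forall>v. even (deg_in W v))"

lemma handshake:
  fixes W :: "'v::finite set set"
  shows "(\<Sum>v\<in>S. deg_in W v) = (\<Sum>e\<in>W. card (e \<inter> S))"
proof -
  have "(\<Sum>v\<in>S. deg_in W v) = (\<Sum>v\<in>S. \<Sum>e\<in>W. of_bool (v \<in> e))"
    by (simp add: deg_in_def card_filter_sum)
  also have "\<dots> = (\<Sum>e\<in>W. \<Sum>v\<in>S. of_bool (v \<in> e))"
    by (rule sum.swap)
  also have "\<dots> = (\<Sum>e\<in>W. card (e \<inter> S))"
    by (simp add: Int_def conj_commute)
  finally show ?thesis .
qed

lemma deg_in_insert: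
  fixes W :: "'v::finite set set"
  shows "e \<notin> W \<Longrightarrow> deg_in (insert e W) v = deg_in W v + of_bool (v \<in> e)"
proof -
  assume "e \<notin> W"
  moreover have "{f \<in> insert e W. v \<in> f} = (if v \<in> e then insert e {f \<in> W. v \<in> f} else {f \<in> W. v \<in> f})"
    by auto
  ultimately show ?thesis by (simp add: deg_in_def)
qed

lemma adjacent_sym: "adjacent W u v \<Longrightarrow> adjacent W v u"
  by (simp add: adjacent_def insert_commute)

lemma conn_sym: "(adjacent W)\<^sup>*\<^sup>* u v \<Longrightarrow> (adjacent W)\<^sup>*\<^sup>* v u"
  by (rule sympD[OF symp_rtranclp]) (auto intro: sympI adjacent_sym)

lemma conn_mono: "(adjacent W)\<^sup>*\<^sup>* u v \<Longrightarrow> W \<subseteq> W' \<Longrightarrow> (adjacent W')\<^sup>*\<^sup>* u v"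
  by (erule rtranclp_mono[THEN predicate2D, rotated]) (auto simp: adjacent_def)

definition reach :: "'v::finite set set \<Rightarrow> 'v \<Rightarrow> 'v set" where
  "reach W a = {v. (adjacent W)\<^sup>*\<^sup>* a v}"

lemma reach_self [simp]: "a \<in> reach W a"
  by (simp add: reach_def)

lemma reach_closed:
  assumes "simple_graph W" "e \<in> W" "e \<inter> reach W a \<noteq> {}"
  shows "e \<subseteq> reach W a"
proof -
  obtain x y where xy: "x \<noteq> y" "e = {x, y}"
    using assms simple_graph_edgeE by metis
  have "adjacent W x y" "adjacent W y x"
    using assms(2) xy by (auto simp: adjacent_def insert_commute)
  then show ?thesis
    using assms(3) xy by (auto simp: reach_def intro: rtranclp.rtrancl_into_rtrancl)
qed

lemma reach_subset:
  assumes "a \<in> X" "\<And>e. e \<in> W \<Longrightarrow> e \<inter> X \<noteq> {} \<Longrightarrow> e \<subseteq> X"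
  shows "reach W a \<subseteq> X"
proof -
  have "(adjacent W)\<^sup>*\<^sup>* a v \<Longrightarrow> v \<in> X" for v
    by (induction rule: rtranclp_induct) (use assms in \<open>auto simp: adjacent_def\<close>)
  then show ?thesis by (auto simp: reach_def)
qed

text \<open>Otherwise the component of \<open>a\<close> after the deletion contains \<open>a\<close>
  but not \<open>b\<close>. Its degrees in \<open>Z\<close> count every inner edge twice and the
  deleted edge once, so their sum is odd although each summand is even.\<close>

lemma even_set_conn:
  fixes Z :: "'v::finite set set"
  assumes "simple_graph Z" "even_set Z" "{a, b} \<in> Z"
  shows "(adjacent (Z - {{a, b}}))\<^sup>*\<^sup>* a b"
proof (rule ccontr)
  assume nc: "\<not> ?thesis"
  define W where "W = Z - {{a, b}}"
  define S where "S = reach W a"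
  have sW: "simple_graph W" using assms(1) by (auto simp: simple_graph_def W_def)
  have aS: "a \<in> S" and bS: "b \<notin> S" using nc by (auto simp: S_def reach_def W_def)
  have Z: "Z = insert {a, b} W" "{a, b} \<notin> W" using assms by (auto simp: W_def)
  have "even (\<Sum>e\<in>W. card (e \<inter> S))"
  proof (rule dvd_sum)
    fix e assume e: "e \<in> W"
    show "even (card (e \<inter> S))"
    proof (cases "e \<inter> S = {}")
      case False
      then have "e \<inter> S = e" using reach_closed[OF sW e] by (auto simp: S_def)
      then show ?thesis using e sW by (simp add: simple_graph_def)
    qed simp
  qed
  moreover have "(\<Sum>v\<in>S. deg_in W v) + 1 = (\<Sum>v\<in>S. deg_in Z v)"
  proof -
    have "(\<Sum>v\<in>S. deg_in Z v) = (\<Sum>v\<in>S. deg_in W v + of_bool (v \<in> {a, b}))"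
      using Z deg_in_insert by metis
    also have "\<dots> = (\<Sum>v\<in>S. deg_in W v + of_bool (v = a))"
      by (rule sum.cong) (use bS in auto)
    also have "\<dots> = (\<Sum>v\<in>S. deg_in W v) + (\<Sum>v\<in>S. of_bool (v = a))"
      by (simp add: sum.distrib del: sum_of_bool_eq)
    also have "(\<Sum>v\<in>S. of_bool (v = a)) = (1::nat)"
      using aS by (simp add: of_bool_def sum.delta)
    finally show ?thesis by simp
  qed
  moreover have "even (\<Sum>v\<in>S. deg_in Z v)"
    using assms(2) by (auto simp: even_set_def intro: dvd_sum)
  ultimately show False by (metis handshake even_plus_one_iff)
qed

fun walk_edges :: "'v list \<Rightarrow> 'v set set" where
  "walk_edges (x # y # xs) = insert {x, y} (walk_edges (y # xs))"
| "walk_edges _ = {}"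

lemma walk_edges_append: "walk_edges zs \<subseteq> walk_edges (ys @ zs)"
proof (induction ys)
  case (Cons a ys)
  then show ?case by (cases "ys @ zs") auto
qed simp

lemma walk_edges_subset: "e \<in> walk_edges xs \<Longrightarrow> e \<subseteq> set xs"
  by (induction xs rule: walk_edges.induct) auto

lemma walk_edges_odd:
  fixes xs :: "'v::finite list"
  assumes "distinct xs" "length xs \<ge> 2"
  shows "odd (deg_in (walk_edges xs) v) \<longleftrightarrow> v = hd xs \<or> v = last xs"
  using assms
proof (induction xs rule: walk_edges.induct)
  case (1 x y xs)
  have n: "{x, y} \<notin> walk_edges (y # xs)"
    using walk_edges_subset 1(2) by fastforce
  show ?case
  proof (cases xs)
    case Nil
    have "{e. e = {x, y} \<and> v \<in> e} = (if v = x \<or> v = y then {{x, y}} else {})"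
      by auto
    then show ?thesis using Nil by (auto simp: deg_in_def)
  next
    case (Cons z zs)
    then have "odd (deg_in (walk_edges (y # xs)) v) \<longleftrightarrow> v = y \<or> v = last xs"
      using 1 by simp
    moreover have "y \<noteq> last xs" "x \<noteq> last xs" "x \<noteq> y" using 1(2) Cons by auto
    moreover have "deg_in (walk_edges (x # y # xs)) v = deg_in (walk_edges (y # xs)) v + of_bool (v \<in> {x, y})"
      using deg_in_insert[OF n] by simp
    ultimately show ?thesis
      using Cons by (auto simp del: walk_edges.simps)
  qed
qed auto

lemma conn_distinct_walk:
  assumes "(adjacent H)\<^sup>*\<^sup>* a b"
  obtains xs where "xs \<noteq> []" "hd xs = a" "last xs = b" "distinct xs" "walk_edges xs \<subseteq> H"
proof -
  from assms have "\<exists>xs. xs \<noteq> [] \<and> hd xs = a \<and> last xs = b \<and> distinct xs \<and> walk_edges xs \<subseteq> H"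
  proof (induction rule: converse_rtranclp_induct)
    case base
    then show ?case by (intro exI[of _ "[b]"]) auto
  next
    case (step a c)
    then obtain xs where xs: "xs \<noteq> []" "hd xs = c" "last xs = b" "distinct xs" "walk_edges xs \<subseteq> H"
      by blast
    show ?case
    proof (cases "a \<in> set xs")
      case True
      then obtain ys zs where "xs = ys @ a # zs" by (auto simp: in_set_conv_decomp)
      then show ?thesis
        using xs walk_edges_append[of "a # zs" ys] by (intro exI[of _ "a # zs"]) auto
    next
      case False
      then show ?thesis
        using xs step(1) by (intro exI[of _ "a # xs"], cases xs) (auto simp: adjacent_def)
    qed
  qed
  then show ?thesis using that by blast
qed

section \<open>Faces of a plane drawing\<close>

text \<open>The combinatorial content of a plane drawing: \<open>L e\<close> and \<open>R e\<close> are the faces on the two sides of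
  the edge \<open>e\<close>, and \<open>dual_cut H L R A\<close> is the boundary of the union of the faces in \<open>A\<close>. Boundaries
  modulo 2 suffice for everything below, so no cyclic orders are recorded.\<close>

definition dual_cut :: "'v set set \<Rightarrow> ('v set \<Rightarrow> 'f) \<Rightarrow> ('v set \<Rightarrow> 'f) \<Rightarrow> 'f set \<Rightarrow> 'v set set" where
  "dual_cut H L R A = {e\<in>H. (L e \<in> A) \<noteq> (R e \<in> A)}"

text \<open>\<open>even_cut\<close> places dual cuts in the cycle space, \<open>cycle_cut\<close> is
  a converse for a cycle through \<open>ab\<close> that avoids the rest of \<open>D\<close>, and
  \<open>dual_conn\<close> is connectedness of the dual graph. The vertices form a subset
  \<open>X\<close> of the type because the induction for 5-cycles passes to induced
  subgraphs.\<close>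

locale plane_graph =
  fixes X :: "'v::finite set" and H :: "'v set set" and \<Phi> :: "'f set" and L R :: "'v set \<Rightarrow> 'f"
  assumes simple: "simple_graph H"
    and edges_in: "e \<in> H \<Longrightarrow> e \<subseteq> X"
    and conn: "u \<in> X \<Longrightarrow> v \<in> X \<Longrightarrow> (adjacent H)\<^sup>*\<^sup>* u v"
    and finite_faces: "finite \<Phi>"
    and sides: "e \<in> H \<Longrightarrow> L e \<in> \<Phi>" "e \<in> H \<Longrightarrow> R e \<in> \<Phi>"
    and euler: "card \<Phi> + card X = card H + 2"
    and even_cut: "A \<subseteq> \<Phi> \<Longrightarrow> even_set (dual_cut H L R A)"
    and dual_conn: "A \<subseteq> \<Phi> \<Longrightarrow> dual_cut H L R A = {} \<Longrightarrow> A = {} \<or> A = \<Phi>"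
    and cycle_cut: "D \<subseteq> H \<Longrightarrow> {a, b} \<in> D \<Longrightarrow> (adjacent (H - D))\<^sup>*\<^sup>* a b \<Longrightarrow>
      \<exists>A\<subseteq>\<Phi>. dual_cut H L R A \<inter> D = {{a, b}}"

section \<open>Arcs and closed curves in a drawing\<close>

lemma component_of_point:
  assumes "Y \<in> components S" "x \<in> Y"
  shows "Y = connected_component_set S x"
  using assms connected_component_eq by (auto simp: components_def)

locale drawing =
  fixes E :: "'v::finite set set" and p :: "'v \<Rightarrow> complex" and g :: "'v set \<Rightarrow> real \<Rightarrow> complex"
  assumes simple: "simple_graph E" and drawing: "planar_drawing E p g"
begin

lemma arc_g: "e \<in> E \<Longrightarrow> arc (g e)"
  and ends_g: "e \<in> E \<Longrightarrow> {pathstart (g e), pathfinish (g e)} = p ` e"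
  and meets_edges: "e \<in> E \<Longrightarrow> f \<in> E \<Longrightarrow> e \<noteq> f \<Longrightarrow> path_image (g e) \<inter> path_image (g f) \<subseteq> p ` (e \<inter> f)"
  using drawing by (auto simp: planar_drawing_def)

definition drawn :: "'v set set \<Rightarrow> complex set" where
  "drawn H = (\<Union>e\<in>H. path_image (g e))"

lemma drawn_insert [simp]: "drawn (insert e H) = path_image (g e) \<union> drawn H"
  by (simp add: drawn_def)

lemma drawn_empty [simp]: "drawn {} = {}"
  by (simp add: drawn_def)

lemma drawn_mono: "H \<subseteq> H' \<Longrightarrow> drawn H \<subseteq> drawn H'"
  by (auto simp: drawn_def)

lemma compact_drawn: "H \<subseteq> E \<Longrightarrow> compact (drawn H)"
  unfolding drawn_def by (intro compact_UN) (auto intro: compact_path_image arc_imp_path arc_g)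

lemma edge_meets_drawn:
  assumes "e \<in> E" "H \<subseteq> E" "e \<notin> H"
  shows "path_image (g e) \<inter> drawn H \<subseteq> p ` e"
  using meets_edges[OF assms(1)] assms(2,3) by (fastforce simp: drawn_def)

lemma oriented_edge:
  assumes "{a, b} \<in> E"
  obtains h where "arc h" "pathstart h = p a" "pathfinish h = p b" "path_image h = path_image (g {a, b})"
proof -
  have "{pathstart (g {a, b}), pathfinish (g {a, b})} = {p a, p b}"
    using ends_g[OF assms] by simp
  then consider "pathstart (g {a, b}) = p a" "pathfinish (g {a, b}) = p b"
    | "pathstart (g {a, b}) = p b" "pathfinish (g {a, b}) = p a"
    by (metis doubleton_eq_iff)
  then show ?thesis
  proof cases
    case 1
    then show ?thesis using that arc_g[OF assms] by blast
  next
    case 2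
    then show ?thesis
      using that[of "reversepath (g {a, b})"] arc_g[OF assms] by (simp add: arc_reversepath)
  qed
qed

lemma walk_arc:
  assumes "distinct xs" "length xs \<ge> 2" "walk_edges xs \<subseteq> E"
  obtains h where "arc h" "pathstart h = p (hd xs)" "pathfinish h = p (last xs)"
    "path_image h = drawn (walk_edges xs)"
proof -
  have "\<exists>h. arc h \<and> pathstart h = p (hd xs) \<and> pathfinish h = p (last xs)
           \<and> path_image h = drawn (walk_edges xs)"
    using assms
  proof (induction xs rule: walk_edges.induct)
    case (1 x y xs)
    have e: "{x, y} \<in> E" using 1 by simp
    obtain h0 where h0: "arc h0" "pathstart h0 = p x" "pathfinish h0 = p y"
      "path_image h0 = path_image (g {x, y})"
      using oriented_edge[OF e] .
    show ?case
    proof (cases xs)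
      case Nil
      then show ?thesis using h0 by auto
    next
      case (Cons z zs)
      then obtain h where h: "arc h" "pathstart h = p y" "pathfinish h = p (last (y # xs))"
        "path_image h = drawn (walk_edges (y # xs))"
        using 1 by auto
      have "path_image (g {x, y}) \<inter> path_image (g f) \<subseteq> {p y}" if f: "f \<in> walk_edges (y # xs)" for f
      proof -
        have "f \<subseteq> set (y # xs)" using walk_edges_subset f by fast
        then have "x \<notin> f" using 1 by auto
        moreover from this have "f \<noteq> {x, y}" by blast
        moreover have "f \<in> E" using f 1 by auto
        ultimately show ?thesis using meets_edges[OF e, of f] by auto
      qed
      then have "path_image h0 \<inter> path_image h \<subseteq> {pathstart h}"
        using h0 h by (auto simp: drawn_def)
      then have "arc (h0 +++ h)" using h0 h by (intro arc_join) auto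
      moreover have "path_image (h0 +++ h) = drawn (walk_edges (x # y # xs))"
        using h0 h by (simp add: path_image_join)
      ultimately show ?thesis
        using h0 h by (intro exI[of _ "h0 +++ h"]) auto
    qed
  qed auto
  then show ?thesis using that by blast
qed

definition jordan :: "'v set set \<Rightarrow> bool" where
  "jordan Z \<longleftrightarrow> Z \<subseteq> E \<and> even_set Z \<and>
     (\<exists>c. simple_path c \<and> pathfinish c = pathstart c \<and> path_image c = drawn Z)"

text \<open>The rest \<open>Z\<close> of the cycle is kept apart from the edge \<open>ab\<close>:
  its drawing is exactly what the cycle shares with a larger drawing that lacks \<open>ab\<close>,
  and Janiszewski's theorem asks for this intersection to be connected.\<close>

lemma cycle_through_edge:
  assumes e: "{a, b} \<in> E" and W: "W \<subseteq> E" "{a, b} \<notin> W" and conn: "(adjacent W)\<^sup>*\<^sup>* a b"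
  obtains Z where "Z \<subseteq> W" "jordan (insert {a, b} Z)" "connected (drawn Z)" "p a \<in> drawn Z" "p b \<in> drawn Z"
proof -
  obtain xs where xs: "xs \<noteq> []" "hd xs = a" "last xs = b" "distinct xs" "walk_edges xs \<subseteq> W"
    using conn_distinct_walk[OF conn] .
  have ab: "a \<noteq> b" using simple e by (force simp: simple_graph_def)
  then have len: "length xs \<ge> 2" using xs by (cases xs; cases "tl xs") auto
  obtain h where h: "arc h" "pathstart h = p a" "pathfinish h = p b" "path_image h = drawn (walk_edges xs)"
    using walk_arc[OF xs(4) len] xs W by auto
  have "{b, a} \<in> E" using e by (simp add: insert_commute)
  then obtain h0 where h0: "arc h0" "pathstart h0 = p b" "pathfinish h0 = p a"
      "path_image h0 = path_image (g {a, b})"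
    using oriented_edge[of b a] by (metis insert_commute)
  have "path_image h0 \<inter> path_image h \<subseteq> {pathstart h0, pathstart h}"
    using edge_meets_drawn[OF e, of "walk_edges xs"] xs W h0 h by auto
  then have "simple_path (h0 +++ h)"
    using h h0 by (intro simple_path_join_loop) auto
  moreover have "path_image (h0 +++ h) = drawn (insert {a, b} (walk_edges xs))"
    using h h0 by (simp add: path_image_join)
  moreover have "even_set (insert {a, b} (walk_edges xs))"
  proof -
    have "{a, b} \<notin> walk_edges xs" using xs W by blast
    moreover have "even (deg_in (walk_edges xs) v) \<longleftrightarrow> v \<noteq> a \<and> v \<noteq> b" for v
      using walk_edges_odd[OF xs(4) len, of v] xs(2,3) by blast
    ultimately show ?thesis
      using ab by (simp add: even_set_def deg_in_insert)
  qed
  moreover have "connected (drawn (walk_edges xs))"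
    using h connected_path_image[of h] by (simp add: arc_imp_path)
  moreover have "p a \<in> drawn (walk_edges xs)" "p b \<in> drawn (walk_edges xs)"
    using h pathstart_in_path_image[of h] pathfinish_in_path_image[of h] by auto
  moreover have "insert {a, b} (walk_edges xs) \<subseteq> E" using xs W e by auto
  moreover have "pathfinish (h0 +++ h) = pathstart (h0 +++ h)" using h h0 by simp
  ultimately have "jordan (insert {a, b} (walk_edges xs))"
    unfolding jordan_def by blast
  then show ?thesis
    using that[of "walk_edges xs"] xs \<open>connected _\<close> \<open>p a \<in> _\<close> \<open>p b \<in> _\<close> by blast
qed

section \<open>Faces under the addition of an edge\<close>

lemma jordan_curve_facts:
  assumes "jordan Z"
  shows "connected (inside (drawn Z))" "connected (outside (drawn Z))"
    "frontier (inside (drawn Z)) = drawn Z" "frontier (outside (drawn Z)) = drawn Z"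
    "open (inside (drawn Z))" "open (outside (drawn Z))"
proof -
  obtain c where c: "simple_path c" "pathfinish c = pathstart c" "path_image c = drawn Z"
    using assms by (auto simp: jordan_def)
  show "connected (inside (drawn Z))" "connected (outside (drawn Z))"
    "frontier (inside (drawn Z)) = drawn Z" "frontier (outside (drawn Z)) = drawn Z"
    "open (inside (drawn Z))" "open (outside (drawn Z))"
    using Jordan_inside_outside[OF c(1,2)] c(3) by auto
qed

lemma same_side_component:
  assumes "jordan Z" "x \<notin> drawn Z" "y \<notin> drawn Z" "x \<in> inside (drawn Z) \<longleftrightarrow> y \<in> inside (drawn Z)"
  shows "connected_component (- drawn Z) x y"
proof -
  note j = jordan_curve_facts[OF assms(1)]
  have "x \<in> inside (drawn Z) \<and> y \<in> inside (drawn Z) \<or> x \<in> outside (drawn Z) \<and> y \<in> outside (drawn Z)"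
    using assms(2,3,4) by (metis Compl_iff Un_iff inside_Un_outside)
  then show ?thesis
    using j(1,2) inside_no_overlap[of "drawn Z"] outside_no_overlap[of "drawn Z"]
    unfolding connected_component_def by (metis disjoint_eq_subset_Compl)
qed

text \<open>An edge that closes a cycle splits a face into at most two pieces. Janiszewski's theorem applies
  because the cycle meets the rest of the drawing in a connected set.\<close>

lemma split_face:
  assumes e: "{a, b} \<in> E" "{a, b} \<notin> K" and K: "K \<subseteq> E"
    and Z: "Z \<subseteq> K" "jordan (insert {a, b} Z)" "connected (drawn Z)" "p a \<in> drawn Z" "p b \<in> drawn Z"
    and xy: "x \<notin> path_image (g {a, b})" "y \<notin> path_image (g {a, b})" "connected_component (- drawn K) x y"
      "x \<in> inside (drawn (insert {a, b} Z)) \<longleftrightarrow> y \<in> inside (drawn (insert {a, b} Z))"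
  shows "connected_component (- drawn (insert {a, b} K)) x y"
proof -
  have "drawn K \<inter> path_image (g {a, b}) \<subseteq> drawn Z"
    using edge_meets_drawn[OF e(1) K e(2)] Z by auto
  then have int: "drawn K \<inter> drawn (insert {a, b} Z) = drawn Z"
    using drawn_mono[OF Z(1)] by auto
  have un: "drawn K \<union> drawn (insert {a, b} Z) = drawn (insert {a, b} K)"
    using drawn_mono[OF Z(1)] by auto
  have "x \<notin> drawn K" "y \<notin> drawn K" using xy(3) connected_component_in by blast+
  then have "connected_component (- drawn (insert {a, b} Z)) x y"
    using xy drawn_mono[OF Z(1)] by (intro same_side_component[OF Z(2)]) auto
  moreover have "closed (drawn (insert {a, b} Z))"
    using Z(2) compact_imp_closed[OF compact_drawn] unfolding jordan_def by blast
  moreover have "connected (drawn K \<inter> drawn (insert {a, b} Z))"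
    unfolding int by (rule Z(3))
  ultimately show ?thesis
    unfolding un[symmetric] by (intro Janiszewski compact_drawn[OF K] xy(3))
qed

text \<open>A new face is determined by the old face around it and one bit, needed only for the face
  \<open>F\<close> crossed by the new edge, that tells on which side of a cycle through this edge it
  lies. So the code \<open>\<phi>\<close> has only one value more than there are old faces.\<close>

lemma split_face_count:
  assumes e: "{a, b} \<in> E" "{a, b} \<notin> K" and K: "K \<subseteq> E" and conn: "(adjacent K)\<^sup>*\<^sup>* a b"
    and fin: "finite (components (- drawn K))"
  shows "finite (components (- drawn (insert {a, b} K)))
    \<and> card (components (- drawn (insert {a, b} K))) \<le> card (components (- drawn K)) + 1"
proof -
  let ?K' = "drawn (insert {a, b} K)"
  obtain Z where Z: "Z \<subseteq> K" "jordan (insert {a, b} Z)" "connected (drawn Z)" "p a \<in> drawn Z" "p b \<in> drawn Z"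
    using cycle_through_edge[OF e(1) K e(2) conn] .
  let ?I = "inside (drawn (insert {a, b} Z))"
  define m where "m = g {a, b} (1/2)"
  define F where "F = connected_component_set (- drawn K) m"
  define comp where "comp Y = connected_component_set (- drawn K) (SOME x. x \<in> Y)" for Y
  define \<phi> where "\<phi> Y = (comp Y, comp Y = F \<and> (SOME x. x \<in> Y) \<in> ?I)" for Y
  \<comment> \<open>Without its ends the edge is connected and misses \<open>drawn K\<close>, so it
    lies in a single old face, named by the midpoint \<open>m\<close>.\<close>
  have open_edge: "path_image (g {a, b}) - p ` {a, b} \<subseteq> F"
  proof -
    obtain h where h: "arc h" "pathstart h = p a" "pathfinish h = p b" "path_image h = path_image (g {a, b})"
      using oriented_edge[OF e(1)] .
    let ?O = "path_image (g {a, b}) - p ` {a, b}"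
    have "connected ?O"
      using connected_simple_path_endless[of h] h by (simp add: arc_imp_simple_path)
    moreover have "m \<in> ?O"
    proof -
      have inj: "inj_on (g {a, b}) {0..1}" using arc_g[OF e(1)] by (simp add: arc_def)
      have "m \<noteq> pathstart (g {a, b})" "m \<noteq> pathfinish (g {a, b})"
        using inj_onD[OF inj, of "1/2" 0] inj_onD[OF inj, of "1/2" 1]
        by (auto simp: m_def pathstart_def pathfinish_def)
      moreover have "m \<in> path_image (g {a, b})" by (auto simp: m_def path_image_def)
      ultimately show ?thesis using ends_g[OF e(1)] by auto
    qed
    moreover have "?O \<subseteq> - drawn K" using edge_meets_drawn[OF e(1) K e(2)] by auto
    ultimately show ?thesis unfolding F_def by (intro connected_component_maximal)
  qed
  have some: "(SOME x. x \<in> Y) \<in> Y" if "Y \<in> components (- ?K')" for Y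
    using in_components_nonempty[OF that] some_in_eq by blast
  have inj: "inj_on \<phi> (components (- ?K'))"
  proof (rule inj_onI)
    fix Y Y' assume Y: "Y \<in> components (- ?K')" "Y' \<in> components (- ?K')" and eq: "\<phi> Y = \<phi> Y'"
    define x where "x = (SOME x. x \<in> Y)"
    define y where "y = (SOME x. x \<in> Y')"
    have xY: "x \<in> Y" "y \<in> Y'" using some Y by (auto simp: x_def y_def)
    then have xy: "x \<notin> ?K'" "y \<notin> ?K'" using Y in_components_subset by blast+
    have cc: "connected_component_set (- drawn K) x = connected_component_set (- drawn K) y"
      using eq by (simp add: \<phi>_def comp_def x_def y_def)
    then have cxy: "connected_component (- drawn K) x y"
      using xy connected_component_refl[of y "- drawn K"] by auto
    have "connected_component (- ?K') x y"
    proof (cases "comp Y = F")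
      case True
      then have "x \<in> ?I \<longleftrightarrow> y \<in> ?I" using eq by (simp add: \<phi>_def x_def y_def)
      then show ?thesis using split_face[OF e K Z] xy cxy by simp
    next
      case False
      \<comment> \<open>An old face other than \<open>F\<close> does not meet the new edge and
        remains whole.\<close>
      let ?G = "connected_component_set (- drawn K) x"
      have "?G \<inter> F = {}"
        using False unfolding F_def comp_def x_def using connected_component_nonoverlap by blast
      moreover have "?G \<subseteq> - drawn K" by (rule connected_component_subset)
      moreover have "p ` {a, b} \<subseteq> drawn K" using Z drawn_mono[OF Z(1)] by auto
      ultimately have "?G \<subseteq> - ?K'" using open_edge by auto
      moreover have "x \<in> ?G" "y \<in> ?G" using cxy connected_component_refl xy by auto
      ultimately show ?thesis
        unfolding connected_component_def using connected_connected_component by blast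
    qed
    then show "Y = Y'"
      using component_of_point[OF Y(1) xY(1)] component_of_point[OF Y(2) xY(2)] connected_component_eq by blast
  qed
  have img: "\<phi> ` components (- ?K') \<subseteq> insert (F, True) ((\<lambda>G. (G, False)) ` components (- drawn K))"
  proof
    fix z assume "z \<in> \<phi> ` components (- ?K')"
    then obtain Y where Y: "Y \<in> components (- ?K')" "z = \<phi> Y" by blast
    then have "(SOME x. x \<in> Y) \<in> - drawn K"
      using some[OF Y(1)] in_components_subset[OF Y(1)] by auto
    then have "comp Y \<in> components (- drawn K)"
      unfolding comp_def by (rule componentsI)
    then show "z \<in> insert (F, True) ((\<lambda>G. (G, False)) ` components (- drawn K))"
      using Y by (auto simp: \<phi>_def)
  qed
  have fin': "finite (insert (F, True) ((\<lambda>G. (G, False)) ` components (- drawn K)))"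
    using fin by simp
  have "finite (components (- ?K'))"
    using inj img fin' by (meson finite_imageD finite_subset)
  moreover have "card (components (- ?K')) \<le> card (insert (F, True) ((\<lambda>G. (G, False)) ` components (- drawn K)))"
    using card_inj_on_le[OF inj img fin'] .
  moreover have "\<dots> \<le> card (components (- drawn K)) + 1"
  proof -
    have "card ((\<lambda>G. (G, False)) ` components (- drawn K)) \<le> card (components (- drawn K))"
      by (rule card_image_le[OF fin])
    moreover have "card (insert (F, True) ((\<lambda>G. (G, False)) ` components (- drawn K)))
        \<le> Suc (card ((\<lambda>G. (G, False)) ` components (- drawn K)))"
      by (rule card_insert_le_m1) auto
    ultimately show ?thesis by linarith
  qed
  ultimately show ?thesis by linarith
qed

section \<open>Sides of edges and the number of faces\<close>

lemma drawn_not_UNIV: "H \<subseteq> E \<Longrightarrow> drawn H \<noteq> UNIV"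
  using compact_imp_bounded[OF compact_drawn] not_bounded_UNIV by metis

text \<open>One pair of points has to work for all cycles at once. If \<open>e\<close> is no bridge,
  a small disc about its midpoint meets no other edge, and a fixed cycle \<open>Z0\<close> through
  \<open>e\<close> picks \<open>x\<close> and \<open>y\<close> in it. By \<open>split_face\<close>,
  undrawn points of the disc on the same side of \<open>Z0\<close> lie in one face, so every cycle
  through \<open>e\<close> separates \<open>x\<close> from \<open>y\<close>. If \<open>e\<close> is
  a bridge, no even set contains it, and a single point serves twice.\<close>

lemma edge_sides:
  assumes H: "H \<subseteq> E" and e: "e \<in> H"
  shows "\<exists>x y. x \<notin> drawn H \<and> y \<notin> drawn H \<and>
    (\<forall>Z\<subseteq>H. jordan Z \<longrightarrow> (e \<in> Z \<longleftrightarrow> (x \<in> inside (drawn Z)) \<noteq> (y \<in> inside (drawn Z))))"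
proof -
  obtain a b where ab: "a \<noteq> b" "e = {a, b}" using simple e H simple_graph_edgeE by blast
  define K where "K = H - {e}"
  have K: "K \<subseteq> E" "e \<notin> K" "H = insert e K" "e \<in> E" using H e by (auto simp: K_def)
  show ?thesis
  proof (cases "(adjacent K)\<^sup>*\<^sup>* a b")
    case False
    have "e \<notin> Z" if "Z \<subseteq> H" "jordan Z" for Z
    proof
      assume "e \<in> Z"
      moreover have "simple_graph Z" using simple that H by (auto simp: simple_graph_def)
      ultimately have "(adjacent (Z - {e}))\<^sup>*\<^sup>* a b"
        using even_set_conn[of Z a b] that ab by (auto simp: jordan_def)
      then show False using False conn_mono[of "Z - {e}" a b K] that K by blast
    qed
    moreover obtain x where "x \<notin> drawn H" using drawn_not_UNIV[OF H] by blast
    ultimately show ?thesis by blast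
  next
    case True
    obtain Z0 where Z0: "Z0 \<subseteq> K" "jordan (insert e Z0)" "connected (drawn Z0)" "p a \<in> drawn Z0" "p b \<in> drawn Z0"
      using cycle_through_edge[OF _ K(1) _ True] K ab by metis
    define m where "m = g e (1/2)"
    have m_g: "m \<in> path_image (g e)" by (auto simp: m_def path_image_def)
    have inj: "inj_on (g e) {0..1}" using arc_g[OF K(4)] by (simp add: arc_def)
    have "m \<noteq> pathstart (g e)" "m \<noteq> pathfinish (g e)"
      using inj_onD[OF inj, of "1/2" 0] inj_onD[OF inj, of "1/2" 1]
      by (auto simp: m_def pathstart_def pathfinish_def)
    then have "m \<notin> p ` e" using ends_g[OF K(4)] by auto
    then have "m \<in> - drawn K" using m_g edge_meets_drawn[OF K(4) K(1,2)] by auto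
    moreover have "open (- drawn K)" using compact_imp_closed[OF compact_drawn[OF K(1)]] by blast
    ultimately obtain r where r: "r > 0" "ball m r \<subseteq> - drawn K"
      using open_contains_ball by blast
    have conn_ball: "connected_component (- drawn K) u w" if "u \<in> ball m r" "w \<in> ball m r" for u w
      using r that connected_ball unfolding connected_component_def by blast
    have near: "\<exists>u\<in>ball m r. \<exists>w\<in>ball m r. u \<in> inside (drawn Z) \<and> w \<in> outside (drawn Z)"
      if "jordan Z" "e \<in> Z" for Z
    proof -
      have "m \<in> drawn Z" using m_g that by (auto simp: drawn_def)
      then have "m \<in> closure (inside (drawn Z))" "m \<in> closure (outside (drawn Z))"
        using jordan_curve_facts[OF that(1)] by (auto simp: frontier_def)
      then show ?thesis
        using r(1) unfolding closure_approachable by (metis dist_commute mem_ball)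
    qed
    have off: "u \<notin> drawn H" if "jordan Z" "e \<in> Z" "u \<in> ball m r" "u \<in> inside (drawn Z) \<union> outside (drawn Z)" for u Z
    proof -
      have "u \<notin> drawn Z" using that(4) inside_no_overlap outside_no_overlap by fastforce
      then have "u \<notin> path_image (g e)" using that(2) by (auto simp: drawn_def)
      then show ?thesis using r that K by auto
    qed
    obtain x y where x: "x \<in> ball m r" "x \<in> inside (drawn (insert e Z0))"
      and y: "y \<in> ball m r" "y \<in> outside (drawn (insert e Z0))"
      using near[OF Z0(2)] by blast
    then have yi: "y \<notin> inside (drawn (insert e Z0))" using inside_Int_outside by blast
    have xH: "x \<notin> drawn H" "y \<notin> drawn H" using off[OF Z0(2)] x y by blast+
    have same: "u \<in> inside (drawn Z) \<longleftrightarrow> w \<in> inside (drawn Z)"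
      if "Z \<subseteq> H" "u \<in> ball m r" "w \<in> ball m r" "u \<notin> drawn H" "w \<notin> drawn H"
        "u \<in> inside (drawn (insert e Z0)) \<longleftrightarrow> w \<in> inside (drawn (insert e Z0))" for u w Z
    proof -
      have "connected_component (- drawn H) u w"
        using split_face[of a b K Z0 u w] K Z0 ab that conn_ball[of u w] by auto
      then have "connected_component (- drawn Z) u w"
        using drawn_mono[OF that(1)] by (meson Compl_anti_mono connected_component_of_subset)
      then show ?thesis
        using inside_same_component connected_component_sym by metis
    qed
    have "e \<in> Z \<longleftrightarrow> (x \<in> inside (drawn Z)) \<noteq> (y \<in> inside (drawn Z))" if Z: "Z \<subseteq> H" "jordan Z" for Z
    proof (cases "e \<in> Z")
      case False
      then have "drawn Z \<subseteq> drawn K" using Z K by (intro drawn_mono) auto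
      then have "connected_component (- drawn Z) x y"
        using conn_ball[OF x(1) y(1)] by (meson Compl_anti_mono connected_component_of_subset)
      then show ?thesis
        using False inside_same_component connected_component_sym by metis
    next
      case True
      obtain u w where u: "u \<in> ball m r" "u \<in> inside (drawn Z)" and w: "w \<in> ball m r" "w \<in> outside (drawn Z)"
        using near[OF Z(2) True] by blast
      then have "w \<notin> inside (drawn Z)" using inside_Int_outside by blast
      moreover have "u \<notin> drawn H" "w \<notin> drawn H" using off[OF Z(2) True] u w by blast+
      ultimately show ?thesis
        using same[OF Z(1) x(1) u(1)] same[OF Z(1) y(1) u(1)] same[OF Z(1) x(1) w(1)] same[OF Z(1) y(1) w(1)]
          xH x(2) yi u(2) True by blast
    qed
    then show ?thesis using xH by blast
  qed
qed

text \<open>The tree grows by one edge leaving \<open>S\<close>. Its arc has a connected complement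
  and meets the old drawing in at most one point, so by Janiszewski's theorem the complement of the
  drawing stays connected: a drawn tree has a single face.\<close>

lemma drawn_tree:
  assumes H: "H \<subseteq> E" "\<And>e. e \<in> H \<Longrightarrow> e \<subseteq> X" and a: "a \<in> X"
    and conn: "\<And>v. v \<in> X \<Longrightarrow> (adjacent H)\<^sup>*\<^sup>* a v"
  shows "\<lbrakk>1 \<le> k; k \<le> card X\<rbrakk> \<Longrightarrow> \<exists>S T. S \<subseteq> X \<and> card S = k \<and> a \<in> S \<and> T \<subseteq> H \<and> card T = k - 1 \<and>
    (\<forall>e\<in>T. e \<subseteq> S) \<and> (\<forall>v\<in>S. (adjacent T)\<^sup>*\<^sup>* a v) \<and> connected (- drawn T)"
proof (induction k rule: nat_induct_at_least)
  case base
  show ?case by (intro exI[of _ "{a}"] exI[of _ "{}"]) (use a in auto)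
next
  case (Suc k)
  then obtain S T where S: "S \<subseteq> X" "card S = k" "a \<in> S" and T: "T \<subseteq> H" "card T = k - 1" "\<forall>e\<in>T. e \<subseteq> S"
    and c: "\<forall>v\<in>S. (adjacent T)\<^sup>*\<^sup>* a v" "connected (- drawn T)" by auto
  have "S \<noteq> X" using S Suc by auto
  moreover have "X \<subseteq> reach H a" using conn by (auto simp: reach_def)
  ultimately have "\<not> reach H a \<subseteq> S" using S(1) by blast
  then obtain e where e: "e \<in> H" "e \<inter> S \<noteq> {}" "\<not> e \<subseteq> S" using reach_subset[OF S(3)] by blast
  obtain u v where uv: "e = {u, v}" "u \<in> S" "v \<notin> S"
    using e simple_graph_edgeE[OF simple, of e] H(1)
    by (metis Int_insert_left_if0 Int_empty_left insert_commute insert_subset empty_subsetI subsetD)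
  have eE: "e \<in> E" and TE: "T \<subseteq> E" and eT: "e \<notin> T" using e H T uv by auto
  have "path_image (g e) \<inter> path_image (g f) \<subseteq> {p u}" if "f \<in> T" for f
  proof -
    have "v \<notin> f" "f \<noteq> e" "f \<in> E" using that T uv TE by auto
    then show ?thesis using meets_edges[OF eE, of f] uv by auto
  qed
  then have "drawn T \<inter> path_image (g e) \<subseteq> {p u}" by (auto simp: drawn_def)
  then have int: "connected (drawn T \<inter> path_image (g e))" by (metis connected_empty connected_sing subset_singletonD)
  have arc: "arc (g e)" using arc_g eE by blast
  have "connected (- drawn (insert e T))"
    unfolding connected_iff_connected_component
  proof (intro ballI)
    fix x y assume "x \<in> - drawn (insert e T)" "y \<in> - drawn (insert e T)"
    then have "connected_component (- drawn T) x y" "connected_component (- path_image (g e)) x y"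
      using c(2) connected_arc_complement[OF arc] by (auto simp: connected_iff_connected_component)
    then have "connected_component (- (drawn T \<union> path_image (g e))) x y"
      using int arc by (intro Janiszewski compact_drawn TE) (auto simp: closed_arc_image)
    then show "connected_component (- drawn (insert e T)) x y"
      by (simp add: Un_commute)
  qed
  moreover have "(adjacent (insert e T))\<^sup>*\<^sup>* a w" if "w \<in> insert v S" for w
  proof -
    have "(adjacent (insert e T))\<^sup>*\<^sup>* a w" if "w \<in> S" for w
      using c(1) that conn_mono[of T a w "insert e T"] by blast
    moreover have "adjacent (insert e T) u v" by (simp add: adjacent_def uv)
    ultimately show ?thesis
      using \<open>w \<in> insert v S\<close> uv(2) by (metis insertE rtranclp.rtrancl_into_rtrancl)
  qed
  moreover have "v \<in> X" using e H uv by auto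
  ultimately show ?case
    using S T uv e eT Suc(1)
    by (intro exI[of _ "insert v S"] exI[of _ "insert e T"]) (auto simp del: drawn_insert)
qed

text \<open>Let \<open>N\<close> be the set of edges outside a spanning tree. Adding them one by one
  yields at most \<open>card N + 1\<close> faces. Conversely, \<open>w I\<close> collects the faces
  inside an odd number of the fundamental cycles of edges in \<open>I\<close>. Its boundary meets
  \<open>N\<close> in exactly \<open>I\<close>, so \<open>w\<close> embeds the subsets of
  \<open>N\<close> into the sets of faces without the outer face \<open>F0\<close>. Both counts
  together make \<open>w\<close> onto: every set of faces or its complement is some
  \<open>w I\<close>, from which evenness and dual connectedness are read off.\<close>

theorem plane_structure:
  assumes H: "H \<subseteq> E" "\<And>e. e \<in> H \<Longrightarrow> e \<subseteq> X" and X: "X \<noteq> {}"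
    and conn: "\<And>u v. u \<in> X \<Longrightarrow> v \<in> X \<Longrightarrow> (adjacent H)\<^sup>*\<^sup>* u v"
  obtains \<Phi> :: "complex set set" and L R where "plane_graph X H \<Phi> L R"
proof -
  obtain a where a: "a \<in> X" using X by blast
  have "1 \<le> card X" using X by (simp add: Suc_leI card_gt_0_iff)
  then obtain S T where "S \<subseteq> X" "card S = card X" "a \<in> S" and T: "T \<subseteq> H" "card T = card X - 1"
    and c: "\<forall>v\<in>S. (adjacent T)\<^sup>*\<^sup>* a v" "connected (- drawn T)"
    using drawn_tree[OF H a conn[OF a], of "card X"] by auto
  then have "S = X" by (simp add: card_subset_eq)
  with c have connT: "(adjacent T)\<^sup>*\<^sup>* u v" if "u \<in> X" "v \<in> X" for u v
    using that conn_sym by (meson rtranclp_trans)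
  have fin: "finite H" by simp
  define N where "N = H - T"
  have cardN: "card N + card X = card H + 1"
    using T card_Diff_subset[of T H] card_mono[of H T] \<open>1 \<le> card X\<close> by (auto simp: N_def)
  have TE: "T \<subseteq> E" using T H by auto
  have "\<exists>Z. jordan Z \<and> e \<in> Z \<and> Z \<subseteq> insert e T" if e: "e \<in> N" for e
  proof -
    obtain x y where xy: "e = {x, y}" using e simple_graph_edgeE[OF simple] H by (metis DiffD1 N_def subsetD)
    then have "x \<in> X" "y \<in> X" using e H by (auto simp: N_def)
    moreover have "{x, y} \<in> E" "{x, y} \<notin> T" using e H xy by (auto simp: N_def)
    ultimately obtain Z where "Z \<subseteq> T" "jordan (insert {x, y} Z)"
      using cycle_through_edge[of x y T] TE connT[of x y] by metis
    then show ?thesis using xy by (intro exI[of _ "insert e Z"]) auto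
  qed
  then obtain Z where Z: "\<And>e. e \<in> N \<Longrightarrow> jordan (Z e)" "\<And>e. e \<in> N \<Longrightarrow> e \<in> Z e" "\<And>e. e \<in> N \<Longrightarrow> Z e \<subseteq> insert e T"
    by metis
  then have ZH: "Z e \<subseteq> H" if "e \<in> N" for e using Z(3)[OF that] that T unfolding N_def by blast
  define \<Phi> where "\<Phi> = components (- drawn H)"
  have "\<forall>e. \<exists>x y. e \<in> H \<longrightarrow> x \<notin> drawn H \<and> y \<notin> drawn H \<and>
    (\<forall>Z\<subseteq>H. jordan Z \<longrightarrow> (e \<in> Z \<longleftrightarrow> (x \<in> inside (drawn Z)) \<noteq> (y \<in> inside (drawn Z))))"
    using edge_sides[OF H(1)] by blast
  then obtain x y where xy: "\<And>e. e \<in> H \<Longrightarrow> x e \<notin> drawn H" "\<And>e. e \<in> H \<Longrightarrow> y e \<notin> drawn H"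
    "\<And>e Z. e \<in> H \<Longrightarrow> Z \<subseteq> H \<Longrightarrow> jordan Z \<Longrightarrow>
      e \<in> Z \<longleftrightarrow> (x e \<in> inside (drawn Z)) \<noteq> (y e \<in> inside (drawn Z))"
    by metis
  define L where "L e = connected_component_set (- drawn H) (x e)" for e
  define R where "R e = connected_component_set (- drawn H) (y e)" for e
  have LR: "L e \<in> \<Phi>" "R e \<in> \<Phi>" "x e \<in> L e" "y e \<in> R e" if "e \<in> H" for e
    using xy(1,2)[OF that] by (auto simp: L_def R_def \<Phi>_def components_def)
  have side: "F \<subseteq> inside (drawn Z') \<longleftrightarrow> z \<in> inside (drawn Z')" if "F \<in> \<Phi>" "z \<in> F" "Z' \<subseteq> H" for F z Z'
  proof -
    have "w \<in> inside (drawn Z')" if "z \<in> inside (drawn Z')" "w \<in> F" for w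
    proof -
      have "connected_component (- drawn H) z w"
        using \<open>F \<in> \<Phi>\<close> \<open>z \<in> F\<close> \<open>w \<in> F\<close> component_of_point[of F "- drawn H" z] by (auto simp: \<Phi>_def)
      then have "connected_component (- drawn Z') z w"
        using drawn_mono[OF \<open>Z' \<subseteq> H\<close>] by (meson Compl_anti_mono connected_component_of_subset)
      then show ?thesis using inside_same_component that by blast
    qed
    then show ?thesis using that by blast
  qed
  have LR_side: "f \<in> Z e \<longleftrightarrow> (L f \<subseteq> inside (drawn (Z e))) \<noteq> (R f \<subseteq> inside (drawn (Z e)))"
    if "f \<in> H" "e \<in> N" for e f
    using xy(3)[OF that(1) ZH Z(1)] that side[OF LR(1) LR(3) ZH] side[OF LR(2) LR(4) ZH] by metis
  have count: "finite (components (- drawn (T \<union> M))) \<and> card (components (- drawn (T \<union> M))) \<le> card M + 1"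
    if "M \<subseteq> N" for M
  proof -
    have "finite M" by simp
    then show ?thesis using that
    proof (induction M)
      case empty
      have "- drawn T \<noteq> {}" using drawn_not_UNIV[OF TE] by blast
      then have "components (- drawn T) = {- drawn T}"
        using c(2) by (simp add: components_eq_sing_iff)
      then show ?case by simp
    next
      case (insert e M)
      then obtain u v where uv: "e = {u, v}" using simple_graph_edgeE[OF simple] H by (metis DiffD1 N_def insert_subset subsetD)
      have e: "e \<in> H" "e \<notin> T" using insert by (auto simp: N_def)
      then have "u \<in> X" "v \<in> X" using H uv by auto
      then have "(adjacent (T \<union> M))\<^sup>*\<^sup>* u v" using connT conn_mono[of T u v "T \<union> M"] by blast
      moreover have "{u, v} \<in> E" "{u, v} \<notin> T \<union> M" "T \<union> M \<subseteq> E"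
        using e insert uv H TE by (auto simp: N_def)
      ultimately have "finite (components (- drawn (insert {u, v} (T \<union> M))))
          \<and> card (components (- drawn (insert {u, v} (T \<union> M)))) \<le> card (components (- drawn (T \<union> M))) + 1"
        using insert by (intro split_face_count) auto
      moreover have "T \<union> insert e M = insert {u, v} (T \<union> M)" using uv by simp
      moreover have "card (insert e M) = Suc (card M)" using insert by simp
      ultimately show ?case using insert by (metis add_Suc add_le_mono1 insert_subset le_trans Suc_eq_plus1)
    qed
  qed
  have "T \<union> N = H" using T by (auto simp: N_def)
  then have finF: "finite \<Phi>" and cardF: "card \<Phi> \<le> card N + 1"
    using count[of N] by (auto simp: \<Phi>_def)
  have "bounded (drawn H)" using compact_drawn[OF H(1)] compact_imp_bounded by blast
  then obtain r where "\<forall>x\<in>drawn H. norm x \<le> r" by (auto simp: bounded_iff)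
  then have r: "drawn H \<subseteq> cball 0 r" by auto
  obtain z :: complex where z: "z \<notin> cball 0 r" using bounded_cball[of "0::complex" r] not_bounded_UNIV by (metis UNIV_eq_I)
  \<comment> \<open>The face of a point outside a disc around the drawing. It lies inside no cycle,
    hence never belongs to \<open>w I\<close>.\<close>
  define F0 where "F0 = connected_component_set (- drawn H) z"
  have F0: "F0 \<in> \<Phi>" "z \<in> F0" using z r by (auto simp: F0_def \<Phi>_def components_def)
  have outer: "\<not> F0 \<subseteq> inside (drawn Z')" if "Z' \<subseteq> H" for Z'
  proof -
    have "drawn Z' \<subseteq> cball 0 r" using drawn_mono[OF that] r by blast
    then have "- cball 0 r \<subseteq> outside (drawn Z')" by (intro outside_subset_convex) auto
    then show ?thesis using z F0(2) inside_Int_outside by blast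
  qed
  define w where "w I = {F\<in>\<Phi>. odd (card {e\<in>I. F \<subseteq> inside (drawn (Z e))})}" for I
  have cut_w: "dual_cut H L R (w I) = {f\<in>H. odd (card {e\<in>I. f \<in> Z e})}" if I: "I \<subseteq> N" for I
  proof -
    have "(L f \<in> w I) \<noteq> (R f \<in> w I) \<longleftrightarrow> odd (card {e\<in>I. f \<in> Z e})" if f: "f \<in> H" for f
    proof -
      let ?l = "\<lambda>e. L f \<subseteq> inside (drawn (Z e))" and ?r = "\<lambda>e. R f \<subseteq> inside (drawn (Z e))"
      have "odd (card {e\<in>I. f \<in> Z e}) = odd (\<Sum>e\<in>I. of_bool (f \<in> Z e) :: nat)"
        by (simp add: card_filter_sum)
      also have "\<dots> = odd (\<Sum>e\<in>I. of_bool (?l e) + of_bool (?r e) :: nat)"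
      proof -
        have "even (\<Sum>e\<in>I. of_bool (f \<in> Z e) :: nat) = even (\<Sum>e\<in>I. of_bool (?l e) + of_bool (?r e) :: nat)"
        proof (rule even_sum_cong)
          fix e assume "e \<in> I"
          then have "e \<in> N" using I by blast
          then show "even (of_bool (f \<in> Z e) :: nat) = even (of_bool (?l e) + of_bool (?r e) :: nat)"
            using LR_side[OF f] by (simp add: of_bool_def)
        qed
        then show ?thesis by blast
      qed
      also have "\<dots> = odd (card {e\<in>I. ?l e} + card {e\<in>I. ?r e})"
        by (simp add: sum.distrib card_filter_sum)
      finally show ?thesis using f LR[OF f] by (auto simp: w_def)
    qed
    then show ?thesis by (auto simp: dual_cut_def)
  qed
  have cut_w_N: "dual_cut H L R (w I) \<inter> N = I" if I: "I \<subseteq> N" for I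
  proof -
    have "odd (card {e\<in>I. f \<in> Z e}) \<longleftrightarrow> f \<in> I" if "f \<in> N" for f
    proof -
      have "f \<in> Z e \<longleftrightarrow> f = e" if "e \<in> I" for e
        using \<open>f \<in> N\<close> that Z(2,3)[of e] I unfolding N_def by blast
      then have "{e\<in>I. f \<in> Z e} = (if f \<in> I then {f} else {})" by auto
      then show ?thesis by simp
    qed
    moreover have "N \<subseteq> H" by (auto simp: N_def)
    ultimately show ?thesis using I unfolding cut_w[OF I] by blast
  qed
  have w_sub: "w I \<subseteq> \<Phi> - {F0}" if I: "I \<subseteq> N" for I
  proof -
    have none: "{e\<in>I. F0 \<subseteq> inside (drawn (Z e))} = {}" using outer ZH I by blast
    have "F0 \<notin> w I" unfolding w_def mem_Collect_eq none by simp
    then show ?thesis by (auto simp: w_def)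
  qed
  have inj_w: "inj_on w (Pow N)" by (rule inj_onI) (metis PowD cut_w_N)
  have img_w: "w ` Pow N \<subseteq> Pow (\<Phi> - {F0})" using w_sub by auto
  have "card (Pow N) \<le> card (Pow (\<Phi> - {F0}))"
    using card_inj_on_le[OF inj_w img_w] finF by simp
  then have "card N \<le> card \<Phi> - 1" using finF F0 by (simp add: card_Pow)
  moreover have "card \<Phi> \<ge> 1" using finF F0 by (metis One_nat_def Suc_leI card_gt_0_iff empty_iff)
  ultimately have cardF': "card \<Phi> = card N + 1" using cardF by linarith
  have "w ` Pow N = Pow (\<Phi> - {F0})"
    using img_w finF F0 cardF' by (intro card_subset_eq) (auto simp: card_image[OF inj_w] card_Pow)
  then have surj_w: "\<exists>I\<subseteq>N. A = w I" if "A \<subseteq> \<Phi> - {F0}" for A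
    using that by (metis PowD PowI imageE)
  \<comment> \<open>This serves the sets of faces that contain \<open>F0\<close>, which are not of
    the form \<open>w I\<close>.\<close>
  have cut_compl: "dual_cut H L R (\<Phi> - A) = dual_cut H L R A" for A
    using LR by (auto simp: dual_cut_def)
  have cut_I: "\<exists>I\<subseteq>N. dual_cut H L R A = dual_cut H L R (w I) \<and> (A = w I \<or> \<Phi> - A = w I)" if "A \<subseteq> \<Phi>" for A
  proof (cases "F0 \<in> A")
    case True
    then obtain I where "I \<subseteq> N" "\<Phi> - A = w I" using surj_w[of "\<Phi> - A"] by auto
    then show ?thesis using cut_compl by metis
  next
    case False
    then show ?thesis using surj_w[of A] that by auto
  qed
  have "plane_graph X H \<Phi> L R"
  proof
    show "simple_graph H" using simple H by (auto simp: simple_graph_def)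
    show "card \<Phi> + card X = card H + 2" using cardF' cardN by linarith
  next
    fix A assume "A \<subseteq> \<Phi>"
    then obtain I where I: "I \<subseteq> N" "dual_cut H L R A = dual_cut H L R (w I)"
      using cut_I by blast
    note I = I(1) I(2)[unfolded cut_w[OF I(1)]]
    show "even_set (dual_cut H L R A)"
      unfolding even_set_def
    proof
      fix v
      let ?W = "{f\<in>H. v \<in> f}"
      have "{f\<in>dual_cut H L R A. v \<in> f} = {f\<in>?W. odd (card {e\<in>I. f \<in> Z e})}" using I by auto
      then have "even (deg_in (dual_cut H L R A) v) = even (\<Sum>f\<in>?W. of_bool (odd (card {e\<in>I. f \<in> Z e})) :: nat)"
        unfolding deg_in_def by (simp only: card_filter_sum[OF finite])
      also have "\<dots> = even (\<Sum>f\<in>?W. card {e\<in>I. f \<in> Z e})" by (rule even_sum_cong) auto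
      also have "(\<Sum>f\<in>?W. card {e\<in>I. f \<in> Z e}) = (\<Sum>f\<in>?W. \<Sum>e\<in>I. of_bool (f \<in> Z e))"
        by (simp add: card_filter_sum)
      also have "\<dots> = (\<Sum>e\<in>I. \<Sum>f\<in>?W. of_bool (f \<in> Z e))" by (rule sum.swap)
      also have "\<dots> = (\<Sum>e\<in>I. deg_in (Z e) v)"
      proof (rule sum.cong)
        fix e assume "e \<in> I"
        then have "{f\<in>Z e. v \<in> f} = {f\<in>?W. f \<in> Z e}" using ZH I by auto
        then show "(\<Sum>f\<in>?W. of_bool (f \<in> Z e)) = deg_in (Z e) v"
          unfolding deg_in_def by (simp only: card_filter_sum[OF finite])
      qed simp
      also have "even \<dots>"
        using Z(1) I by (intro dvd_sum) (auto simp: jordan_def even_set_def)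
      finally show "even (deg_in (dual_cut H L R A) v)" by simp
    qed
    show "A = {} \<or> A = \<Phi>" if "dual_cut H L R A = {}"
    proof -
      obtain I where I: "I \<subseteq> N" "dual_cut H L R A = dual_cut H L R (w I)" "A = w I \<or> \<Phi> - A = w I"
        using cut_I[OF \<open>A \<subseteq> \<Phi>\<close>] by blast
      then have "I = {}" using cut_w_N[OF I(1)] that by simp
      then have "w I = {}" by (simp add: w_def)
      then show ?thesis using I \<open>A \<subseteq> \<Phi>\<close> by blast
    qed
  next
    fix D a b assume D: "D \<subseteq> H" "{a, b} \<in> D" "(adjacent (H - D))\<^sup>*\<^sup>* a b"
    have "{a, b} \<in> E" "H - D \<subseteq> E" "{a, b} \<notin> H - D" using D H(1) by auto
    from cycle_through_edge[OF this D(3)] obtain Z' where Z': "Z' \<subseteq> H - D" "jordan (insert {a, b} Z')"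
      by metis
    \<comment> \<open>The faces inside the cycle. Apart from \<open>ab\<close> the cycle avoids
      \<open>D\<close>, so the boundary of \<open>A\<close> meets \<open>D\<close> in
      \<open>ab\<close> only.\<close>
    define A where "A = {F\<in>\<Phi>. F \<subseteq> inside (drawn (insert {a, b} Z'))}"
    have sub: "insert {a, b} Z' \<subseteq> H" using Z' D by auto
    have "dual_cut H L R A = insert {a, b} Z'"
    proof -
      have "f \<in> insert {a, b} Z' \<longleftrightarrow> (L f \<in> A) \<noteq> (R f \<in> A)" if "f \<in> H" for f
        using xy(3)[OF that sub Z'(2)] side[OF LR(1) LR(3) sub] side[OF LR(2) LR(4) sub] that LR[OF that]
        unfolding A_def by blast
      then show ?thesis using sub unfolding dual_cut_def by blast
    qed
    then show "\<exists>A\<subseteq>\<Phi>. dual_cut H L R A \<inter> D = {{a, b}}"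
      using D Z' by (intro exI[of _ A]) (auto simp: A_def simp del: drawn_insert)
  qed (use H conn finF LR in auto)
  then show ?thesis using that by blast
qed

end

section \<open>Edge bounds from face sizes\<close>

lemma deg_in_empty: "deg_in {} v = 0"
  by (simp add: deg_in_def)

lemma even_setD_other:
  fixes W :: "'v::finite set set"
  assumes "simple_graph W" "even_set W" "e \<in> W" "v \<in> e"
  obtains c where "{v, c} \<in> W" "{v, c} \<noteq> e" "c \<noteq> v"
proof -
  have "even (card {f\<in>W. v \<in> f})" using assms(2) by (simp add: even_set_def deg_in_def)
  then have "{f\<in>W. v \<in> f} \<noteq> {e}" by (metis is_singletonI is_singleton_altdef odd_one)
  then obtain f where f: "f \<in> W" "v \<in> f" "f \<noteq> e" using assms(3,4) by blast
  have "card f = 2" using assms(1) f by (auto simp: simple_graph_def)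
  then obtain c where "f = {v, c}" "c \<noteq> v" using f(2) by (auto simp: card_2_iff)
  then show ?thesis using that f by blast
qed

lemma even_set_Diff:
  fixes W :: "'v::finite set set"
  assumes "even_set W" "even_set T" "T \<subseteq> W"
  shows "even_set (W - T)"
  unfolding even_set_def
proof
  fix v
  have "{e\<in>W. v \<in> e} = {e\<in>W - T. v \<in> e} \<union> {e\<in>T. v \<in> e}" using assms(3) by auto
  then have "deg_in W v = deg_in (W - T) v + deg_in T v"
    unfolding deg_in_def by (simp add: card_Un_disjoint disjoint_iff)
  then show "even (deg_in (W - T) v)"
    using assms(1,2) unfolding even_set_def by (metis even_add)
qed

text \<open>At both ends of an edge an even set has a second edge. The outer ends \<open>c\<close>
  and \<open>d\<close> of the resulting path may coincide, which is the case of a triangle. The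
  classifications below start from here.\<close>

lemma even_set_path:
  fixes W :: "'v::finite set set"
  assumes W: "simple_graph W" "even_set W" "W \<noteq> {}"
  obtains a b c d where "{a, b} \<in> W" "{a, c} \<in> W" "{b, d} \<in> W" "a \<noteq> b" "c \<noteq> a" "c \<noteq> b" "d \<noteq> a" "d \<noteq> b"
proof -
  obtain e where e: "e \<in> W" using W(3) by blast
  obtain a b where ab: "a \<noteq> b" "e = {a, b}" using simple_graph_edgeE[OF W(1) e] .
  obtain c where c: "{a, c} \<in> W" "{a, c} \<noteq> e" "c \<noteq> a" using even_setD_other[OF W(1,2) e, of a] ab by blast
  obtain d where d: "{b, d} \<in> W" "{b, d} \<noteq> e" "d \<noteq> b" using even_setD_other[OF W(1,2) e, of b] ab by blast
  show ?thesis using that[of a b c d] e ab c d by blast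
qed

lemma even_set_card_ge_3:
  fixes W :: "'v::finite set set"
  assumes W: "simple_graph W" "even_set W" "W \<noteq> {}"
  shows "card W \<ge> 3"
proof -
  obtain a b c d where *: "{a, b} \<in> W" "{a, c} \<in> W" "{b, d} \<in> W" "a \<noteq> b" "c \<noteq> a" "c \<noteq> b" "d \<noteq> a" "d \<noteq> b"
    using even_set_path[OF W] .
  then have "card {{a, b}, {a, c}, {b, d}} = 3" by (simp add: doubleton_eq_iff)
  then show ?thesis using card_mono[of W "{{a, b}, {a, c}, {b, d}}"] * by simp
qed

lemma even_triangle:
  assumes "a \<noteq> b" "b \<noteq> c" "a \<noteq> c"
  shows "even_set {{a, b}, {a, c}, {b, c::'v::finite}}"
proof -
  have "deg_in {{a, b}, {a, c}, {b, c}} v = of_bool (v \<in> {a, b}) + of_bool (v \<in> {a, c}) + of_bool (v \<in> {b, c})" for v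
    using assms by (auto simp add: deg_in_insert deg_in_empty doubleton_eq_iff)
  then show ?thesis using assms by (simp add: even_set_def)
qed

lemma even_4_cycle:
  assumes "distinct [a, b, c, d]"
  shows "even_set {{a, b}, {b, c}, {c, d}, {d, a::'v::finite}}"
proof -
  have "deg_in {{a, b}, {b, c}, {c, d}, {d, a}} v
      = of_bool (v \<in> {a, b}) + of_bool (v \<in> {b, c}) + of_bool (v \<in> {c, d}) + of_bool (v \<in> {d, a})" for v
    using assms by (auto simp add: deg_in_insert deg_in_empty doubleton_eq_iff)
  then show ?thesis using assms by (auto simp: even_set_def)
qed

lemma even_set_card_3:
  fixes W :: "'v::finite set set"
  assumes W: "simple_graph W" "even_set W" "card W = 3"
  obtains a b c where "a \<noteq> b" "b \<noteq> c" "a \<noteq> c" "W = {{a, b}, {a, c}, {b, c}}"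
proof -
  have "W \<noteq> {}" using W by auto
  then obtain a b c d where *: "{a, b} \<in> W" "{a, c} \<in> W" "{b, d} \<in> W" "a \<noteq> b" "c \<noteq> a" "c \<noteq> b" "d \<noteq> a" "d \<noteq> b"
    by (rule even_set_path[OF W(1,2)])
  then have "card {{a, b}, {a, c}, {b, d}} = 3" by (simp add: doubleton_eq_iff)
  then have eq: "{{a, b}, {a, c}, {b, d}} = W"
    using * W by (intro card_subset_eq) auto
  obtain x where x: "{c, x} \<in> W" "{c, x} \<noteq> {a, c}" "x \<noteq> c" using even_setD_other[OF W(1,2) *(2), of c] by blast
  then have "{c, x} \<in> {{a, b}, {b, d}}" using eq by blast
  then have "c = d" using * by (auto simp: doubleton_eq_iff)
  then show ?thesis using that[of a b c] * eq by simp
qed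

lemma even_set_card_4:
  fixes W :: "'v::finite set set"
  assumes W: "simple_graph W" "even_set W" "card W = 4"
  obtains a b c d where "distinct [a, b, c, d]" "W = {{a, b}, {b, c}, {c, d}, {d, a}}"
proof -
  have "W \<noteq> {}" using W by auto
  then obtain a b c d where *: "{a, b} \<in> W" "{a, c} \<in> W" "{b, d} \<in> W" "a \<noteq> b" "c \<noteq> a" "c \<noteq> b" "d \<noteq> a" "d \<noteq> b"
    by (rule even_set_path[OF W(1,2)])
  \<comment> \<open>Removing a triangle would leave a single edge as an even set.\<close>
  have cd: "c \<noteq> d"
  proof
    assume "c = d"
    define T where "T = {{a, b}, {a, c}, {b, c}}"
    have T: "T \<subseteq> W" "even_set T" using * \<open>c = d\<close> even_triangle[of a b c] by (auto simp: T_def)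
    moreover have "card T = 3" using * by (simp add: T_def doubleton_eq_iff)
    ultimately have "card (W - T) = 1" using W by (simp add: card_Diff_subset)
    moreover from this have "W - T \<noteq> {}" by force
    moreover have "simple_graph (W - T)" using W by (simp add: simple_graph_def)
    ultimately show False
      using even_set_card_ge_3[of "W - T"] even_set_Diff[OF W(2) T(2,1)] by simp
  qed
  obtain x where x: "{c, x} \<in> W" "{c, x} \<noteq> {a, c}" "x \<noteq> c" using even_setD_other[OF W(1,2) *(2), of c] by blast
  have "card {{a, b}, {a, c}, {b, d}, {c, x}} = 4" using * cd x by (auto simp: doubleton_eq_iff)
  then have eq: "{{a, b}, {a, c}, {b, d}, {c, x}} = W"
    using * x W by (intro card_subset_eq) auto
  obtain y where y: "{d, y} \<in> W" "{d, y} \<noteq> {b, d}" "y \<noteq> d" using even_setD_other[OF W(1,2) *(3), of d] by blast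
  then have "{d, y} \<in> {{a, b}, {a, c}, {c, x}}" using eq by blast
  then have "x = d" using * cd by (auto simp: doubleton_eq_iff)
  then have "W = {{a, b}, {b, d}, {d, c}, {c, a}}" using eq by (simp add: insert_commute)
  then show ?thesis using that[of a b d c] * cd by auto
qed

lemma even_set_card_5:
  fixes W :: "'v::finite set set"
  assumes W: "simple_graph W" "even_set W" "card W = 5"
  obtains a b c d e where "distinct [a, b, c, d, e]" "W = {{a, b}, {b, c}, {c, d}, {d, e}, {e, a}}"
proof -
  \<comment> \<open>Removing a triangle or a 4-cycle would leave two edges or one as an even set,
    but a nonempty even set has at least three. Hence the path cannot close early.\<close>
  have no: "\<not> (T \<subseteq> W \<and> even_set T \<and> card T \<in> {3, 4})" for T
  proof
    assume T: "T \<subseteq> W \<and> even_set T \<and> card T \<in> {3, 4}"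
    then have "card (W - T) \<in> {1, 2}" using W by (auto simp: card_Diff_subset)
    moreover from this have "W - T \<noteq> {}" by force
    moreover have "simple_graph (W - T)" using W by (simp add: simple_graph_def)
    ultimately show False
      using even_set_card_ge_3[of "W - T"] even_set_Diff[OF W(2), of T] T by auto
  qed
  have "W \<noteq> {}" using W by auto
  then obtain a b c d where *: "{a, b} \<in> W" "{a, c} \<in> W" "{b, d} \<in> W" "a \<noteq> b" "c \<noteq> a" "c \<noteq> b" "d \<noteq> a" "d \<noteq> b"
    by (rule even_set_path[OF W(1,2)])
  have no3: "{b, c} \<notin> W"
  proof
    assume "{b, c} \<in> W"
    moreover have "card {{a, b}, {a, c}, {b, c}} = 3" using * by (simp add: doubleton_eq_iff)
    ultimately show False
      using no[of "{{a, b}, {a, c}, {b, c}}"] even_triangle[of a b c] * by simp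
  qed
  then have cd: "c \<noteq> d" using * by blast
  have no4: "{c, d} \<notin> W"
  proof
    assume "{c, d} \<in> W"
    moreover have "card {{a, b}, {b, d}, {d, c}, {c, a}} = 4" using * cd by (simp add: doubleton_eq_iff)
    ultimately show False
      using no[of "{{a, b}, {b, d}, {d, c}, {c, a}}"] even_4_cycle[of a b d c] * cd
      by (simp add: insert_commute)
  qed
  obtain e where e: "{c, e} \<in> W" "{c, e} \<noteq> {a, c}" "e \<noteq> c" using even_setD_other[OF W(1,2) *(2), of c] by blast
  have en: "e \<noteq> a" "e \<noteq> b" "e \<noteq> d" using e no3 no4 by (auto simp: insert_commute)
  obtain y where y: "{d, y} \<in> W" "{d, y} \<noteq> {b, d}" "y \<noteq> d" using even_setD_other[OF W(1,2) *(3), of d] by blast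
  obtain z where z: "{e, z} \<in> W" "{e, z} \<noteq> {c, e}" "z \<noteq> e" using even_setD_other[OF W(1,2) e(1), of e] by blast
  have "card {{a, b}, {a, c}, {b, d}, {c, e}, {d, y}} = 5" using * cd e en y by (auto simp: doubleton_eq_iff)
  then have eq: "{{a, b}, {a, c}, {b, d}, {c, e}, {d, y}} = W"
    using * e y W by (intro card_subset_eq) auto
  then have "{e, z} \<in> {{a, b}, {a, c}, {b, d}, {d, y}}" using z by blast
  then have "y = e" using * e(3) en by (auto simp: doubleton_eq_iff)
  then have "W = {{a, b}, {b, d}, {d, e}, {e, c}, {c, a}}" using eq by (simp add: insert_commute)
  then show ?thesis using that[of a b d e c] * cd en e by auto
qed

section \<open>Forbidden cycles as forbidden even sets\<close>

lemma cycle_freeD: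
  assumes "cycle_free m E" "distinct xs" "length xs = m"
  shows "\<exists>i<m. {xs ! i, xs ! (Suc i mod m)} \<notin> E"
proof -
  have "inj_on ((!) xs) {..<m}" using assms(2,3) by (intro inj_on_nth) auto
  then show ?thesis using assms(1) unfolding cycle_free_def adjacent_def by blast
qed

lemma cycle_free_3D:
  assumes "cycle_free 3 E" "W \<subseteq> E" "simple_graph W" "even_set W"
  shows "card W \<noteq> 3"
proof
  assume "card W = 3"
  then obtain a b c where abc: "a \<noteq> b" "b \<noteq> c" "a \<noteq> c" "W = {{a, b}, {a, c}, {b, c}}"
    by (rule even_set_card_3[OF assms(3,4)])
  have E: "{a, b} \<in> E" "{b, c} \<in> E" "{c, a} \<in> E"
    using assms(2) unfolding abc(4) by (simp_all add: insert_commute[of c a])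
  have "distinct [a, b, c]" using abc by simp
  then obtain i where i: "i < 3" "{[a, b, c] ! i, [a, b, c] ! (Suc i mod 3)} \<notin> E"
    using cycle_freeD[OF assms(1), of "[a, b, c]"] by auto
  from i(1) have "i = 0 \<or> i = 1 \<or> i = 2" by linarith
  then show False using i(2) E by (elim disjE) simp_all
qed

lemma cycle_free_4D:
  assumes "cycle_free 4 E" "W \<subseteq> E" "simple_graph W" "even_set W"
  shows "card W \<noteq> 4"
proof
  assume "card W = 4"
  then obtain a b c d where W: "distinct [a, b, c, d]" "W = {{a, b}, {b, c}, {c, d}, {d, a}}"
    by (rule even_set_card_4[OF assms(3,4)])
  have E: "{a, b} \<in> E" "{b, c} \<in> E" "{c, d} \<in> E" "{d, a} \<in> E"
    using assms(2) unfolding W(2) by simp_all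
  from W(1) obtain i where i: "i < 4" "{[a, b, c, d] ! i, [a, b, c, d] ! (Suc i mod 4)} \<notin> E"
    using cycle_freeD[OF assms(1), of "[a, b, c, d]"] by auto
  from i(1) have "i = 0 \<or> i = 1 \<or> i = 2 \<or> i = 3" by linarith
  then show False using i(2) E by (elim disjE) simp_all
qed

lemma cycle_free_5D:
  assumes "cycle_free 5 E" "W \<subseteq> E" "simple_graph W" "even_set W"
  shows "card W \<noteq> 5"
proof
  assume "card W = 5"
  then obtain a b c d e where W: "distinct [a, b, c, d, e]" "W = {{a, b}, {b, c}, {c, d}, {d, e}, {e, a}}"
    by (rule even_set_card_5[OF assms(3,4)])
  have E: "{a, b} \<in> E" "{b, c} \<in> E" "{c, d} \<in> E" "{d, e} \<in> E" "{e, a} \<in> E"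
    using assms(2) unfolding W(2) by simp_all
  from W(1) obtain i where i: "i < 5" "{[a, b, c, d, e] ! i, [a, b, c, d, e] ! (Suc i mod 5)} \<notin> E"
    using cycle_freeD[OF assms(1), of "[a, b, c, d, e]"] by auto
  from i(1) have "i = 0 \<or> i = 1 \<or> i = 2 \<or> i = 3 \<or> i = 4" by linarith
  then show False using i(2) E by (elim disjE) simp_all
qed

section \<open>Counting edges on face boundaries\<close>

context plane_graph
begin

abbreviation cut :: "'f set \<Rightarrow> 'v set set" where
  "cut A \<equiv> dual_cut H L R A"

abbreviation boundary :: "'f \<Rightarrow> 'v set set" where
  "boundary F \<equiv> cut {F}"

lemma cut_subset: "cut A \<subseteq> H"
  by (auto simp: dual_cut_def)

lemma simple_cut: "simple_graph (cut A)"
  using simple by (auto simp: dual_cut_def simple_graph_def)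

lemma mem_boundary: "e \<in> boundary F \<longleftrightarrow> e \<in> H \<and> (L e = F) \<noteq> (R e = F)"
  by (auto simp: dual_cut_def)

text \<open>The boundary of a disjoint union is the symmetric difference of the boundaries. The
  length of the boundary of merged faces is always computed from this identity.\<close>

lemma card_cut_Un:
  assumes "A \<inter> B = {}"
  shows "card (cut (A \<union> B)) + 2 * card (cut A \<inter> cut B) = card (cut A) + card (cut B)"
proof -
  have eq: "cut (A \<union> B) = (cut A - cut B) \<union> (cut B - cut A)"
    using assms by (auto simp: dual_cut_def)
  have "card (cut (A \<union> B)) = card (cut A - cut B) + card (cut B - cut A)"
    unfolding eq by (rule card_Un_disjoint) auto
  moreover have "card (cut A - cut B) + card (cut A \<inter> cut B) = card (cut A)"
    by (metis card_Diff_subset_Int card_mono finite inf_le1 le_add_diff_inverse2)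
  moreover have "card (cut B - cut A) + card (cut A \<inter> cut B) = card (cut B)"
    by (metis card_Diff_subset_Int card_mono finite inf_le1 inf_commute le_add_diff_inverse2)
  ultimately show ?thesis by linarith
qed

text \<open>Double counting with a weight on each face. An edge with the same face on both sides
  lies in no boundary and contributes nothing. Constant weights give the simple bounds,
  \<open>face_share\<close> the discharging.\<close>

lemma sum_boundary:
  fixes s :: "'f \<Rightarrow> real"
  shows "(\<Sum>F\<in>\<Phi>. s F * card (boundary F)) = (\<Sum>e\<in>H. if L e = R e then 0 else s (L e) + s (R e))"
proof -
  have "(\<Sum>F\<in>\<Phi>. s F * card (boundary F)) = (\<Sum>F\<in>\<Phi>. \<Sum>e\<in>H. s F * of_bool ((L e = F) \<noteq> (R e = F)))"
    by (simp add: dual_cut_def card_filter_sum sum_distrib_left mult.commute)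
  also have "\<dots> = (\<Sum>e\<in>H. \<Sum>F\<in>\<Phi>. s F * of_bool ((L e = F) \<noteq> (R e = F)))"
    by (rule sum.swap)
  also have "\<dots> = (\<Sum>e\<in>H. if L e = R e then 0 else s (L e) + s (R e))"
  proof (rule sum.cong)
    fix e assume e: "e \<in> H"
    show "(\<Sum>F\<in>\<Phi>. s F * of_bool ((L e = F) \<noteq> (R e = F))) = (if L e = R e then 0 else s (L e) + s (R e))"
    proof (cases "L e = R e")
      case False
      have "\<Phi> \<inter> {F. (L e = F) \<noteq> (R e = F)} = {L e, R e}" using sides[OF e] False by auto
      then show ?thesis using False finite_faces by simp
    qed simp
  qed simp
  finally show ?thesis .
qed

lemma sum_card_boundary: "(\<Sum>F\<in>\<Phi>. card (boundary F)) \<le> 2 * card H"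
proof -
  have "real (\<Sum>F\<in>\<Phi>. card (boundary F)) = (\<Sum>e\<in>H. if L e = R e then 0 else 1 + 1)"
    using sum_boundary[of "\<lambda>_. 1"] by (simp del: sum_constant)
  also have "\<dots> \<le> (\<Sum>e\<in>H. 2)" by (rule sum_mono) simp
  also have "\<dots> = real (2 * card H)" by simp
  finally show ?thesis by (rule of_nat_le_iff[THEN iffD1])
qed

lemma boundary_nonempty: "card \<Phi> \<ge> 2 \<Longrightarrow> F \<in> \<Phi> \<Longrightarrow> boundary F \<noteq> {}"
  using dual_conn[of "{F}"] by force

lemma even_boundary: "F \<in> \<Phi> \<Longrightarrow> even_set (boundary F)"
  by (rule even_cut) simp

lemma card_boundary_ge_3: "card \<Phi> \<ge> 2 \<Longrightarrow> F \<in> \<Phi> \<Longrightarrow> card (boundary F) \<ge> 3"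
  using even_set_card_ge_3[OF simple_cut even_boundary boundary_nonempty] .

text \<open>A single face has an empty boundary, and Euler's formula then gives the edge number of a
  tree; hence the first alternative. With more faces, \<open>k\<close> edges on each boundary and
  two sides of each edge give the second.\<close>

lemma edge_bound:
  assumes "\<And>F. F \<in> \<Phi> \<Longrightarrow> card \<Phi> \<ge> 2 \<Longrightarrow> card (boundary F) \<ge> k"
  shows "card H + 1 \<le> card X \<or> k * (card H + 2) \<le> 2 * card H + k * card X"
proof (cases "card \<Phi> \<ge> 2")
  case True
  have "k * card \<Phi> = (\<Sum>F\<in>\<Phi>. k)" by simp
  also have "\<dots> \<le> (\<Sum>F\<in>\<Phi>. card (boundary F))" using assms True by (intro sum_mono) auto
  also have "\<dots> \<le> 2 * card H" by (rule sum_card_boundary)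
  finally have "k * card \<Phi> \<le> 2 * card H" .
  then show ?thesis unfolding euler[symmetric] by (simp add: algebra_simps)
next
  case False
  then show ?thesis using euler by linarith
qed

lemma planar_edges:
  assumes "card X \<ge> 3"
  shows "card H + 6 \<le> 3 * card X"
proof -
  have "card H + 1 \<le> card X \<or> 3 * (card H + 2) \<le> 2 * card H + 3 * card X"
    by (rule edge_bound) (rule card_boundary_ge_3)
  then show ?thesis using assms by (elim disjE) simp_all
qed

lemma triangle_free_edges:
  assumes "cycle_free 3 H" "card X \<ge> 3"
  shows "card H + 4 \<le> 2 * card X"
proof -
  have "card (boundary F) \<ge> 4" if "F \<in> \<Phi>" "card \<Phi> \<ge> 2" for F
    using card_boundary_ge_3[OF that(2,1)] cycle_free_3D[OF assms(1) cut_subset simple_cut even_boundary[OF that(1)]]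
    by linarith
  then have "card H + 1 \<le> card X \<or> 4 * (card H + 2) \<le> 2 * card H + 4 * card X"
    by (rule edge_bound)
  then show ?thesis using assms(2) by (elim disjE) simp_all
qed

text \<open>Two triangular faces cannot share an edge: with one common edge their union is bounded
  by four edges, with more by too few for a nonempty even set, unless the two are all faces. So t
  triangles use 3 t different edges, the other faces have at least five edges each, and 5 f <= 2 e +
  2 t follows.\<close>

lemma C4_free_edges:
  assumes C4: "cycle_free 4 H" and n: "card X \<ge> 4"
  shows "7 * card H + 30 \<le> 15 * card X"
proof (cases "card \<Phi> \<ge> 3")
  case True
  define T where "T = {F\<in>\<Phi>. card (boundary F) = 3}"
  have disj: "boundary F \<inter> boundary G = {}" if FG: "F \<in> T" "G \<in> T" "F \<noteq> G" for F G
  proof (rule ccontr)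
    assume ne: "boundary F \<inter> boundary G \<noteq> {}"
    have sub: "{F, G} \<subseteq> \<Phi>" using FG by (auto simp: T_def)
    have "card (boundary F \<inter> boundary G) \<ge> 1" using ne by (simp add: Suc_leI card_gt_0_iff)
    moreover have "card (cut {F, G}) + 2 * card (boundary F \<inter> boundary G) = 6"
      using card_cut_Un[of "{F}" "{G}"] FG by (simp add: T_def insert_commute)
    moreover have "card (cut {F, G}) \<noteq> 4"
      using cycle_free_4D[OF C4 cut_subset simple_cut even_cut[OF sub]] .
    moreover have "cut {F, G} \<noteq> {}"
    proof
      assume "cut {F, G} = {}"
      then have "\<Phi> = {F, G}" using dual_conn[OF sub] by auto
      then show False using True FG by simp
    qed
    then have "card (cut {F, G}) \<ge> 3" using even_set_card_ge_3[OF simple_cut even_cut[OF sub]] by blast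
    moreover have "k \<ge> 1 \<Longrightarrow> m + 2 * k = 6 \<Longrightarrow> m \<noteq> 4 \<Longrightarrow> m \<ge> 3 \<Longrightarrow> False" for k m :: nat
      by presburger
    ultimately show False by blast
  qed
  have "3 * card T = (\<Sum>F\<in>T. card (boundary F))" by (simp add: T_def)
  also have "\<dots> = card (\<Union>F\<in>T. boundary F)"
    using disj finite_faces by (subst card_UN_disjoint) (auto simp: T_def)
  also have "\<dots> \<le> card H" by (intro card_mono) (auto simp: dual_cut_def)
  finally have T3: "3 * card T \<le> card H" .
  have ge: "card (boundary F) + 2 * of_bool (F \<in> T) \<ge> 5" if "F \<in> \<Phi>" for F
  proof -
    have "card (boundary F) \<noteq> 4" using cycle_free_4D[OF C4 cut_subset simple_cut even_boundary[OF that]] .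
    moreover have "card (boundary F) \<ge> 3" using card_boundary_ge_3 True that by simp
    ultimately show ?thesis using that by (auto simp: T_def)
  qed
  have "5 * card \<Phi> = (\<Sum>F\<in>\<Phi>. 5)" by simp
  also have "\<dots> \<le> (\<Sum>F\<in>\<Phi>. card (boundary F) + 2 * of_bool (F \<in> T))"
    using ge by (rule sum_mono)
  also have "\<dots> = (\<Sum>F\<in>\<Phi>. card (boundary F)) + 2 * card T"
  proof -
    have "\<Phi> \<inter> T = T" by (auto simp: T_def)
    then show ?thesis using finite_faces by (simp add: sum.distrib flip: sum_distrib_left)
  qed
  also have "\<dots> \<le> 2 * card H + 2 * card T" using sum_card_boundary by simp
  finally show ?thesis using T3 euler by linarith
next
  case False
  \<comment> \<open>With at most two faces, e <= n, which is enough from n = 4 on.\<close>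
  then show ?thesis using euler n by linarith
qed

end

section \<open>Discharging in planar graphs without 5-cycles\<close>

text \<open>What a minimal counterexample to \<open>e \<le> 2 n - 2\<close> or \<open>5 e \<le> 12 n - 33\<close> looks like.\<close>

locale reduced_graph = plane_graph +
  assumes C5: "cycle_free 5 H"
    and card_X: "card X \<ge> 2"
    and edge_cut: "\<lbrakk>V \<subseteq> X; V \<noteq> {}; V \<noteq> X\<rbrakk> \<Longrightarrow> card {e\<in>H. e \<inter> V \<noteq> {} \<and> \<not> e \<subseteq> V} \<ge> 3"
    and vertex_cut: "\<lbrakk>V \<union> W = X; V \<inter> W = {v}; V \<noteq> {v}; W \<noteq> {v}\<rbrakk> \<Longrightarrow> \<exists>e\<in>H. \<not> e \<subseteq> V \<and> \<not> e \<subseteq> W"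
    and incident: "\<lbrakk>Y \<subseteq> X; Y \<noteq> {}; Y \<noteq> X\<rbrakk> \<Longrightarrow> card {e\<in>H. e \<inter> Y \<noteq> {}} \<ge> 2 * card Y + 1"
begin

section \<open>Connectivity of the graph and simplicity of its dual\<close>

lemma edgeD: "{x, y} \<in> H \<Longrightarrow> x \<noteq> y \<and> x \<in> X \<and> y \<in> X"
  using edges_in[of "{x, y}"] simple by (force simp: simple_graph_def)

text \<open>If \<open>Y\<close> consists of all vertices but one, \<open>incident\<close> asks for 2
  n - 1 edges, more than n (n - 1) / 2 when n <= 4. Therefore \<open>incident\<close> applies to
  every nonempty set of at most four vertices.\<close>

lemma card_X_ge_5: "card X \<ge> 5"
proof (rule ccontr)
  assume small: "\<not> card X \<ge> 5"
  obtain v where v: "v \<in> X" using card_X by fastforce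
  have cY: "card (X - {v}) = card X - 1" using v by simp
  have "X - {v} \<noteq> {}" using cY card_X by (metis card.empty diff_is_0_eq not_less_eq_eq numeral_2_eq_2 One_nat_def)
  then have "2 * (card X - 1) + 1 \<le> card {e\<in>H. e \<inter> (X - {v}) \<noteq> {}}"
    using incident[of "X - {v}"] v cY by auto
  also have "\<dots> \<le> card H" by (rule card_mono) auto
  also have "\<dots> \<le> card {e. e \<subseteq> X \<and> card e = 2}"
    using simple edges_in by (intro card_mono) (auto simp: simple_graph_def)
  also have "\<dots> = card X choose 2" by (rule n_subsets) simp
  also have "\<dots> = card X * (card X - 1) div 2" by (rule choose_two)
  finally have ineq: "2 * (card X - 1) + 1 \<le> card X * (card X - 1) div 2" .
  have "card X = 2 \<or> card X = 3 \<or> card X = 4" using small card_X by linarith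
  then show False using ineq by (elim disjE) simp_all
qed

lemma incident_small:
  assumes "Y \<subseteq> X" "Y \<noteq> {}" "card Y < 5"
  shows "card {e\<in>H. e \<inter> Y \<noteq> {}} \<ge> 2 * card Y + 1"
  using incident[OF assms(1,2)] assms(3) card_X_ge_5 by fastforce

lemma degree_ge_3:
  assumes "v \<in> X"
  shows "deg_in H v \<ge> 3"
  using incident_small[of "{v}"] assms by (simp add: deg_in_def)

lemma leaving:
  assumes "e \<in> H" "e \<inter> reach (H - D) a \<noteq> {}" "\<not> e \<subseteq> reach (H - D) a"
  shows "e \<in> D"
proof (rule ccontr)
  assume "e \<notin> D"
  moreover have "simple_graph (H - D)" using simple by (simp add: simple_graph_def)
  ultimately show False using reach_closed[of "H - D" e a] assms by blast
qed

lemma reach_in_X: "a \<in> X \<Longrightarrow> reach (H - D) a \<subseteq> X"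
  by (rule reach_subset) (auto dest: edges_in)

lemma separated:
  assumes "D \<subseteq> H" "{a, b} \<in> D" "\<And>A. A \<subseteq> \<Phi> \<Longrightarrow> cut A \<inter> D \<noteq> {{a, b}}"
  shows "b \<notin> reach (H - D) a"
  using cycle_cut[OF assms(1,2)] assms(3) by (auto simp: reach_def)

text \<open>If no dual cut met \<open>D\<close> in \<open>e\<close> alone, then by
  \<open>cycle_cut\<close> deleting \<open>D\<close> would separate the ends of \<open>e\<close>,
  and the graph would have an edge cut of at most two edges. With one or two edges in
  \<open>D\<close> this says that the dual graph has no loops and no parallel edges.\<close>

lemma small_dual_cut:
  assumes D: "D \<subseteq> H" "e \<in> D" "card D \<le> 2"
  shows "\<exists>A\<subseteq>\<Phi>. cut A \<inter> D = {e}"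
proof (rule ccontr)
  assume no: "\<not> ?thesis"
  have "card e = 2" using simple D by (auto simp: simple_graph_def)
  then obtain a b where ab: "e = {a, b}" by (auto simp: card_2_iff)
  have X: "a \<in> X" "b \<in> X" using edges_in[of e] D ab by auto
  have b: "b \<notin> reach (H - D) a" using separated[of D a b] D no ab by blast
  have "{f\<in>H. f \<inter> reach (H - D) a \<noteq> {} \<and> \<not> f \<subseteq> reach (H - D) a} \<subseteq> D"
    using leaving by blast
  then have "card {f\<in>H. f \<inter> reach (H - D) a \<noteq> {} \<and> \<not> f \<subseteq> reach (H - D) a} \<le> card D"
    by (intro card_mono) auto
  moreover have "reach (H - D) a \<noteq> {}" using reach_self by blast
  moreover have "reach (H - D) a \<noteq> X" using X(2) b by blast
  ultimately show False
    using edge_cut[OF reach_in_X[OF X(1)], of D] D(3) by linarith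
qed

lemma sides_distinct: "e \<in> H \<Longrightarrow> L e \<noteq> R e"
  using small_dual_cut[of "{e}" e] by (auto simp: dual_cut_def)

lemma in_boundary: "e \<in> boundary F \<longleftrightarrow> e \<in> H \<and> (F = L e \<or> F = R e)"
  using sides_distinct[of e] by (auto simp: mem_boundary)

lemma two_sides:
  assumes "e \<in> boundary F" "e \<in> boundary G" "F \<noteq> G"
  shows "L e = F \<and> R e = G \<or> L e = G \<and> R e = F"
  using assms by (auto simp: in_boundary)

lemma mem_cut: "e \<in> boundary F \<Longrightarrow> e \<in> boundary G \<Longrightarrow> F \<noteq> G \<Longrightarrow> e \<in> cut A \<longleftrightarrow> (F \<in> A) \<noteq> (G \<in> A)"
  by (auto simp: in_boundary dual_cut_def)

lemma no_third_side: "e \<in> boundary F \<Longrightarrow> e \<in> boundary G \<Longrightarrow> F \<noteq> G \<Longrightarrow> e \<in> boundary K \<Longrightarrow> K = F \<or> K = G"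
  by (auto simp: in_boundary)

lemma boundary_face: "e \<in> boundary F \<Longrightarrow> F \<in> \<Phi>"
  using sides by (auto simp: in_boundary)

lemma boundary_edge: "e \<in> boundary F \<Longrightarrow> e \<in> H"
  by (simp add: in_boundary)

lemma other_side:
  assumes "e \<in> boundary F"
  obtains G where "G \<in> \<Phi>" "G \<noteq> F" "e \<in> boundary G"
  using assms sides_distinct[of e] sides[of e] in_boundary by metis

lemma shared_edge_unique:
  assumes "e \<in> boundary F" "e \<in> boundary G" "f \<in> boundary F" "f \<in> boundary G" "F \<noteq> G"
  shows "e = f"
proof (rule ccontr)
  assume "e \<noteq> f"
  moreover have ef: "e \<in> H" "f \<in> H" using assms by (auto simp: in_boundary)
  ultimately obtain A where "cut A \<inter> {e, f} = {e}"
    using small_dual_cut[of "{e, f}" e] by (auto simp: card_insert_if)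
  then have "e \<in> cut A" "f \<notin> cut A" using \<open>e \<noteq> f\<close> by auto
  then show False using mem_cut[OF assms(1,2,5)] mem_cut[OF assms(3,4,5)] by blast
qed

lemma card_shared:
  assumes "e \<in> boundary F" "e \<in> boundary G" "F \<noteq> G"
  shows "boundary F \<inter> boundary G = {e}"
  using assms shared_edge_unique[OF assms(1,2)] by blast

lemma card_faces: "card \<Phi> \<ge> 2"
proof -
  obtain v where "v \<in> X" using card_X by fastforce
  then have "{e\<in>H. v \<in> e} \<noteq> {}" using degree_ge_3[of v] unfolding deg_in_def by (metis card.empty not_numeral_le_zero)
  then obtain e where e: "e \<in> H" by blast
  have "card {L e, R e} \<le> card \<Phi>" using sides[OF e] finite_faces by (intro card_mono) auto
  then show ?thesis using sides_distinct[OF e] by simp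
qed

section \<open>Adjacent small faces\<close>

definition tri :: "'b \<Rightarrow> bool" where "tri F \<longleftrightarrow> card (boundary F) = 3"
definition big :: "'b \<Rightarrow> bool" where "big F \<longleftrightarrow> card (boundary F) \<ge> 6"

lemma even_set_not_5: "A \<subseteq> \<Phi> \<Longrightarrow> card (cut A) \<noteq> 5"
  by (rule cycle_free_5D[OF C5 cut_subset simple_cut even_cut])

lemma face_sizes: "F \<in> \<Phi> \<Longrightarrow> tri F \<or> card (boundary F) = 4 \<or> big F"
  using card_boundary_ge_3[OF card_faces, of F] even_set_not_5[of "{F}"] unfolding tri_def big_def by force

text \<open>A triangle and a quadrilateral with one common edge have a union bounded by 3 + 4 - 2 =
  5 edges.\<close>

lemma tri_neighbour:
  assumes "e \<in> boundary T" "e \<in> boundary G" "T \<noteq> G" "tri T"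
  shows "tri G \<or> big G"
proof -
  have "card (cut ({T} \<union> {G})) + 2 * card {e} = card (boundary T) + card (boundary G)"
    using card_cut_Un[of "{T}" "{G}"] assms card_shared[OF assms(1-3)] by auto
  moreover have "card (cut ({T} \<union> {G})) \<noteq> 5"
    using boundary_face assms by (intro even_set_not_5) auto
  ultimately have "card (boundary G) \<noteq> 4" using assms(4) by (auto simp: tri_def)
  then show ?thesis using face_sizes boundary_face assms(2) by blast
qed

text \<open>Otherwise \<open>T3\<close> shares just one edge with the union of \<open>T1\<close> and
  \<open>T2\<close>, which is bounded by four edges, and all three together are bounded by 4 + 3 - 2
  = 5 edges.\<close>

lemma tri_chain:
  assumes T: "tri T1" "tri T2" "tri T3" "T1 \<noteq> T2" "T2 \<noteq> T3" "T1 \<noteq> T3"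
    and e: "e \<in> boundary T1" "e \<in> boundary T2" and f: "f \<in> boundary T2" "f \<in> boundary T3"
  obtains h where "h \<in> boundary T1" "h \<in> boundary T3"
proof (rule ccontr)
  assume "\<not> thesis"
  then have no: "boundary T1 \<inter> boundary T3 = {}" using that by blast
  have c12: "card (cut ({T1} \<union> {T2})) = 4"
    using card_cut_Un[of "{T1}" "{T2}"] T card_shared[OF e T(4)] by (simp add: tri_def)
  have "cut ({T1} \<union> {T2}) \<inter> boundary T3 = {f}"
  proof -
    have "h = f" if h: "h \<in> cut ({T1} \<union> {T2})" "h \<in> boundary T3" for h
    proof -
      have "h \<in> boundary T1 \<or> h \<in> boundary T2"
        using h by (auto simp: dual_cut_def)
      then have "h \<in> boundary T2" using no h(2) by blast
      then show ?thesis using shared_edge_unique[OF _ h(2) f(1,2) T(5)] by blast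
    qed
    moreover have "f \<in> cut ({T1} \<union> {T2})"
      using mem_cut[OF f T(5), of "{T1} \<union> {T2}"] T by auto
    ultimately show ?thesis using f by blast
  qed
  then have "card (cut (({T1} \<union> {T2}) \<union> {T3})) = 5"
    using card_cut_Un[of "{T1} \<union> {T2}" "{T3}"] T c12 by (simp add: tri_def)
  moreover have "({T1} \<union> {T2}) \<union> {T3} \<subseteq> \<Phi>" using boundary_face e f by auto
  ultimately show False using even_set_not_5 by blast
qed

text \<open>Every edge leaving the component of \<open>v\<close> starts at \<open>v\<close>. So two
  sets that overlap in \<open>v\<close> alone contain all edges: the component, and the other
  vertices together with \<open>v\<close>. As \<open>v\<close> is no cut vertex, the component is
  just \<open>v\<close>.\<close>

lemma isolated_by_cut:
  assumes v: "v \<in> X" and y: "y \<in> X" "y \<notin> reach (H - D) v"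
    and D: "\<And>e. e \<in> D \<Longrightarrow> e \<inter> reach (H - D) v \<noteq> {} \<Longrightarrow> \<not> e \<subseteq> reach (H - D) v \<Longrightarrow> v \<in> e"
  shows "reach (H - D) v = {v}" and "{e\<in>H. v \<in> e} \<subseteq> D"
proof -
  let ?V = "reach (H - D) v"
  define W where "W = insert v (X - ?V)"
  have "?V \<union> W = X" using reach_in_X[OF v] v by (auto simp: W_def)
  moreover have "?V \<inter> W = {v}" by (auto simp: W_def)
  moreover have "W \<noteq> {v}" using y by (auto simp: W_def)
  moreover have "e \<subseteq> ?V \<or> e \<subseteq> W" if e: "e \<in> H" for e
  proof (cases "e \<inter> ?V = {}")
    case True
    then show ?thesis using edges_in[OF e] by (auto simp: W_def)
  next
    case False
    show ?thesis
    proof (cases "e \<subseteq> ?V")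
      case nsub: False
      then have "e \<in> D" using leaving[OF e False] by blast
      then have "v \<in> e" using D False nsub by blast
      moreover have "card e = 2" using simple e by (auto simp: simple_graph_def)
      ultimately obtain z where z: "e = {v, z}" by (auto simp: card_2_iff)
      then have "z \<notin> ?V" using nsub by auto
      then show ?thesis using z edges_in[OF e] by (auto simp: W_def)
    qed simp
  qed
  ultimately show V: "?V = {v}" using vertex_cut[of ?V W v] by blast
  show "{e\<in>H. v \<in> e} \<subseteq> D"
  proof
    fix e assume e: "e \<in> {e\<in>H. v \<in> e}"
    then have "card e = 2" using simple by (auto simp: simple_graph_def)
    then have "\<not> e \<subseteq> {v}" using card_mono[of "{v}" e] by auto
    then show "e \<in> D" using leaving[of e D v] V e by auto
  qed
qed

section \<open>Three triangles around a vertex\<close>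

lemma triangle_from_edges:
  assumes T: "tri T" and e: "{x, y} \<in> boundary T" "{x, z} \<in> boundary T" "y \<noteq> z"
  shows "boundary T = {{x, y}, {x, z}, {y, z}}" and "x \<noteq> y" "x \<noteq> z"
proof -
  show xy: "x \<noteq> y" "x \<noteq> z" using edgeD boundary_edge e by blast+
  have T': "T \<in> \<Phi>" using boundary_face e by blast
  obtain f where f: "{y, f} \<in> boundary T" "{y, f} \<noteq> {x, y}" "f \<noteq> y"
    by (rule even_setD_other[OF simple_cut even_boundary[OF T'] e(1) insertI2[OF singletonI]])
  have fx: "f \<noteq> x" using f by (auto simp: insert_commute)
  have "card {{x, y}, {x, z}, {y, f}} = 3" using xy e(3) f fx by (auto simp: doubleton_eq_iff)
  then have eq: "{{x, y}, {x, z}, {y, f}} = boundary T"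
    using T e f by (intro card_subset_eq) (auto simp: tri_def)
  obtain g where g: "{z, g} \<in> boundary T" "{z, g} \<noteq> {x, z}" "g \<noteq> z"
    by (rule even_setD_other[OF simple_cut even_boundary[OF T'] e(2) insertI2[OF singletonI]])
  have "{z, g} \<in> {{x, y}, {x, z}, {y, f}}" unfolding eq by (rule g(1))
  then have "f = z" using g(2) xy e(3) by (auto simp: doubleton_eq_iff)
  then show "boundary T = {{x, y}, {x, z}, {y, z}}" using eq by simp
qed

lemma triangle_edges_meet:
  assumes "tri T" "e \<in> boundary T" "f \<in> boundary T" "e \<noteq> f"
  obtains x y z where "e = {x, y}" "f = {x, z}" "y \<noteq> z"
proof -
  obtain a b c where "a \<noteq> b" "b \<noteq> c" "a \<noteq> c" and T: "boundary T = {{a, b}, {a, c}, {b, c}}"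
    by (rule even_set_card_3[OF simple_cut even_boundary[OF boundary_face[OF assms(2)]] assms(1)[unfolded tri_def]])
  have "e = {a, b} \<or> e = {a, c} \<or> e = {b, c}" "f = {a, b} \<or> f = {a, c} \<or> f = {b, c}"
    using assms T by auto
  then obtain x where x: "x \<in> e" "x \<in> f" by (elim disjE) auto
  have "card e = 2" "card f = 2"
    using simple boundary_edge[OF assms(2)] boundary_edge[OF assms(3)] by (auto simp: simple_graph_def)
  then obtain y z where "e = {x, y}" "f = {x, z}" using x by (auto simp: card_2_iff)
  then show ?thesis using that assms(4) by blast
qed

text \<open>\<open>T1\<close>, \<open>T2\<close>, \<open>T3\<close> are the faces around
  \<open>x\<close> that avoid \<open>a\<close>, \<open>b\<close>, \<open>c\<close> respectively. The
  last conjunct gives \<open>x\<close> degree three; what lies beyond the triangle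
  \<open>abc\<close> is left open.\<close>

definition K4 :: "'a \<Rightarrow> 'a \<Rightarrow> 'a \<Rightarrow> 'a \<Rightarrow> 'b \<Rightarrow> 'b \<Rightarrow> 'b \<Rightarrow> bool" where
  "K4 x a b c T1 T2 T3 \<longleftrightarrow> distinct [x, a, b, c] \<and> distinct [T1, T2, T3] \<and>
     boundary T1 = {{x, b}, {x, c}, {b, c}} \<and> boundary T2 = {{x, a}, {x, c}, {a, c}} \<and>
     boundary T3 = {{x, a}, {x, b}, {a, b}} \<and> {e\<in>H. x \<in> e} = {{x, a}, {x, b}, {x, c}}"

lemma K4_rotate: "K4 x a b c T1 T2 T3 \<Longrightarrow> K4 x b c a T2 T3 T1"
  unfolding K4_def by (simp add: insert_commute) blast

lemma K4_flip: "K4 x a b c T1 T2 T3 \<Longrightarrow> K4 x a c b T1 T3 T2"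
  unfolding K4_def by (simp add: insert_commute) blast

text \<open>The three common edges meet in a vertex \<open>x\<close>, since otherwise
  \<open>e23\<close> would be the third edge of \<open>T1\<close> and have three sides. Each of them
  separates two of the three faces, so a dual cut contains an even number of them and never exactly
  one. Deleting them thus separates \<open>x\<close> from \<open>a\<close>, and as \<open>x\<close>
  is no cut vertex it has no further edges.\<close>

lemma K4_exists:
  assumes T: "tri T1" "tri T2" "tri T3" "distinct [T1, T2, T3]"
    and e12: "e12 \<in> boundary T1" "e12 \<in> boundary T2"
    and e13: "e13 \<in> boundary T1" "e13 \<in> boundary T3"
    and e23: "e23 \<in> boundary T2" "e23 \<in> boundary T3"
  obtains x a b c where "K4 x a b c T1 T2 T3"
proof -
  have neq: "e12 \<noteq> e13" "e12 \<noteq> e23" "e13 \<noteq> e23"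
    using no_third_side[OF e12] no_third_side[OF e13] e12 e13 e23 T(4) by auto
  obtain x b c where x: "e12 = {x, c}" "e13 = {x, b}" "c \<noteq> b"
    using triangle_edges_meet[OF T(1) e12(1) e13(1) neq(1)] by metis
  have T1: "boundary T1 = {{x, c}, {x, b}, {c, b}}" "x \<noteq> c" "x \<noteq> b"
    using triangle_from_edges[OF T(1), of x c b] e12 e13 x by auto
  have nbc: "e23 \<noteq> {c, b}"
  proof
    assume "e23 = {c, b}"
    then have "e23 \<in> boundary T1" using T1 by simp
    then show False using no_third_side[OF e23] T(4) by auto
  qed
  obtain u v w where u: "e12 = {u, v}" "e23 = {u, w}" "v \<noteq> w"
    using triangle_edges_meet[OF T(2) e12(2) e23(1) neq(2)] by metis
  obtain u' v' w' where u': "e13 = {u', v'}" "e23 = {u', w'}" "v' \<noteq> w'"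
    using triangle_edges_meet[OF T(3) e13(2) e23(2) neq(3)] by metis
  have "x \<in> e23"
  proof (rule ccontr)
    assume "x \<notin> e23"
    then have "c \<in> e23" "b \<in> e23" using u u' x by (auto simp: doubleton_eq_iff)
    then have "e23 = {c, b}" using u(2) x(3) by auto
    then show False using nbc by simp
  qed
  then obtain a where a: "e23 = {x, a}" using u(2) by auto
  have ac: "a \<noteq> c" "a \<noteq> b" using neq x a by auto
  have T2: "boundary T2 = {{x, a}, {x, c}, {a, c}}" "x \<noteq> a"
    using triangle_from_edges[OF T(2), of x a c] e12 e23 x a ac by auto
  have T3: "boundary T3 = {{x, a}, {x, b}, {a, b}}"
    using triangle_from_edges[OF T(3), of x a b] e13 e23 x a ac by auto
  define D where "D = {{x, a}, {x, b}, {x, c}}"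
  have DH: "D \<subseteq> H" using boundary_edge e12 e13 e23 x a by (auto simp: D_def)
  have m: "{x, a} \<in> cut A \<longleftrightarrow> (T2 \<in> A) \<noteq> (T3 \<in> A)" "{x, b} \<in> cut A \<longleftrightarrow> (T1 \<in> A) \<noteq> (T3 \<in> A)"
    "{x, c} \<in> cut A \<longleftrightarrow> (T1 \<in> A) \<noteq> (T2 \<in> A)" for A
    using mem_cut[OF e12, of A] mem_cut[OF e13, of A] mem_cut[OF e23, of A] x a T(4) by auto
  have "a \<notin> reach (H - D) x"
  proof (rule separated[OF DH])
    show "{x, a} \<in> D" by (simp add: D_def)
    show "cut A \<inter> D \<noteq> {{x, a}}" for A
    proof
      assume eq: "cut A \<inter> D = {{x, a}}"
      have ne: "{x, b} \<noteq> {x, a}" "{x, c} \<noteq> {x, a}" and D: "{x, b} \<in> D" "{x, c} \<in> D"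
        using ac by (auto simp: D_def doubleton_eq_iff)
      have "{x, a} \<in> cut A \<inter> D" unfolding eq by simp
      moreover have "{x, b} \<notin> cut A \<inter> D" unfolding eq using ne(1) by simp
      moreover have "{x, c} \<notin> cut A \<inter> D" unfolding eq using ne(2) by simp
      ultimately have "{x, a} \<in> cut A" "{x, b} \<notin> cut A" "{x, c} \<notin> cut A" using D by simp_all
      then show False unfolding m by simp
    qed
  qed
  moreover have "x \<in> X" "a \<in> X" using edgeD[of x a] DH by (auto simp: D_def)
  ultimately have "{e\<in>H. x \<in> e} \<subseteq> D"
    using isolated_by_cut(2)[of x a D] by (auto simp: D_def)
  then have "{e\<in>H. x \<in> e} = D" using DH by (auto simp: D_def)
  then have "K4 x a b c T1 T2 T3"
    unfolding K4_def D_def using T1 T2 T3 T(4) ac x(3) by (auto simp: insert_commute)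
  then show ?thesis using that by blast
qed

lemma not_tri_big: "tri F \<Longrightarrow> big F \<Longrightarrow> False"
  by (simp add: tri_def big_def)

lemma K4_tri:
  assumes "K4 x a b c T1 T2 T3"
  shows "tri T1" "tri T2" "tri T3"
  using assms by (auto simp: K4_def tri_def doubleton_eq_iff)

lemma K4_edge:
  assumes "K4 x a b c T1 T2 T3"
  shows "{x, a} \<in> H" "{x, b} \<in> H" "{x, c} \<in> H" "{a, b} \<in> H" "{a, c} \<in> H" "{b, c} \<in> H"
proof -
  have "boundary T1 \<subseteq> H" "boundary T2 \<subseteq> H" "boundary T3 \<subseteq> H" by (rule cut_subset)+
  then show "{x, a} \<in> H" "{x, b} \<in> H" "{x, c} \<in> H" "{a, b} \<in> H" "{a, c} \<in> H" "{b, c} \<in> H"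
    using assms by (simp_all add: K4_def)
qed

lemma K4_center_edges: "K4 x a b c T1 T2 T3 \<Longrightarrow> {e\<in>H. x \<in> e} = {{x, a}, {x, b}, {x, c}}"
  by (simp only: K4_def)

lemma K4_face:
  assumes "K4 x a b c T1 T2 T3"
  shows "T1 \<in> \<Phi>" "T2 \<in> \<Phi>" "T3 \<in> \<Phi>"
  using assms by (auto simp: K4_def intro: boundary_face)

text \<open>The face across \<open>bc\<close> is no quadrilateral by \<open>tri_neighbour\<close>.
  By \<open>tri_chain\<close> a triangle there would also be adjacent to \<open>T2\<close> and
  \<open>T3\<close>, so its boundary would be \<open>abc\<close> and the four triangles would be all
  faces. That leaves six edges and four vertices, but there are at least five vertices.\<close>

lemma K4_outer:
  assumes K: "K4 x a b c T1 T2 T3"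
  obtains F where "big F" "F \<in> \<Phi>" "{b, c} \<in> boundary F" "F \<notin> {T1, T2, T3}"
proof -
  have dx: "x \<noteq> a" "x \<noteq> b" "x \<noteq> c" "a \<noteq> b" "a \<noteq> c" "b \<noteq> c" and dT: "T1 \<noteq> T2" "T1 \<noteq> T3" "T2 \<noteq> T3"
    and B: "boundary T1 = {{x, b}, {x, c}, {b, c}}" "boundary T2 = {{x, a}, {x, c}, {a, c}}"
     "boundary T3 = {{x, a}, {x, b}, {a, b}}"
    using K by (auto simp: K4_def)
  note tri = K4_tri[OF K]
  have bc: "{b, c} \<in> boundary T1" by (simp add: B)
  obtain G where G: "G \<in> \<Phi>" "G \<noteq> T1" "{b, c} \<in> boundary G" using other_side[OF bc] .
  have G2: "G \<noteq> T2" using G(3) B(2) dx by (auto simp: doubleton_eq_iff)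
  have G3: "G \<noteq> T3" using G(3) B(3) dx by (auto simp: doubleton_eq_iff)
  have xa: "{x, a} \<notin> boundary G" using no_third_side[of "{x, a}" T2 T3 G] B dT G2 G3 by auto
  have xb: "{x, b} \<notin> boundary G" using no_third_side[of "{x, b}" T1 T3 G] B dT G(2) G3 by auto
  have xc: "{x, c} \<notin> boundary G" using no_third_side[of "{x, c}" T1 T2 G] B dT G(2) G2 by auto
  have "\<not> tri G"
  proof
    assume triG: "tri G"
    have c12: "{x, c} \<in> boundary T1" "{x, c} \<in> boundary T2" and c13: "{x, b} \<in> boundary T1" "{x, b} \<in> boundary T3"
      by (auto simp: B)
    obtain h where h: "h \<in> boundary G" "h \<in> boundary T2"
      using tri_chain[OF triG tri(1,2) G(2) dT(1) G2 G(3) bc c12] .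
    then have ac: "{a, c} \<in> boundary G" using xa xc unfolding B(2) by auto
    obtain k where k: "k \<in> boundary G" "k \<in> boundary T3"
      using tri_chain[OF triG tri(1,3) G(2) dT(2) G3 G(3) bc c13] .
    then have ab: "{a, b} \<in> boundary G" using xa xb unfolding B(3) by auto
    have BG: "boundary G = {{a, b}, {a, c}, {b, c}}"
      using triangle_from_edges[OF triG ab ac] dx by auto
    define A where "A = {T1, T2, T3, G}"
    have AF: "A \<subseteq> \<Phi>" using K4_face[OF K] G by (auto simp: A_def)
    have covered: "\<exists>F'\<in>A. F' \<noteq> F \<and> e \<in> boundary F'" if "F \<in> A" "e \<in> boundary F" for F e
    proof -
      have "F = T1 \<or> F = T2 \<or> F = T3 \<or> F = G" using that(1) by (simp add: A_def)
      moreover have "e \<in> boundary T1 \<Longrightarrow> e \<in> boundary T2 \<or> e \<in> boundary T3 \<or> e \<in> boundary G"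
        "e \<in> boundary T2 \<Longrightarrow> e \<in> boundary T1 \<or> e \<in> boundary T3 \<or> e \<in> boundary G"
        "e \<in> boundary T3 \<Longrightarrow> e \<in> boundary T1 \<or> e \<in> boundary T2 \<or> e \<in> boundary G"
        "e \<in> boundary G \<Longrightarrow> e \<in> boundary T1 \<or> e \<in> boundary T2 \<or> e \<in> boundary T3"
        unfolding B BG by (elim insertE emptyE; simp)+
      ultimately have "\<exists>F'. (F' = T1 \<or> F' = T2 \<or> F' = T3 \<or> F' = G) \<and> F' \<noteq> F \<and> e \<in> boundary F'"
        using that(2) dT G(2) G2 G3 by metis
      then show ?thesis by (auto simp: A_def)
    qed
    have "cut A = {}"
    proof (rule ccontr)
      assume "cut A \<noteq> {}"
      then obtain e where e: "e \<in> cut A" by blast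
      then have "e \<in> H" "(L e \<in> A) \<noteq> (R e \<in> A)" by (auto simp: dual_cut_def)
      then obtain F where F: "F \<in> A" "e \<in> boundary F" by (auto simp: in_boundary)
      then obtain F' where F': "F' \<in> A" "F' \<noteq> F" "e \<in> boundary F'" using covered by blast
      then show False using mem_cut[OF F(2) F'(3)] F e by blast
    qed
    then have "A = {} \<or> A = \<Phi>" using dual_conn[OF AF] by simp
    then have \<Phi>: "\<Phi> = A" by (auto simp: A_def)
    then have cF: "card \<Phi> = 4" using dT G(2) G2 G3 by (auto simp: A_def)
    have "(\<Sum>F\<in>\<Phi>. 1 * real (card (boundary F))) = (\<Sum>F\<in>\<Phi>. 3)"
      using tri triG by (intro sum.cong) (auto simp: \<Phi> A_def tri_def)
    moreover have "(\<Sum>F\<in>\<Phi>. 1 * real (card (boundary F))) = (\<Sum>e\<in>H. 2)"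
      unfolding sum_boundary using sides_distinct by (intro sum.cong) auto
    ultimately have "card H = 6" using cF by simp
    then show False using euler cF card_X_ge_5 by simp
  qed
  then have "big G" using tri_neighbour[OF bc G(3)] G(2) tri(1) by blast
  then show ?thesis using that G G2 G3 by blast
qed

definition center :: "'a \<Rightarrow> bool" where
  "center x \<longleftrightarrow> (\<exists>a b c T1 T2 T3. K4 x a b c T1 T2 T3)"

text \<open>Expressed by the neighbourhood of \<open>x\<close>, so that it does not depend on how
  the vertices and faces of a \<open>K4\<close> are named.\<close>

definition K4_edges :: "'a \<Rightarrow> 'a set set" where
  "K4_edges x = {e\<in>H. e \<subseteq> insert x {v. {x, v} \<in> H}}"

lemma K4_neighbours: "K4 x a b c T1 T2 T3 \<Longrightarrow> {v. {x, v} \<in> H} = {a, b, c}"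
proof -
  assume K: "K4 x a b c T1 T2 T3"
  have "v \<in> {a, b, c}" if "{x, v} \<in> H" for v
  proof -
    have "{x, v} \<in> {e\<in>H. x \<in> e}" using that by simp
    then have "{x, v} \<in> {{x, a}, {x, b}, {x, c}}" unfolding K4_center_edges[OF K] .
    then show ?thesis by (auto simp: doubleton_eq_iff)
  qed
  then show ?thesis using K4_edge[OF K] by blast
qed

lemma K4_edges_eq:
  assumes K: "K4 x a b c T1 T2 T3"
  shows "K4_edges x = {{x, a}, {x, b}, {x, c}, {a, b}, {a, c}, {b, c}}"
proof -
  have "e \<in> {{x, a}, {x, b}, {x, c}, {a, b}, {a, c}, {b, c}}" if "e \<in> K4_edges x" for e
  proof -
    have "e \<in> H" and sub: "e \<subseteq> {x, a, b, c}" using that K4_neighbours[OF K] by (auto simp: K4_edges_def)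
    then have "card e = 2" using simple by (auto simp: simple_graph_def)
    then obtain p q where pq: "e = {p, q}" "p \<noteq> q" by (auto simp: card_2_iff)
    then have "p = x \<or> p = a \<or> p = b \<or> p = c" "q = x \<or> q = a \<or> q = b \<or> q = c" using sub by auto
    then show ?thesis using pq by (elim disjE) (simp_all add: doubleton_eq_iff)
  qed
  moreover have "{{x, a}, {x, b}, {x, c}, {a, b}, {a, c}, {b, c}} \<subseteq> K4_edges x"
    unfolding K4_edges_def K4_neighbours[OF K] using K4_edge[OF K] by simp
  ultimately show ?thesis by (intro equalityI subsetI) (auto simp only: subset_iff)
qed

lemma K4_boundary_subset:
  assumes K: "K4 x a b c T1 T2 T3" and "F \<in> {T1, T2, T3}"
  shows "boundary F \<subseteq> K4_edges x"
proof -
  have B: "boundary T1 = {{x, b}, {x, c}, {b, c}}" "boundary T2 = {{x, a}, {x, c}, {a, c}}"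
     "boundary T3 = {{x, a}, {x, b}, {a, b}}"
    using K by (simp_all add: K4_def)
  have "F = T1 \<or> F = T2 \<or> F = T3" using assms(2) by simp
  then show ?thesis unfolding K4_edges_eq[OF K] by (elim disjE) (simp_all add: B)
qed

lemma center_corner:
  assumes "center x" "{x, v} \<in> H"
  obtains b c T1 T2 T3 where "K4 x v b c T1 T2 T3"
proof -
  obtain a b c T1 T2 T3 where K: "K4 x a b c T1 T2 T3" using assms(1) by (auto simp: center_def)
  have "v = a \<or> v = b \<or> v = c" using K4_neighbours[OF K] assms(2) by auto
  then show ?thesis
    using that K K4_rotate[OF K] K4_rotate[OF K4_rotate[OF K]] by blast
qed

lemma center_edge_tri:
  assumes "center x" "x \<in> e" "e \<in> boundary F"
  shows "tri F" "boundary F \<subseteq> K4_edges x"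
proof -
  have "e \<in> H" using boundary_edge assms by blast
  then have "card e = 2" using simple by (auto simp: simple_graph_def)
  then obtain v where "e = {x, v}" using assms(2) by (auto simp: card_2_iff)
  then have v: "e = {x, v}" "{x, v} \<in> H" using \<open>e \<in> H\<close> by auto
  obtain b c T1 T2 T3 where K: "K4 x v b c T1 T2 T3" using center_corner[OF assms(1) v(2)] .
  have "e \<in> boundary T2" "e \<in> boundary T3" "T2 \<noteq> T3" using K v by (auto simp: K4_def)
  then have F: "F = T2 \<or> F = T3" using no_third_side[of e T2 T3 F] assms(3) by blast
  then show "tri F" using K4_tri[OF K] by auto
  show "boundary F \<subseteq> K4_edges x" using F by (intro K4_boundary_subset[OF K]) auto
qed

lemma outer_edge:
  assumes "center x" "e \<in> K4_edges x" "x \<notin> e"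
  obtains p q T F where "e = {p, q}" "{x, p} \<in> H" "{x, q} \<in> H" "tri T" "big F" "e \<in> boundary T" "e \<in> boundary F"
    "boundary T = {{x, p}, {x, q}, {p, q}}" "boundary T \<subseteq> K4_edges x" "p \<noteq> q" "x \<noteq> p" "x \<noteq> q"
proof -
  obtain a b c T1 T2 T3 where K: "K4 x a b c T1 T2 T3" using assms(1) by (auto simp: center_def)
  note * = that
  have result: thesis if K: "K4 x a b c T1 T2 T3" and e: "e = {b, c}" for a b c T1 T2 T3
  proof -
    obtain F where F: "big F" "{b, c} \<in> boundary F" using K4_outer[OF K] by metis
    have "boundary T1 = {{x, b}, {x, c}, {b, c}}" "b \<noteq> c" "x \<noteq> b" "x \<noteq> c" using K by (auto simp: K4_def)
    moreover have "boundary T1 \<subseteq> K4_edges x" by (rule K4_boundary_subset[OF K]) simp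
    ultimately show thesis using *[of b c T1 F] e F K4_edge[OF K] K4_tri[OF K] by simp
  qed
  have "e = {b, c} \<or> e = {c, a} \<or> e = {a, b}"
    using assms(2,3) unfolding K4_edges_eq[OF K] by (auto simp: insert_commute)
  then show thesis
    using result[OF K] result[OF K4_rotate[OF K]] result[OF K4_rotate[OF K4_rotate[OF K]]] by blast
qed

lemma centers_not_adjacent:
  assumes "center x" "center y"
  shows "{x, y} \<notin> H"
proof
  assume xy: "{x, y} \<in> H"
  obtain b c T1 T2 T3 where K: "K4 x y b c T1 T2 T3" using center_corner[OF assms(1) xy] .
  obtain F where F: "big F" "{c, y} \<in> boundary F" using K4_outer[OF K4_rotate[OF K]] by metis
  then show False using center_edge_tri(1)[OF assms(2) _ F(2)] not_tri_big by auto
qed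

lemma tri_boundary_K4:
  assumes "center x" "e \<in> K4_edges x" "e \<in> boundary F" "tri F"
  shows "boundary F \<subseteq> K4_edges x"
proof (cases "x \<in> e")
  case True
  then show ?thesis using center_edge_tri(2)[OF assms(1) True assms(3)] by simp
next
  case False
  obtain p q T F' where "e = {p, q}" "{x, p} \<in> H" "{x, q} \<in> H" and T: "tri T" "big F'" "e \<in> boundary T" "e \<in> boundary F'"
    and "boundary T = {{x, p}, {x, q}, {p, q}}" and sub: "boundary T \<subseteq> K4_edges x" and "p \<noteq> q" "x \<noteq> p" "x \<noteq> q"
    using outer_edge[OF assms(1,2) False] .
  have "T \<noteq> F'" using T not_tri_big by blast
  then have "F = T \<or> F = F'" using no_third_side[OF T(3,4) _ assms(3)] by blast
  then have "F = T" using T(2) assms(4) not_tri_big by blast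
  then show ?thesis using sub by simp
qed

text \<open>Edges at a centre have triangles on both sides, the outer edges have a big face on one
  side, so a common edge is of the same kind for both centres. If it contains both, the centres are
  adjacent. If it is an outer edge, the triangle beside it belongs to both blocks, and again
  \<open>x\<close> would be a neighbour of \<open>y\<close>. Adjacent centres are excluded since
  every second neighbour sits on a big face.\<close>

lemma K4_edges_disjoint:
  assumes "center x" "center y" "x \<noteq> y"
  shows "K4_edges x \<inter> K4_edges y = {}"
proof (rule ccontr)
  assume "\<not> ?thesis"
  then obtain e where e: "e \<in> K4_edges x" "e \<in> K4_edges y" by blast
  then have eH: "e \<in> H" by (simp add: K4_edges_def)
  have card_e: "card e = 2" using simple eH by (auto simp: simple_graph_def)
  have both: "x \<in> e \<longleftrightarrow> y \<in> e"
  proof -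
    have *: "v \<in> e" if h: "center u" "center v" "u \<in> e" "e \<in> K4_edges v" for u v
    proof (rule ccontr)
      assume "v \<notin> e"
      then obtain p q T F where "e = {p, q}" "{v, p} \<in> H" "{v, q} \<in> H" and T: "tri T" "big F" "e \<in> boundary T" "e \<in> boundary F"
        and "boundary T = {{v, p}, {v, q}, {p, q}}" "boundary T \<subseteq> K4_edges v" "p \<noteq> q" "v \<noteq> p" "v \<noteq> q"
        by (rule outer_edge[OF h(2,4)])
      then show False using center_edge_tri(1)[OF h(1,3) T(4)] not_tri_big by blast
    qed
    show ?thesis using * assms e by blast
  qed
  show False
  proof (cases "x \<in> e")
    case True
    then have "e = {x, y}" using both card_e assms(3) by (auto simp: card_2_iff)
    then show False using centers_not_adjacent[OF assms(1,2)] eH by simp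
  next
    case False
    obtain p q T F where pq: "e = {p, q}" "{x, p} \<in> H" "{x, q} \<in> H" and T: "tri T" "big F" "e \<in> boundary T" "e \<in> boundary F"
      and B: "boundary T = {{x, p}, {x, q}, {p, q}}" "boundary T \<subseteq> K4_edges x" "p \<noteq> q" "x \<noteq> p" "x \<noteq> q"
      using outer_edge[OF assms(1) e(1) False] .
    have "boundary T \<subseteq> K4_edges y" by (rule tri_boundary_K4[OF assms(2) e(2) T(3) T(1)])
    then have "{x, p} \<in> K4_edges y" "{x, q} \<in> K4_edges y" using B by auto
    then have "x = y \<or> {y, x} \<in> H" by (auto simp: K4_edges_def)
    then show False using centers_not_adjacent[OF assms(2,1)] assms(3) by blast
  qed
qed

text \<open>Consequently, triangular faces outside these blocks occur alone or in pairs, which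
  \<open>diagonal_others\<close> exploits.\<close>

lemma two_tri_neighbours_K4:
  assumes T: "tri T1" "tri T2" "tri T3" "T1 \<noteq> T2" "T2 \<noteq> T3" "T1 \<noteq> T3"
    and e: "e \<in> boundary T1" "e \<in> boundary T2" and f: "f \<in> boundary T2" "f \<in> boundary T3"
  obtains x where "center x" "boundary T1 \<subseteq> K4_edges x" "boundary T2 \<subseteq> K4_edges x" "boundary T3 \<subseteq> K4_edges x"
proof -
  obtain h where h: "h \<in> boundary T1" "h \<in> boundary T3" using tri_chain[OF T e f] .
  have "distinct [T1, T2, T3]" using T by simp
  then obtain x a b c where K: "K4 x a b c T1 T2 T3" by (rule K4_exists[OF T(1,2,3) _ e h f])
  then have "center x" unfolding center_def by blast
  then show ?thesis using that[of x] K4_boundary_subset[OF K] by simp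
qed

section \<open>Corners of degree three\<close>

definition pendant :: "'a set" where
  "pendant = {v\<in>X. deg_in H v = 3 \<and> (\<exists>x. center x \<and> {x, v} \<in> H)}"

lemma K4_corner_edges:
  assumes K: "K4 x v b c T1 T2 T3"
  shows "{e\<in>K4_edges x. v \<in> e} = {{x, v}, {v, b}, {v, c}}" and "card {e\<in>K4_edges x. v \<in> e} = 3"
proof -
  have d: "x \<noteq> v" "x \<noteq> b" "x \<noteq> c" "v \<noteq> b" "v \<noteq> c" "b \<noteq> c" using K by (auto simp: K4_def)
  show eq: "{e\<in>K4_edges x. v \<in> e} = {{x, v}, {v, b}, {v, c}}"
    unfolding K4_edges_eq[OF K] using d by auto
  show "card {e\<in>K4_edges x. v \<in> e} = 3" unfolding eq using d by (auto simp: doubleton_eq_iff)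
qed

lemma pendant_edges:
  assumes K: "K4 x v b c T1 T2 T3" and deg: "deg_in H v = 3"
  shows "{e\<in>H. v \<in> e} = {{x, v}, {v, b}, {v, c}}"
proof -
  have "{e\<in>K4_edges x. v \<in> e} = {e\<in>H. v \<in> e}"
    using K4_corner_edges(2)[OF K] deg by (intro card_subset_eq) (auto simp: K4_edges_def deg_in_def)
  then show ?thesis using K4_corner_edges(1)[OF K] by simp
qed

text \<open>Two such corners and the centre would be incident with the six edges of the
  \<open>K4\<close> only, whereas three vertices need seven.\<close>

lemma pendant_unique:
  assumes K: "K4 x v b c T1 T2 T3" and deg: "deg_in H v = 3" "deg_in H b = 3"
  shows False
proof -
  have K': "K4 x b v c T2 T1 T3" using K4_flip[OF K4_rotate[OF K]] .
  have "{e\<in>H. e \<inter> {x, v, b} \<noteq> {}} = {e\<in>H. x \<in> e} \<union> {e\<in>H. v \<in> e} \<union> {e\<in>H. b \<in> e}" by auto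
  also have "\<dots> = {{x, v}, {x, b}, {x, c}} \<union> {{x, v}, {v, b}, {v, c}} \<union> {{x, b}, {b, v}, {b, c}}"
    unfolding pendant_edges[OF K deg(1)] pendant_edges[OF K' deg(2)] K4_center_edges[OF K] ..
  also have "\<dots> = {{x, v}, {x, b}, {x, c}, {v, b}, {v, c}, {b, c}}" by (auto simp: insert_commute)
  finally have "card {e\<in>H. e \<inter> {x, v, b} \<noteq> {}} \<le> 6"
    by (simp add: card_insert_if)
  moreover have "card {x, v, b} = 3" "{x, v, b} \<subseteq> X" using K edgeD K4_edge[OF K] by (auto simp: K4_def)
  ultimately show False using incident_small[of "{x, v, b}"] by simp
qed

text \<open>If \<open>bc\<close> lay on \<open>F\<close> as well, then \<open>b\<close> and \<open>c\<close> would be disconnected by the removal of the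
  \<open>K4\<close>, so one of them would be a cut vertex.\<close>

lemma pendant_outer:
  assumes K: "K4 x v b c T1 T2 T3" and deg: "deg_in H v = 3"
    and F: "{v, b} \<in> boundary F" "{v, c} \<in> boundary F" "F \<notin> {T1, T2, T3}"
  shows "{b, c} \<notin> boundary F"
proof
  assume bc: "{b, c} \<in> boundary F"
  have d: "x \<noteq> v" "x \<noteq> b" "x \<noteq> c" "v \<noteq> b" "v \<noteq> c" "b \<noteq> c" and dT: "T1 \<noteq> T2" "T1 \<noteq> T3" "T2 \<noteq> T3"
    and B: "boundary T1 = {{x, b}, {x, c}, {b, c}}" "boundary T2 = {{x, v}, {x, c}, {v, c}}"
     "boundary T3 = {{x, v}, {x, b}, {v, b}}"
    using K by (auto simp: K4_def)
  let ?D = "K4_edges x"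
  have DH: "?D \<subseteq> H" by (auto simp: K4_edges_def)
  have in_D: "{b, c} \<in> ?D" "{v, b} \<in> ?D" "{v, c} \<in> ?D" "{x, b} \<in> ?D" unfolding K4_edges_eq[OF K] by auto
  have "c \<notin> reach (H - ?D) b"
  proof (rule separated[OF DH in_D(1)])
    fix A
    show "cut A \<inter> ?D \<noteq> {{b, c}}"
    proof
      assume eq: "cut A \<inter> ?D = {{b, c}}"
      have "{b, c} \<in> cut A \<inter> ?D" unfolding eq by simp
      moreover have "{v, b} \<notin> cut A \<inter> ?D" unfolding eq using d by (simp add: doubleton_eq_iff)
      moreover have "{v, c} \<notin> cut A \<inter> ?D" unfolding eq using d by (simp add: doubleton_eq_iff)
      moreover have "{x, b} \<notin> cut A \<inter> ?D" unfolding eq using d by (simp add: doubleton_eq_iff)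
      ultimately have *: "{b, c} \<in> cut A" "{v, b} \<notin> cut A" "{x, b} \<notin> cut A"
        using in_D by simp_all
      have "(T3 \<in> A) = (F \<in> A)" using mem_cut[of "{v, b}" T3 F A] * F B by auto
      moreover have "(T1 \<in> A) = (T3 \<in> A)" using mem_cut[of "{x, b}" T1 T3 A] * dT B by auto
      moreover have "(T1 \<in> A) \<noteq> (F \<in> A)" using mem_cut[of "{b, c}" T1 F A] * F B bc by auto
      ultimately show False by blast
    qed
  qed
  moreover have X: "b \<in> X" "c \<in> X" using edgeD K4_edge[OF K] by blast+
  moreover have "b \<in> e" if e: "e \<in> ?D" "e \<inter> reach (H - ?D) b \<noteq> {}" for e
  proof -
    have nx: "u \<notin> reach (H - ?D) b" if u: "u \<noteq> b" "{e\<in>H. u \<in> e} \<subseteq> ?D" for u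
    proof -
      have "reach (H - ?D) b \<subseteq> UNIV - {u}" using u by (intro reach_subset) auto
      then show ?thesis by blast
    qed
    have "{e\<in>H. v \<in> e} \<subseteq> ?D" unfolding pendant_edges[OF K deg] K4_edges_eq[OF K] by auto
    moreover have "{e\<in>H. x \<in> e} \<subseteq> ?D" unfolding K4_center_edges[OF K] K4_edges_eq[OF K] by auto
    ultimately have "v \<notin> reach (H - ?D) b" "x \<notin> reach (H - ?D) b" using nx d by auto
    then show ?thesis
      using e \<open>c \<notin> reach (H - ?D) b\<close> unfolding K4_edges_eq[OF K] by auto
  qed
  ultimately have "{e\<in>H. b \<in> e} \<subseteq> ?D" by (intro isolated_by_cut(2)) auto
  then have sub: "{e\<in>H. b \<in> e} = {e\<in>?D. b \<in> e}" using DH by auto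
  have "K4 x b v c T2 T1 T3" using K4_flip[OF K4_rotate[OF K]] .
  then have "deg_in H b = 3" unfolding deg_in_def sub by (rule K4_corner_edges(2))
  then show False using pendant_unique[OF K deg] by simp
qed

text \<open>The boundary of \<open>G\<close> continues from \<open>e\<close> through another edge at
  \<open>v\<close>, and only edges of the \<open>K4\<close> are left. It is not \<open>xv\<close>,
  which has triangles of the block on both sides, so \<open>G\<close> is the big face beyond
  \<open>vb\<close> or \<open>vc\<close>.\<close>

lemma degree_4_corner:
  assumes K: "K4 x v b c T1 T2 T3" and deg: "deg_in H v = 4"
    and e: "e \<in> boundary G" "v \<in> e" "e \<notin> K4_edges x"
  shows "big G"
proof -
  have eH: "e \<in> H" using boundary_edge e by blast
  have "insert e {e\<in>K4_edges x. v \<in> e} = {e\<in>H. v \<in> e}"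
    using K4_corner_edges(2)[OF K] deg e eH
    by (intro card_subset_eq) (auto simp: K4_edges_def deg_in_def)
  then have inc: "{e\<in>H. v \<in> e} = {e, {x, v}, {v, b}, {v, c}}" using K4_corner_edges(1)[OF K] by simp
  obtain u where u: "{v, u} \<in> boundary G" "{v, u} \<noteq> e"
    by (rule even_setD_other[OF simple_cut even_boundary[OF boundary_face[OF e(1)]] e(1,2)])
  have "{v, u} \<in> {e\<in>H. v \<in> e}" using boundary_edge[OF u(1)] by simp
  then have cases: "{v, u} = {x, v} \<or> {v, u} = {v, b} \<or> {v, u} = {v, c}" unfolding inc using u(2) by simp
  have G: "G \<notin> {T1, T2, T3}" using K4_boundary_subset[OF K] e by blast
  have result: "big G" if f: "f \<in> boundary G" "f \<in> boundary F" "f \<in> boundary T" "T \<in> {T1, T2, T3}" "big F" for f F T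
  proof -
    have "T \<noteq> F" using K4_tri[OF K] that not_tri_big by auto
    then show ?thesis using no_third_side[OF f(2,3) _ f(1)] that G by metis
  qed
  obtain F2 where F2: "big F2" "{c, v} \<in> boundary F2" using K4_outer[OF K4_rotate[OF K]] by metis
  obtain F3 where F3: "big F3" "{v, b} \<in> boundary F3" using K4_outer[OF K4_rotate[OF K4_rotate[OF K]]] by metis
  have B: "boundary T2 = {{x, v}, {x, c}, {v, c}}" "boundary T3 = {{x, v}, {x, b}, {v, b}}" "T2 \<noteq> T3"
    using K by (auto simp: K4_def)
  from cases show ?thesis
  proof (elim disjE)
    assume "{v, u} = {x, v}"
    then have "G = T2 \<or> G = T3" using no_third_side[of "{x, v}" T2 T3 G] B u by auto
    then show ?thesis using G by auto
  next
    assume "{v, u} = {v, b}"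
    then show ?thesis using result[of "{v, b}" F3 T3] u F3 B by auto
  next
    assume "{v, u} = {v, c}"
    moreover have "{v, c} = {c, v}" by blast
    ultimately show ?thesis using result[of "{v, c}" F2 T2] u F2 B by auto
  qed
qed

definition pendant_at :: "'b \<Rightarrow> 'a set" where
  "pendant_at F = {v\<in>pendant. \<exists>e\<in>boundary F. v \<in> e}"

lemma pendant_has_face:
  assumes "v \<in> pendant"
  obtains F where "F \<in> \<Phi>" "big F" "v \<in> pendant_at F"
proof -
  obtain x where "center x" "{x, v} \<in> H" using assms by (auto simp: pendant_def)
  then obtain b c T1 T2 T3 where K: "K4 x v b c T1 T2 T3" by (rule center_corner)
  obtain F where F: "big F" "F \<in> \<Phi>" "{v, b} \<in> boundary F" using K4_outer[OF K4_rotate[OF K4_rotate[OF K]]] by metis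
  have "v \<in> pendant_at F"
    unfolding pendant_at_def using assms by (auto intro!: bexI[OF _ F(3)])
  then show ?thesis using that F by blast
qed

lemma pendant_at_K4:
  assumes "v \<in> pendant_at F" "big F"
  shows "\<exists>x b c T1 T2 T3. K4 x v b c T1 T2 T3 \<and> {v, b} \<in> boundary F \<and> {v, c} \<in> boundary F"
proof -
  obtain e where e: "e \<in> boundary F" "v \<in> e" and v: "v \<in> pendant" using assms by (auto simp: pendant_at_def)
  obtain x where "center x" "{x, v} \<in> H" and deg: "deg_in H v = 3" using v by (auto simp: pendant_def)
  then obtain b c T1 T2 T3 where K: "K4 x v b c T1 T2 T3" using center_corner by metis
  have nxv: "{x, v} \<notin> boundary F"
    using center_edge_tri(1)[of x "{x, v}" F] assms(2) not_tri_big \<open>center x\<close> by auto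
  have inc: "f = {v, b} \<or> f = {v, c}" if "f \<in> boundary F" "v \<in> f" for f
  proof -
    have "f \<in> {e\<in>H. v \<in> e}" using that boundary_edge by simp
    then show ?thesis using that nxv unfolding pendant_edges[OF K deg] by auto
  qed
  obtain u where u: "{v, u} \<in> boundary F" "{v, u} \<noteq> e"
    by (rule even_setD_other[OF simple_cut even_boundary[OF boundary_face[OF e(1)]] e])
  have "{v, u} = {v, b} \<or> {v, u} = {v, c}" by (rule inc[OF u(1)]) simp
  with inc[OF e] have "{v, b} \<in> boundary F \<and> {v, c} \<in> boundary F"
    using u e(1) by metis
  then show ?thesis using K by blast
qed

text \<open>Each pendant corner on a face \<open>F\<close> allows a shortcut through its \<open>K4\<close>, which shortens the boundary
  of \<open>F\<close> by one; shortening it to length five is impossible.\<close>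

lemma card_pendant_at:
  assumes F: "F \<in> \<Phi>" "big F"
  shows "card (pendant_at F) + 6 \<le> card (boundary F)"
proof (rule ccontr)
  assume "\<not> ?thesis"
  then have many: "card (boundary F) - 5 \<le> card (pendant_at F)" using F(2) by (auto simp: big_def)
  obtain x b c T1 T2 T3 where K: "\<And>v. v \<in> pendant_at F \<Longrightarrow> K4 (x v) v (b v) (c v) (T1 v) (T2 v) (T3 v)"
    and vb: "\<And>v. v \<in> pendant_at F \<Longrightarrow> {v, b v} \<in> boundary F"
    and vc: "\<And>v. v \<in> pendant_at F \<Longrightarrow> {v, c v} \<in> boundary F"
    using pendant_at_K4[OF _ F(2)] by metis
  define S where "S v = {T1 v, T2 v, T3 v}" for v
  have deg: "deg_in H v = 3" if "v \<in> pendant_at F" for v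
    using that by (simp add: pendant_at_def pendant_def)
  have S_tri: "tri T" if "v \<in> pendant_at F" "T \<in> S v" for v T
    using K4_tri[OF K[OF that(1)]] that(2) by (auto simp: S_def)
  have F_S: "F \<notin> S v" if "v \<in> pendant_at F" for v
    using S_tri[OF that] F(2) not_tri_big by blast
  have S_disj: "S v \<inter> S w = {}" if vw: "v \<in> pendant_at F" "w \<in> pendant_at F" "v \<noteq> w" for v w
  proof (rule ccontr)
    assume "S v \<inter> S w \<noteq> {}"
    then obtain T where T: "T \<in> S v" "T \<in> S w" by blast
    then have sub: "boundary T \<subseteq> K4_edges (x v)" "boundary T \<subseteq> K4_edges (x w)"
      using K4_boundary_subset[OF K] vw by (auto simp: S_def)
    have "boundary T \<noteq> {}" using S_tri[OF vw(1) T(1)] by (auto simp: tri_def)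
    then have "K4_edges (x v) \<inter> K4_edges (x w) \<noteq> {}" using sub by blast
    moreover have "center (x v)" "center (x w)" using K vw unfolding center_def by blast+
    ultimately have "x v = x w" using K4_edges_disjoint by blast
    then have "{x v, w} \<in> H" using K4_edge(1)[OF K[OF vw(2)]] by simp
    then have "w \<in> {v, b v, c v}" using K4_neighbours[OF K[OF vw(1)]] by blast
    then have "w = b v \<or> w = c v" using vw(3) by blast
    then show False
      using pendant_unique[OF K[OF vw(1)] deg[OF vw(1)]] pendant_unique[OF K4_flip[OF K[OF vw(1)]] deg[OF vw(1)]]
        deg[OF vw(2)] by blast
  qed
  define A where "A J = insert F (\<Union>v\<in>J. S v)" for J
  have count: "card (cut (A J)) + card J = card (boundary F)" if "J \<subseteq> pendant_at F" for J
  proof -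
    have "finite J" by simp
    then show ?thesis using that
    proof (induction J)
      case empty
      then show ?case by (simp add: A_def)
    next
      case (insert v J)
      then have v: "v \<in> pendant_at F" and J: "J \<subseteq> pendant_at F" by auto
      note Kv = K[OF v]
      have d: "x v \<noteq> v" "x v \<noteq> b v" "x v \<noteq> c v" "v \<noteq> b v" "v \<noteq> c v" "b v \<noteq> c v"
        and dT: "T1 v \<noteq> T2 v" "T1 v \<noteq> T3 v" "T2 v \<noteq> T3 v"
        and B: "boundary (T1 v) = {{x v, b v}, {x v, c v}, {b v, c v}}" "boundary (T2 v) = {{x v, v}, {x v, c v}, {v, c v}}"
         "boundary (T3 v) = {{x v, v}, {x v, b v}, {v, b v}}"
        using Kv by (auto simp: K4_def)
      \<comment> \<open>The face beyond \<open>bc\<close> is big and differs from \<open>F\<close>,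
        so it is not among the faces glued so far. Hence gluing the block of \<open>v\<close>
        replaces the boundary edges \<open>vb\<close> and \<open>vc\<close> by the single edge
        \<open>bc\<close>.\<close>
      obtain F1 where F1: "big F1" "{b v, c v} \<in> boundary F1" "F1 \<notin> {T1 v, T2 v, T3 v}" using K4_outer[OF Kv] by metis
      have nF: "{b v, c v} \<notin> boundary F"
        using pendant_outer[OF Kv deg[OF v] vb[OF v] vc[OF v]] F_S[OF v] by (simp add: S_def)
      have AJ: "A J \<inter> S v = {}"
        using S_disj[OF v] F_S[OF v] J insert(2) by (auto simp: A_def)
      have F1A: "F1 \<notin> A J" using F1(1,2) nF S_tri J not_tri_big unfolding A_def by blast
      have FA: "F \<in> A J" by (simp add: A_def)
      have TA: "T1 v \<notin> A J" "T2 v \<notin> A J" "T3 v \<notin> A J" using AJ by (auto simp: S_def)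
      have FT: "F \<noteq> T1 v" "F \<noteq> T2 v" "F \<noteq> T3 v" using F_S[OF v] by (auto simp: S_def)
      have cutS: "cut (S v) = {{b v, c v}, {v, b v}, {v, c v}}"
      proof -
        have in_S: "e \<in> boundary (T1 v) \<or> e \<in> boundary (T2 v) \<or> e \<in> boundary (T3 v)" if "e \<in> cut (S v)" for e
          using that by (auto simp: dual_cut_def S_def)
        have "{x v, v} \<notin> cut (S v)" using mem_cut[of "{x v, v}" "T2 v" "T3 v" "S v"] B dT by (auto simp: S_def)
        moreover have "{x v, b v} \<notin> cut (S v)" using mem_cut[of "{x v, b v}" "T1 v" "T3 v" "S v"] B dT by (auto simp: S_def)
        moreover have "{x v, c v} \<notin> cut (S v)" using mem_cut[of "{x v, c v}" "T1 v" "T2 v" "S v"] B dT by (auto simp: S_def)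
        ultimately have "cut (S v) \<subseteq> {{b v, c v}, {v, b v}, {v, c v}}"
          using in_S unfolding B by blast
        moreover have "{b v, c v} \<in> cut (S v)" using mem_cut[of "{b v, c v}" "T1 v" F1 "S v"] F1 B by (auto simp: S_def)
        moreover have "{v, b v} \<in> cut (S v)" using mem_cut[of "{v, b v}" "T3 v" F "S v"] vb[OF v] F_S[OF v] B by (auto simp: S_def)
        moreover have "{v, c v} \<in> cut (S v)" using mem_cut[of "{v, c v}" "T2 v" F "S v"] vc[OF v] F_S[OF v] B by (auto simp: S_def)
        ultimately show ?thesis by blast
      qed
      have "{b v, c v} \<notin> cut (A J)" using mem_cut[of "{b v, c v}" "T1 v" F1 "A J"] F1 B F1A TA by auto
      moreover have "{v, b v} \<in> cut (A J)" using mem_cut[of "{v, b v}" "T3 v" F "A J"] vb[OF v] FA FT B TA by auto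
      moreover have "{v, c v} \<in> cut (A J)" using mem_cut[of "{v, c v}" "T2 v" F "A J"] vc[OF v] FA FT B TA by auto
      ultimately have "cut (A J) \<inter> cut (S v) = {{v, b v}, {v, c v}}" unfolding cutS by blast
      moreover have "card {{v, b v}, {v, c v}} = 2" "card (cut (S v)) = 3"
        unfolding cutS using d by (auto simp: doubleton_eq_iff)
      ultimately have "card (cut (A J \<union> S v)) + 1 = card (cut (A J))"
        using card_cut_Un[OF AJ] by simp
      moreover have "A J \<union> S v = A (insert v J)" by (auto simp: A_def)
      ultimately show ?case using insert J by simp
    qed
  qed
  obtain J where J: "J \<subseteq> pendant_at F" "card J = card (boundary F) - 5"
    using obtain_subset_with_card_n[OF many] by metis
  have "A J \<subseteq> \<Phi>"
    using F K4_face[OF K] J(1) by (auto simp: A_def S_def)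
  moreover have "card (cut (A J)) = 5" using count[OF J(1)] J(2) F(2) by (simp add: big_def)
  ultimately show False using even_set_not_5 by blast
qed

text \<open>By Euler's formula the goal \<open>5 e + 33 \<le> 12 n\<close> is \<open>33 f + 9 n \<le> 23 e\<close>. Every edge starts with
  23, of which the faces on its sides take equal shares of their demand 33, computed as if a face with
  more than six edges had exactly six; what is left pays for the vertices.\<close>

definition face_share :: "'b \<Rightarrow> real" where
  "face_share F = (if tri F then 11 else if card (boundary F) = 4 then 33 / 4 else 11 / 2)"

definition charge :: "'a set \<Rightarrow> real" where
  "charge e = 23 - face_share (L e) - face_share (R e)"

section \<open>Charges of edges\<close>

lemma face_share_big: "big F \<Longrightarrow> face_share F = 11 / 2"
  by (auto simp: face_share_def big_def tri_def)

lemma face_share_tri: "tri F \<Longrightarrow> face_share F = 11"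
  by (simp add: face_share_def)

lemma boundary_sides: "e \<in> H \<Longrightarrow> e \<in> boundary (L e)" "e \<in> H \<Longrightarrow> e \<in> boundary (R e)"
  by (auto simp: in_boundary)

text \<open>Between two triangles 23 - 11 - 11 = 1 remains. Otherwise either a triangle has a big
  face across the edge or both faces have at least four edges, and 23 - 11 - 11/2 and 23 - 33/4 -
  33/4 are both 13/2.\<close>

lemma charge_ge:
  assumes "e \<in> H"
  shows "charge e \<ge> 1" and "\<not> (tri (L e) \<and> tri (R e)) \<Longrightarrow> charge e \<ge> 13 / 2"
proof -
  show "charge e \<ge> 1" by (simp add: charge_def face_share_def)
  assume nt: "\<not> (tri (L e) \<and> tri (R e))"
  note b = boundary_sides[OF assms] and d = sides_distinct[OF assms]
  show "charge e \<ge> 13 / 2"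
  proof (cases "tri (L e) \<or> tri (R e)")
    case True
    then show ?thesis
    proof
      assume t: "tri (L e)"
      have "big (R e)" using tri_neighbour[OF b d t] nt t by simp
      then show ?thesis using t by (simp add: charge_def face_share_big face_share_tri)
    next
      assume t: "tri (R e)"
      have "big (L e)" using tri_neighbour[OF b(2,1) d[symmetric] t] nt t by simp
      then show ?thesis using t by (simp add: charge_def face_share_big face_share_tri)
    qed
  next
    case False
    have "face_share F \<le> 33 / 4" if "\<not> tri F" for F using that by (simp add: face_share_def)
    then have "face_share (L e) \<le> 33 / 4" "face_share (R e) \<le> 33 / 4" using False by blast+
    then show ?thesis unfolding charge_def by linarith
  qed
qed

text \<open>Six edges of a big face already pay its 33. Every further edge leaves 11/2 over, and by
  \<open>card_pendant_at\<close> there are at least as many of these as pendant corners on the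
  face.\<close>

lemma sum_charge:
  "33 * real (card \<Phi>) + 11 / 2 * real (card pendant) \<le> 23 * real (card H) - (\<Sum>e\<in>H. charge e)"
proof -
  have face: "33 + 11 / 2 * (if big F then real (card (pendant_at F)) else 0) \<le> face_share F * real (card (boundary F))"
    if F: "F \<in> \<Phi>" for F
  proof (cases "big F")
    case True
    then have "real (card (pendant_at F)) + 6 \<le> real (card (boundary F))"
      using card_pendant_at[OF F True] by linarith
    then show ?thesis using True by (simp add: face_share_big)
  next
    case False
    then show ?thesis using face_sizes[OF F] by (auto simp: face_share_def tri_def)
  qed
  have "pendant \<subseteq> (\<Union>F\<in>{F\<in>\<Phi>. big F}. pendant_at F)"
    using pendant_has_face by blast
  then have "card pendant \<le> card (\<Union>F\<in>{F\<in>\<Phi>. big F}. pendant_at F)"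
    by (intro card_mono) auto
  also have "\<dots> \<le> (\<Sum>F\<in>{F\<in>\<Phi>. big F}. card (pendant_at F))"
    using finite_faces by (intro card_UN_le) auto
  finally have "real (card pendant) \<le> real (\<Sum>F\<in>{F\<in>\<Phi>. big F}. card (pendant_at F))"
    by (rule of_nat_mono)
  also have "\<dots> = (\<Sum>F\<in>\<Phi>. if big F then real (card (pendant_at F)) else 0)"
    using finite_faces by (simp add: sum.inter_filter) (intro sum.cong, auto)
  finally have pend: "real (card pendant) \<le> (\<Sum>F\<in>\<Phi>. if big F then real (card (pendant_at F)) else 0)" .
  have "33 * real (card \<Phi>) + 11 / 2 * (\<Sum>F\<in>\<Phi>. if big F then real (card (pendant_at F)) else 0)
      = (\<Sum>F\<in>\<Phi>. 33 + 11 / 2 * (if big F then real (card (pendant_at F)) else 0))"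
    by (simp add: sum.distrib sum_distrib_left del: mult_if_delta)
  also have "\<dots> \<le> (\<Sum>F\<in>\<Phi>. face_share F * real (card (boundary F)))"
    by (rule sum_mono) (rule face)
  also have "\<dots> = (\<Sum>e\<in>H. 23 - charge e)"
    unfolding sum_boundary using sides_distinct by (intro sum.cong) (auto simp: charge_def)
  also have "\<dots> = 23 * real (card H) - (\<Sum>e\<in>H. charge e)"
    by (simp add: sum_subtractf)
  finally show ?thesis using pend by linarith
qed

definition all_K4_edges :: "'a set set" where
  "all_K4_edges = (\<Union>x\<in>{x. center x}. K4_edges x)"

lemma K4_edges_sub: "center x \<Longrightarrow> K4_edges x \<subseteq> all_K4_edges"
  by (auto simp: all_K4_edges_def)

lemma all_K4_edges_sub: "all_K4_edges \<subseteq> H"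
  by (auto simp: all_K4_edges_def K4_edges_def)

text \<open>The three edges at the centre keep at least 1 each and the three outer ones 13/2 each.
  The total 45/2 is exactly what the block has to pay: 9 for its centre and 9/2 for each
  corner.\<close>

lemma sum_charge_K4: "45 / 2 * real (card {x. center x}) \<le> (\<Sum>e\<in>all_K4_edges. charge e)"
proof -
  have one: "45 / 2 \<le> (\<Sum>e\<in>K4_edges x. charge e)" if x: "center x" for x
  proof -
    obtain a b c T1 T2 T3 where K: "K4 x a b c T1 T2 T3" using x by (auto simp: center_def)
    have d: "x \<noteq> a" "x \<noteq> b" "x \<noteq> c" "a \<noteq> b" "a \<noteq> c" "b \<noteq> c" using K by (auto simp: K4_def)
    have outer: "charge e \<ge> 13 / 2" if e: "e \<in> K4_edges x" "x \<notin> e" for e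
    proof -
      obtain p q T F where "e = {p, q}" "{x, p} \<in> H" "{x, q} \<in> H" and F: "tri T" "big F" "e \<in> boundary T" "e \<in> boundary F"
        and "boundary T = {{x, p}, {x, q}, {p, q}}" "boundary T \<subseteq> K4_edges x" "p \<noteq> q" "x \<noteq> p" "x \<noteq> q"
        using outer_edge[OF x e] .
      have "T \<noteq> F" using F not_tri_big by blast
      then have "\<not> (tri (L e) \<and> tri (R e))" using two_sides[OF F(3,4)] F(2) not_tri_big by blast
      then show ?thesis using charge_ge(2) boundary_edge[OF F(3)] by blast
    qed
    have "(\<Sum>e\<in>K4_edges x. charge e)
        = charge {x, a} + charge {x, b} + charge {x, c} + charge {a, b} + charge {a, c} + charge {b, c}"
      unfolding K4_edges_eq[OF K] using d by (simp add: doubleton_eq_iff)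
    moreover have "charge {x, a} \<ge> 1" "charge {x, b} \<ge> 1" "charge {x, c} \<ge> 1"
      using charge_ge(1) K4_edge[OF K] by blast+
    moreover have "charge {a, b} \<ge> 13 / 2" "charge {a, c} \<ge> 13 / 2" "charge {b, c} \<ge> 13 / 2"
      using d outer[of "{a, b}"] outer[of "{a, c}"] outer[of "{b, c}"] by (simp_all add: K4_edges_eq[OF K])
    ultimately show ?thesis by linarith
  qed
  have "45 / 2 * real (card {x. center x}) = (\<Sum>x\<in>{x. center x}. 45 / 2)" by simp
  also have "\<dots> \<le> (\<Sum>x\<in>{x. center x}. \<Sum>e\<in>K4_edges x. charge e)"
    using one by (intro sum_mono) auto
  also have "\<dots> = (\<Sum>e\<in>all_K4_edges. charge e)"
    unfolding all_K4_edges_def using K4_edges_disjoint by (intro sum.UNION_disjoint[symmetric]) auto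
  finally show ?thesis .
qed

section \<open>Demands of vertices\<close>

definition corner_count :: "'a \<Rightarrow> nat" where
  "corner_count v = card {x. center x \<and> {x, v} \<in> H}"

text \<open>The share of the demand 9 of a vertex that falls on each of its edges outside the \<open>K4\<close>s; a
  \<open>K4\<close> pays \<open>9/2\<close> to each of its corners.\<close>

definition demand :: "'a \<Rightarrow> real" where
  "demand v = (if corner_count v = 0 then 9 / real (deg_in H v) else (9 / 2) / (real (deg_in H v) - 3))"

lemma demand_nonneg: "v \<in> X \<Longrightarrow> demand v \<ge> 0"
  using degree_ge_3[of v] by (simp add: demand_def)

lemma vertex_demand:
  assumes v: "v \<in> X" "\<not> center v"
  shows "9 \<le> 9 / 2 * real (corner_count v) + demand v * real (card {e\<in>H - all_K4_edges. v \<in> e})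
    + 9 / 2 * of_bool (v \<in> pendant)"
proof -
  have K4_at: "{x, v} \<in> H" if "center x" "e \<in> K4_edges x" "v \<in> e" for x e
    using that v(2) by (auto simp: K4_edges_def)
  have deg: "deg_in H v \<ge> 3" using degree_ge_3 v by blast
  consider "corner_count v = 0" | "corner_count v = 1" | "corner_count v \<ge> 2" by linarith
  then show ?thesis
  proof cases
    case 1
    then have "{x. center x \<and> {x, v} \<in> H} = {}" by (simp add: corner_count_def)
    then have "{e\<in>H - all_K4_edges. v \<in> e} = {e\<in>H. v \<in> e}"
      using K4_at by (auto simp: all_K4_edges_def)
    then have "real (card {e\<in>H - all_K4_edges. v \<in> e}) = real (deg_in H v)" by (simp add: deg_in_def)
    then show ?thesis using 1 deg by (simp add: demand_def)
  next
    case 2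
    then obtain x where x: "{x. center x \<and> {x, v} \<in> H} = {x}" by (auto simp: corner_count_def card_1_singleton_iff)
    then have xc: "center x" "{x, v} \<in> H" by auto
    have only: "y = x" if "center y" "{y, v} \<in> H" for y
      using that x by auto
    obtain b c T1 T2 T3 where K: "K4 x v b c T1 T2 T3" using center_corner[OF xc] .
    have at: "{e\<in>all_K4_edges. v \<in> e} = {e\<in>K4_edges x. v \<in> e}"
      using K4_at only K4_edges_sub[OF xc(1)] by (auto simp: all_K4_edges_def)
    have "{e\<in>H. v \<in> e} = {e\<in>H - all_K4_edges. v \<in> e} \<union> {e\<in>K4_edges x. v \<in> e}"
      unfolding at[symmetric] using all_K4_edges_sub by blast
    moreover have "{e\<in>H - all_K4_edges. v \<in> e} \<inter> {e\<in>K4_edges x. v \<in> e} = {}"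
      using K4_edges_sub[OF xc(1)] by blast
    ultimately have "deg_in H v = card {e\<in>H - all_K4_edges. v \<in> e} + 3"
      unfolding deg_in_def using K4_corner_edges(2)[OF K] by (simp add: card_Un_disjoint)
    then have nk: "real (card {e\<in>H - all_K4_edges. v \<in> e}) = real (deg_in H v) - 3" by simp
    show ?thesis
    proof (cases "deg_in H v = 3")
      case True
      \<comment> \<open>All edges at \<open>v\<close> lie in its \<open>K4\<close>. The divisor in
        \<open>demand v\<close> is zero, hence so is the demand, and the second half of the 9 is
        left to the faces through the last summand.\<close>
      then have "v \<in> pendant" using v xc by (auto simp: pendant_def)
      then show ?thesis unfolding nk using 2 True by simp
    next
      case False
      then have "real (deg_in H v) - 3 > 0" using deg by linarith
      moreover have "demand v = (9 / 2) / (real (deg_in H v) - 3)" using 2 unfolding demand_def by simp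
      ultimately have "demand v * (real (deg_in H v) - 3) = 9 / 2"
        using nonzero_eq_divide_eq[of "real (deg_in H v) - 3" "demand v" "9 / 2"] by simp
      then show ?thesis unfolding nk using 2 by simp
    qed
  next
    case 3
    then have "9 \<le> 9 / 2 * real (corner_count v)" by simp
    moreover have "0 \<le> demand v * real (card {e\<in>H - all_K4_edges. v \<in> e})"
      using demand_nonneg[OF v(1)] by simp
    moreover have "0 \<le> 9 / 2 * (of_bool (v \<in> pendant) :: real)" by simp
    ultimately show ?thesis by linarith
  qed
qed

lemma corner_with_other_edge:
  assumes e: "e \<in> H - all_K4_edges" "v \<in> e" and j: "corner_count v \<noteq> 0"
  obtains x b c T1 T2 T3 where "K4 x v b c T1 T2 T3" "center x"
proof -
  have "{x. center x \<and> {x, v} \<in> H} \<noteq> {}" using j unfolding corner_count_def by (metis card.empty)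
  then obtain x where x: "center x" "{x, v} \<in> H" by blast
  obtain b c T1 T2 T3 where "K4 x v b c T1 T2 T3" using center_corner[OF x] .
  then show ?thesis using that x by blast
qed

lemma corner_degree:
  assumes W: "W \<subseteq> H - all_K4_edges" "\<And>e. e \<in> W \<Longrightarrow> v \<in> e" and K: "K4 x v b c T1 T2 T3"
  shows "deg_in H v \<ge> card W + 3"
proof -
  have c: "center x" using K unfolding center_def by blast
  have "W \<inter> {e\<in>K4_edges x. v \<in> e} = {}" using W(1) K4_edges_sub[OF c] by blast
  then have "card (W \<union> {e\<in>K4_edges x. v \<in> e}) = card W + 3"
    using K4_corner_edges(2)[OF K] by (simp add: card_Un_disjoint)
  moreover have "card (W \<union> {e\<in>K4_edges x. v \<in> e}) \<le> card {e\<in>H. v \<in> e}"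
    using W by (intro card_mono) (auto simp: K4_edges_def)
  ultimately show ?thesis by (simp add: deg_in_def)
qed

lemma demand_bound:
  assumes "v \<in> X"
  shows "corner_count v = 0 \<Longrightarrow> demand v \<le> 3"
    and "corner_count v = 0 \<Longrightarrow> deg_in H v \<ge> 4 \<Longrightarrow> demand v \<le> 9 / 4"
    and "corner_count v = 0 \<Longrightarrow> deg_in H v \<ge> 5 \<Longrightarrow> demand v \<le> 9 / 5"
    and "corner_count v \<noteq> 0 \<Longrightarrow> deg_in H v \<ge> 5 \<Longrightarrow> demand v \<le> 9 / 4"
    and "corner_count v \<noteq> 0 \<Longrightarrow> deg_in H v \<ge> 6 \<Longrightarrow> demand v \<le> 9 / 5"
    and "corner_count v \<noteq> 0 \<Longrightarrow> deg_in H v \<ge> 4 \<Longrightarrow> demand v \<le> 9 / 2"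
  using degree_ge_3[OF assms] by (auto simp: demand_def divide_simps)

text \<open>Only a corner of degree four can ask for more than 3: its single further edge carries
  9/2, but by \<open>degree_4_corner\<close> lies between two big faces and has charge 12. So two
  ends cost at most 9 there, and at most 6 < 13/2 on the other edges that do not separate two
  triangles.\<close>

lemma demand_le:
  assumes e: "e \<in> H - all_K4_edges" "v \<in> e"
  shows "demand v \<le> 3 \<or> demand v \<le> 9 / 2 \<and> big (L e) \<and> big (R e)"
    and "tri (L e) \<or> tri (R e) \<Longrightarrow> demand v \<le> 3 \<and> (deg_in H v \<ge> 4 \<longrightarrow> demand v \<le> 9 / 4)"
proof -
  have v: "v \<in> X" using edges_in e by auto
  have "demand v \<le> 3 \<and> (deg_in H v \<ge> 4 \<longrightarrow> demand v \<le> 9 / 4)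
    \<or> demand v \<le> 9 / 2 \<and> big (L e) \<and> big (R e)"
  proof (cases "corner_count v = 0")
    case True
    then show ?thesis using demand_bound(1,2)[OF v] by blast
  next
    case False
    obtain x b c T1 T2 T3 where K: "K4 x v b c T1 T2 T3" and x: "center x"
      using corner_with_other_edge[OF e False] .
    have deg: "deg_in H v \<ge> 4" using corner_degree[of "{e}" v x b c T1 T2 T3] e K by simp
    have nK: "e \<notin> K4_edges x" using e K4_edges_sub[OF x] by blast
    show ?thesis
    proof (cases "deg_in H v = 4")
      case True
      have "big (L e)" "big (R e)"
        using degree_4_corner[OF K True _ e(2) nK] boundary_sides e(1) by blast+
      then show ?thesis using demand_bound(6)[OF v False deg] by blast
    next
      case 5: False
      then have "demand v \<le> 9 / 4" using demand_bound(4)[OF v False] deg by linarith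
      then show ?thesis by linarith
    qed
  qed
  then show "demand v \<le> 3 \<or> demand v \<le> 9 / 2 \<and> big (L e) \<and> big (R e)"
    "tri (L e) \<or> tri (R e) \<Longrightarrow> demand v \<le> 3 \<and> (deg_in H v \<ge> 4 \<longrightarrow> demand v \<le> 9 / 4)"
    using not_tri_big by blast+
qed

section \<open>Balance of the edges outside the blocks\<close>

definition surplus :: "'a set \<Rightarrow> real" where
  "surplus e = charge e - (\<Sum>v\<in>e. demand v)"

lemma surplus_single:
  assumes e: "e \<in> H - all_K4_edges" "\<not> (tri (L e) \<and> tri (R e))"
  shows "surplus e \<ge> 0"
proof -
  have "card e = 2" using simple e by (auto simp: simple_graph_def)
  then obtain p q where pq: "e = {p, q}" "p \<noteq> q" by (auto simp: card_2_iff)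
  then have sum: "(\<Sum>v\<in>e. demand v) = demand p + demand q" by simp
  note p = demand_le(1)[OF e(1), of p] and q = demand_le(1)[OF e(1), of q]
  show ?thesis
  proof (cases "big (L e) \<and> big (R e)")
    case True
    then have "charge e = 12" by (simp add: charge_def face_share_big)
    moreover have "demand p \<le> 9 / 2" "demand q \<le> 9 / 2" using p q pq by auto
    ultimately show ?thesis unfolding surplus_def sum by linarith
  next
    case False
    then have "demand p \<le> 3" "demand q \<le> 3" using p q pq by auto
    moreover have "charge e \<ge> 13 / 2" using charge_ge(2)[OF _ e(2)] e(1) by blast
    ultimately show ?thesis unfolding surplus_def sum by linarith
  qed
qed

text \<open>With a charge of 1 such an edge may fail to pay for its ends. It is balanced together
  with the four other edges of its two triangles.\<close>

definition diagonals :: "'a set set" where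
  "diagonals = {m\<in>H - all_K4_edges. tri (L m) \<and> tri (R m)}"

lemma tri_third_vertex:
  assumes T: "tri T" and bc: "{b, c} \<in> boundary T"
  obtains a where "boundary T = {{b, c}, {b, a}, {c, a}}" "a \<noteq> b" "a \<noteq> c"
proof -
  obtain a where a: "{b, a} \<in> boundary T" "{b, a} \<noteq> {b, c}" "a \<noteq> b"
    by (rule even_setD_other[OF simple_cut even_boundary[OF boundary_face[OF bc]] bc insertI1])
  then have "c \<noteq> a" by blast
  then show ?thesis using that[of a] triangle_from_edges[OF T bc a(1)] a(3) by blast
qed

text \<open>If \<open>e\<close> lay in a \<open>K4\<close>, so would the whole triangle and with it
  \<open>m\<close>. If \<open>e\<close> had triangles on both sides, \<open>T\<close> would have two
  triangular neighbours, and \<open>two_tri_neighbours_K4\<close> would again put \<open>m\<close>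
  into a \<open>K4\<close>.\<close>

lemma diagonal_others:
  assumes m: "m \<in> diagonals" "m \<in> boundary T" and e: "e \<in> boundary T" "e \<noteq> m"
  shows "e \<in> H - all_K4_edges" "\<not> (tri (L e) \<and> tri (R e))"
proof -
  have mH: "m \<in> H" "m \<notin> all_K4_edges" and mt: "tri (L m)" "tri (R m)" using m(1) by (auto simp: diagonals_def)
  have T: "tri T" using m(2) mt by (auto simp: in_boundary)
  show "e \<in> H - all_K4_edges"
  proof -
    have "e \<notin> K4_edges x" if x: "center x" for x
    proof
      assume "e \<in> K4_edges x"
      then have "boundary T \<subseteq> K4_edges x" using tri_boundary_K4[OF x _ e(1) T] by blast
      then show False using m(2) mH(2) K4_edges_sub[OF x] by blast
    qed
    then show ?thesis using boundary_edge[OF e(1)] by (auto simp: all_K4_edges_def)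
  qed
  show "\<not> (tri (L e) \<and> tri (R e))"
  proof
    assume et: "tri (L e) \<and> tri (R e)"
    obtain G where G: "G \<noteq> T" "e \<in> boundary G" using other_side[OF e(1)] by metis
    obtain U where U: "U \<noteq> T" "m \<in> boundary U" using other_side[OF m(2)] by metis
    have "tri G" "tri U" using G(2) U(2) et mt by (auto simp: in_boundary)
    moreover have "G \<noteq> U" using shared_edge_unique[OF e(1) G(2) m(2)] U G e(2) by blast
    ultimately obtain x where "center x" "boundary T \<subseteq> K4_edges x"
      using two_tri_neighbours_K4[of G T U e m] T G U m(2) e(1) by metis
    then show False using m(2) mH(2) K4_edges_sub by blast
  qed
qed

text \<open>The five edges carry at least 1 + 4 * 13/2 = 27, while \<open>b\<close> and
  \<open>c\<close> are ends of three of them and \<open>a\<close> and \<open>z\<close> of two. If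
  all demands were 3, the cost would be 30, so \<open>incident\<close> has to exclude too many
  vertices of degree three.\<close>

lemma diagonal_block:
  assumes m: "m \<in> diagonals"
  shows "(\<Sum>e\<in>boundary (L m) \<union> boundary (R m). surplus e) \<ge> 0"
proof -
  have mH: "m \<in> H" "m \<in> H - all_K4_edges" and t: "tri (L m)" "tri (R m)" using m by (auto simp: diagonals_def)
  note mb = boundary_sides[OF mH(1)] and d = sides_distinct[OF mH(1)]
  have "card m = 2" using simple mH by (auto simp: simple_graph_def)
  then obtain b c where bc: "m = {b, c}" "b \<noteq> c" by (auto simp: card_2_iff)
  obtain a where a: "boundary (L m) = {{b, c}, {b, a}, {c, a}}" "a \<noteq> b" "a \<noteq> c"
    using tri_third_vertex[OF t(1), of b c] mb bc by metis
  obtain z where z: "boundary (R m) = {{b, c}, {b, z}, {c, z}}" "z \<noteq> b" "z \<noteq> c"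
    using tri_third_vertex[OF t(2), of b c] mb bc by metis
  have az: "a \<noteq> z"
  proof
    assume "a = z"
    then have "{b, a} \<in> boundary (L m)" "{b, a} \<in> boundary (R m)" using a z by auto
    then have "{b, a} = m" using shared_edge_unique[OF _ _ mb d] by blast
    then show False using bc a by (auto simp: doubleton_eq_iff)
  qed
  have ne: "{b, a} \<noteq> m" "{c, a} \<noteq> m" "{b, z} \<noteq> m" "{c, z} \<noteq> m"
    using bc a(2,3) z(2,3) by (auto simp: doubleton_eq_iff)
  have inL: "{b, a} \<in> boundary (L m)" "{c, a} \<in> boundary (L m)" and inR: "{b, z} \<in> boundary (R m)" "{c, z} \<in> boundary (R m)"
    by (simp_all add: a z)
  note o1 = diagonal_others[OF m mb(1) inL(1) ne(1)] and o2 = diagonal_others[OF m mb(1) inL(2) ne(2)]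
    and o3 = diagonal_others[OF m mb(2) inR(1) ne(3)] and o4 = diagonal_others[OF m mb(2) inR(2) ne(4)]
  have tL: "tri (L e) \<or> tri (R e)" if "e \<in> boundary (L m) \<or> e \<in> boundary (R m)" for e
    using that t by (auto simp: in_boundary)
  have X: "a \<in> X" "b \<in> X" "c \<in> X" "z \<in> X" using edgeD[of b a] edgeD[of c z] o1(1) o4(1) by auto
  note deg3 = degree_ge_3[OF X(1)] degree_ge_3[OF X(2)] degree_ge_3[OF X(3)] degree_ge_3[OF X(4)]
  have inc_a: "card ({e\<in>H. a \<in> e} - {{b, a}, {c, a}}) = deg_in H a - 2"
    using o1(1) o2(1) bc a(2,3) by (subst card_Diff_subset) (auto simp: deg_in_def doubleton_eq_iff)
  have inc_z: "card ({e\<in>H. z \<in> e} - {{b, z}, {c, z}}) = deg_in H z - 2"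
    using o3(1) o4(1) bc z(2,3) by (subst card_Diff_subset) (auto simp: deg_in_def doubleton_eq_iff)
  have inc_b: "card ({e\<in>H. b \<in> e} - {{b, c}, {b, a}, {b, z}}) = deg_in H b - 3"
    using o1(1) o3(1) mH(1) bc a(2,3) z(2,3) az by (subst card_Diff_subset) (auto simp: deg_in_def doubleton_eq_iff)
  have inc_c: "card ({e\<in>H. c \<in> e} - {{b, c}, {c, a}, {c, z}}) = deg_in H c - 3"
    using o2(1) o4(1) mH(1) bc a(2,3) z(2,3) az by (subst card_Diff_subset) (auto simp: deg_in_def doubleton_eq_iff)
  define five where "five = {{b, c}, {b, a}, {c, a}, {b, z}, {c, z}}"
  have card_five: "card five \<le> 5" unfolding five_def by (simp add: card_insert_if)
  \<comment> \<open>Three vertices meet at least seven edges, and the edges of their triangle count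
    twice in the degree sum, which is thus at least 7 + 3 = 10. For all four vertices it is at least
    9 + 5 = 14.\<close>
  have triple: "deg_in H y + deg_in H b + deg_in H c \<ge> 10"
    if y: "y = a \<or> y = z" and inc_y: "card ({e\<in>H. y \<in> e} - {{b, y}, {c, y}}) = deg_in H y - 2" and dy: "deg_in H y \<ge> 3" for y
  proof -
    have "{e\<in>H. e \<inter> {y, b, c} \<noteq> {}} \<subseteq> ({e\<in>H. y \<in> e} - {{b, y}, {c, y}}) \<union> ({e\<in>H. b \<in> e} - {{b, c}, {b, a}, {b, z}})
        \<union> ({e\<in>H. c \<in> e} - {{b, c}, {c, a}, {c, z}}) \<union> five"
      using y by (auto simp: five_def)
    then have "card {e\<in>H. e \<inter> {y, b, c} \<noteq> {}} \<le> card (({e\<in>H. y \<in> e} - {{b, y}, {c, y}}) \<union> ({e\<in>H. b \<in> e} - {{b, c}, {b, a}, {b, z}})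
        \<union> ({e\<in>H. c \<in> e} - {{b, c}, {c, a}, {c, z}}) \<union> five)"
      by (intro card_mono) auto
    also have "\<dots> \<le> (deg_in H y - 2) + (deg_in H b - 3) + (deg_in H c - 3) + 5"
      using card_five unfolding inc_y[symmetric] inc_b[symmetric] inc_c[symmetric]
      by (intro order_trans[OF card_Un_le] add_mono) auto
    finally have "card {e\<in>H. e \<inter> {y, b, c} \<noteq> {}} \<le> (deg_in H y - 2) + (deg_in H b - 3) + (deg_in H c - 3) + 5" .
    moreover have "card {y, b, c} = 3" "{y, b, c} \<subseteq> X" using y X bc(2) a(2,3) z(2,3) by auto
    ultimately show ?thesis using incident_small[of "{y, b, c}"] deg3 dy by simp
  qed
  have quad: "deg_in H a + deg_in H b + deg_in H c + deg_in H z \<ge> 14"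
  proof -
    have "{e\<in>H. e \<inter> {a, b, c, z} \<noteq> {}} \<subseteq> ({e\<in>H. a \<in> e} - {{b, a}, {c, a}}) \<union> ({e\<in>H. b \<in> e} - {{b, c}, {b, a}, {b, z}})
        \<union> ({e\<in>H. c \<in> e} - {{b, c}, {c, a}, {c, z}}) \<union> ({e\<in>H. z \<in> e} - {{b, z}, {c, z}}) \<union> five"
      by (auto simp: five_def)
    then have "card {e\<in>H. e \<inter> {a, b, c, z} \<noteq> {}} \<le> card (({e\<in>H. a \<in> e} - {{b, a}, {c, a}}) \<union> ({e\<in>H. b \<in> e} - {{b, c}, {b, a}, {b, z}})
        \<union> ({e\<in>H. c \<in> e} - {{b, c}, {c, a}, {c, z}}) \<union> ({e\<in>H. z \<in> e} - {{b, z}, {c, z}}) \<union> five)"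
      by (intro card_mono) auto
    also have "\<dots> \<le> (deg_in H a - 2) + (deg_in H b - 3) + (deg_in H c - 3) + (deg_in H z - 2) + 5"
      using card_five unfolding inc_a[symmetric] inc_b[symmetric] inc_c[symmetric] inc_z[symmetric]
      by (intro order_trans[OF card_Un_le] add_mono) auto
    finally have "card {e\<in>H. e \<inter> {a, b, c, z} \<noteq> {}} \<le> (deg_in H a - 2) + (deg_in H b - 3) + (deg_in H c - 3) + (deg_in H z - 2) + 5" .
    moreover have "card {a, b, c, z} = 4" "{a, b, c, z} \<subseteq> X" using X bc(2) a(2,3) z(2,3) az by auto
    ultimately show ?thesis using incident_small[of "{a, b, c, z}"] deg3 by simp
  qed
  have da: "demand a \<le> 3" "deg_in H a \<ge> 4 \<Longrightarrow> demand a \<le> 9 / 4"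
    using demand_le(2)[OF o1(1), of a] tL[of "{b, a}"] inL by auto
  have dz: "demand z \<le> 3" "deg_in H z \<ge> 4 \<Longrightarrow> demand z \<le> 9 / 4"
    using demand_le(2)[OF o3(1), of z] tL[of "{b, z}"] inR by auto
  \<comment> \<open>If \<open>u\<close> is a corner, it has three edges in its \<open>K4\<close>
    besides the three edges of \<open>W\<close>, hence degree at least six.\<close>
  have hub: "demand u \<le> 3 \<and> (deg_in H u \<ge> 4 \<longrightarrow> demand u \<le> 9 / 4) \<and> (deg_in H u \<ge> 5 \<longrightarrow> demand u \<le> 9 / 5)"
    if W: "W \<subseteq> H - all_K4_edges" "\<And>e. e \<in> W \<Longrightarrow> u \<in> e" "card W = 3" and u: "u \<in> m" for u W
  proof -
    have uX: "u \<in> X" using u mH edges_in by blast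
    have "demand u \<le> 9 / 5" if "deg_in H u \<ge> 5"
    proof (cases "corner_count u = 0")
      case True
      then show ?thesis using demand_bound(3)[OF uX] that by blast
    next
      case False
      obtain x b c T1 T2 T3 where K: "K4 x u b c T1 T2 T3" "center x"
        using corner_with_other_edge[OF mH(2) u False] .
      have "deg_in H u \<ge> 6" using corner_degree[OF W(1,2) K(1)] W(3) by simp
      then show ?thesis using demand_bound(5)[OF uX False] by blast
    qed
    then show ?thesis using demand_le(2)[OF mH(2) u] t by blast
  qed
  have db: "demand b \<le> 3" "deg_in H b \<ge> 4 \<Longrightarrow> demand b \<le> 9 / 4" "deg_in H b \<ge> 5 \<Longrightarrow> demand b \<le> 9 / 5"
    using hub[of "{{b, c}, {b, a}, {b, z}}" b] mH o1 o3 bc a(2,3) z(2,3) az by (auto simp: doubleton_eq_iff)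
  have dc: "demand c \<le> 3" "deg_in H c \<ge> 4 \<Longrightarrow> demand c \<le> 9 / 4" "deg_in H c \<ge> 5 \<Longrightarrow> demand c \<le> 9 / 5"
    using hub[of "{{b, c}, {c, a}, {c, z}}" c] mH o2 o4 bc a(2,3) z(2,3) az by (auto simp: doubleton_eq_iff)
  note tr = triple[OF disjI1[OF refl] inc_a deg3(1)] triple[OF disjI2[OF refl] inc_z deg3(4)]
  have demands: "3 * demand b + 3 * demand c + 2 * demand a + 2 * demand z \<le> 27"
  proof -
    consider "deg_in H b = 3" "deg_in H c = 3" | "deg_in H b = 3" "deg_in H c = 4" | "deg_in H b = 3" "deg_in H c \<ge> 5"
      | "deg_in H b = 4" "deg_in H c = 3" | "deg_in H b \<ge> 5" "deg_in H c = 3" | "deg_in H b \<ge> 4" "deg_in H c \<ge> 4"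
      using deg3 by linarith
    then show ?thesis
    proof cases
      case 1
      \<comment> \<open>The tight case: 9 + 9 + 9/2 + 9/2 = 27.\<close>
      then have "deg_in H a \<ge> 4" "deg_in H z \<ge> 4" using tr by linarith+
      then show ?thesis using da dz db(1) dc(1) by linarith
    next
      case 2
      then have "deg_in H a \<ge> 4 \<or> deg_in H z \<ge> 4" using quad by linarith
      then show ?thesis using da dz db(1) dc(2) 2 by (elim disjE) linarith+
    next
      case 3
      then show ?thesis using da(1) dz(1) db(1) dc(3) by linarith
    next
      case 4
      then have "deg_in H a \<ge> 4 \<or> deg_in H z \<ge> 4" using quad by linarith
      then show ?thesis using da dz db(2) dc(1) 4 by (elim disjE) linarith+
    next
      case 5
      then show ?thesis using da(1) dz(1) db(3) dc(1) by linarith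
    next
      case 6
      then show ?thesis using da(1) dz(1) db(2) dc(2) by linarith
    qed
  qed
  have "boundary (L m) \<union> boundary (R m) = {{b, c}, {b, a}, {c, a}, {b, z}, {c, z}}"
    unfolding a(1) z(1) by auto
  then have "(\<Sum>e\<in>boundary (L m) \<union> boundary (R m). surplus e)
      = surplus {b, c} + surplus {b, a} + surplus {c, a} + surplus {b, z} + surplus {c, z}"
    using bc(2) a(2,3) z(2,3) az by (simp add: doubleton_eq_iff)
  also have "\<dots> = charge {b, c} + charge {b, a} + charge {c, a} + charge {b, z} + charge {c, z}
      - (3 * demand b + 3 * demand c + 2 * demand a + 2 * demand z)"
    using bc(2) a(2,3) z(2,3) by (simp add: surplus_def)
  finally show ?thesis
    using demands charge_ge(1)[OF mH(1)] charge_ge(2)[OF _ o1(2)] charge_ge(2)[OF _ o2(2)] charge_ge(2)[OF _ o3(2)]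
      charge_ge(2)[OF _ o4(2)] o1(1) o2(1) o3(1) o4(1) bc(1) by simp
qed

lemma sum_surplus: "(\<Sum>e\<in>H - all_K4_edges. surplus e) \<ge> 0"
proof -
  define B where "B m = boundary (L m) \<union> boundary (R m)" for m
  have disj: "B m \<inter> B m' = {}" if m: "m \<in> diagonals" "m' \<in> diagonals" "m \<noteq> m'" for m m'
  proof (rule ccontr)
    assume "B m \<inter> B m' \<noteq> {}"
    then obtain e where e: "e \<in> B m" "e \<in> B m'" by blast
    have mem: "\<exists>T. u \<in> boundary T \<and> e \<in> boundary T" if "u \<in> diagonals" "e \<in> B u" for u
      using that boundary_sides[of u] by (auto simp: diagonals_def B_def)
    obtain T T' where T: "m \<in> boundary T" "e \<in> boundary T" and T': "m' \<in> boundary T'" "e \<in> boundary T'"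
      using mem[OF m(1) e(1)] mem[OF m(2) e(2)] by blast
    have tt: "tri (L m) \<and> tri (R m)" "tri (L m') \<and> tri (R m')" using m by (auto simp: diagonals_def)
    show False
    proof (cases "T = T'")
      case True
      then show False using diagonal_others(2)[OF m(1) T(1), of m'] T' m(3) tt by blast
    next
      case False
      have "tri T" "tri T'" using T T' tt by (auto simp: in_boundary)
      then have "tri (L e) \<and> tri (R e)" using two_sides[OF T(2) T'(2) False] by blast
      then have "e = m" "e = m'"
        using diagonal_others(2)[OF m(1) T] diagonal_others(2)[OF m(2) T'] by blast+
      then show False using m by blast
    qed
  qed
  have sub: "(\<Union>m\<in>diagonals. B m) \<subseteq> H - all_K4_edges"
  proof
    fix e assume "e \<in> (\<Union>m\<in>diagonals. B m)"
    then obtain m where m: "m \<in> diagonals" "e \<in> B m" by blast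
    then have mH: "m \<in> H - all_K4_edges" by (simp add: diagonals_def)
    show "e \<in> H - all_K4_edges"
    proof (cases "e = m")
      case False
      then show ?thesis
        using diagonal_others(1)[OF m(1)] boundary_sides[of m] m(2) mH unfolding B_def by blast
    qed (use mH in simp)
  qed
  have "(\<Sum>e\<in>(H - all_K4_edges) - (\<Union>m\<in>diagonals. B m). surplus e) \<ge> 0"
  proof (rule sum_nonneg)
    fix e assume e: "e \<in> (H - all_K4_edges) - (\<Union>m\<in>diagonals. B m)"
    have "e \<notin> diagonals" using e boundary_sides[of e] by (auto simp: B_def)
    then show "surplus e \<ge> 0" using e by (intro surplus_single) (auto simp: diagonals_def)
  qed
  moreover have "(\<Sum>e\<in>(\<Union>m\<in>diagonals. B m). surplus e) = (\<Sum>m\<in>diagonals. \<Sum>e\<in>B m. surplus e)"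
    using disj by (intro sum.UNION_disjoint) auto
  moreover have "(\<Sum>m\<in>diagonals. \<Sum>e\<in>B m. surplus e) \<ge> 0"
    unfolding B_def by (intro sum_nonneg diagonal_block)
  moreover have "(\<Sum>e\<in>H - all_K4_edges. surplus e)
     = (\<Sum>e\<in>(H - all_K4_edges) - (\<Union>m\<in>diagonals. B m). surplus e) + (\<Sum>e\<in>(\<Union>m\<in>diagonals. B m). surplus e)"
    by (rule sum.subset_diff[OF sub]) simp
  ultimately show ?thesis by linarith
qed

section \<open>Final balance of the discharging\<close>

theorem reduced_edges: "5 * card H + 33 \<le> 12 * card X"
proof -
  define C where "C = {x. center x}"
  have CX: "C \<subseteq> X"
  proof
    fix x assume "x \<in> C"
    then obtain a b c T1 T2 T3 where "K4 x a b c T1 T2 T3" by (auto simp: C_def center_def)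
    then show "x \<in> X" using edgeD K4_edge(1) by blast
  qed
  have corners: "(\<Sum>v\<in>X - C. corner_count v) \<le> 3 * card C"
  proof -
    have "(\<Sum>v\<in>X - C. corner_count v) = (\<Sum>v\<in>X - C. \<Sum>x\<in>C. of_bool ({x, v} \<in> H))"
    proof (rule sum.cong)
      fix v
      have "{x. center x \<and> {x, v} \<in> H} = {x\<in>C. {x, v} \<in> H}" by (auto simp: C_def)
      then show "corner_count v = (\<Sum>x\<in>C. of_bool ({x, v} \<in> H))"
        unfolding corner_count_def by (simp only: card_filter_sum[OF finite])
    qed simp
    also have "\<dots> = (\<Sum>x\<in>C. \<Sum>v\<in>X - C. of_bool ({x, v} \<in> H))" by (rule sum.swap)
    also have "\<dots> \<le> (\<Sum>x\<in>C. 3)"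
    proof (rule sum_mono)
      fix x assume "x \<in> C"
      then obtain a b c T1 T2 T3 where K: "K4 x a b c T1 T2 T3" by (auto simp: C_def center_def)
      have "(\<Sum>v\<in>X - C. of_bool ({x, v} \<in> H)) = card {v\<in>X - C. {x, v} \<in> H}"
        by (simp only: card_filter_sum[OF finite])
      also have "\<dots> \<le> card {v. {x, v} \<in> H}" by (intro card_mono) auto
      also have "\<dots> \<le> 3" unfolding K4_neighbours[OF K] by (simp add: card_insert_if)
      finally show "(\<Sum>v\<in>X - C. of_bool ({x, v} \<in> H)) \<le> (3::nat)" .
    qed
    finally show ?thesis by simp
  qed
  have rest: "(\<Sum>v\<in>X - C. demand v * real (card {e\<in>H - all_K4_edges. v \<in> e}))
      \<le> (\<Sum>e\<in>H - all_K4_edges. charge e)"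
  proof -
    have "(\<Sum>v\<in>X - C. demand v * real (card {e\<in>H - all_K4_edges. v \<in> e}))
        \<le> (\<Sum>v\<in>X. demand v * real (card {e\<in>H - all_K4_edges. v \<in> e}))"
      using demand_nonneg by (intro sum_mono2) auto
    also have "\<dots> = (\<Sum>v\<in>X. \<Sum>e\<in>H - all_K4_edges. if v \<in> e then demand v else 0)"
      by (intro sum.cong refl) (simp add: sum.If_cases Int_def mult.commute)
    also have "\<dots> = (\<Sum>e\<in>H - all_K4_edges. \<Sum>v\<in>X. if v \<in> e then demand v else 0)" by (rule sum.swap)
    also have "\<dots> = (\<Sum>e\<in>H - all_K4_edges. \<Sum>v\<in>e. demand v)"
    proof (rule sum.cong)
      fix e assume "e \<in> H - all_K4_edges"
      then have "X \<inter> e = e" using edges_in by blast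
      then show "(\<Sum>v\<in>X. if v \<in> e then demand v else 0) = (\<Sum>v\<in>e. demand v)"
        using sum.inter_restrict[of X demand e] by simp
    qed simp
    also have "\<dots> \<le> (\<Sum>e\<in>H - all_K4_edges. charge e)"
      using sum_surplus by (simp add: surplus_def sum_subtractf)
    finally show ?thesis .
  qed
  have pend: "(\<Sum>v\<in>X - C. of_bool (v \<in> pendant)) \<le> real (card pendant)"
  proof -
    have "(\<Sum>v\<in>X - C. of_bool (v \<in> pendant)) = real (card {v\<in>X - C. v \<in> pendant})"
      by (simp add: Int_def)
    also have "\<dots> \<le> real (card pendant)" by (intro of_nat_mono card_mono) auto
    finally show ?thesis .
  qed
  have "9 * real (card (X - C)) = (\<Sum>v\<in>X - C. 9)" by simp
  also have "\<dots> \<le> (\<Sum>v\<in>X - C. 9 / 2 * real (corner_count v) + demand v * real (card {e\<in>H - all_K4_edges. v \<in> e})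
    + 9 / 2 * of_bool (v \<in> pendant))"
    by (rule sum_mono, rule vertex_demand) (auto simp: C_def)
  also have "\<dots> = 9 / 2 * real (\<Sum>v\<in>X - C. corner_count v)
      + (\<Sum>v\<in>X - C. demand v * real (card {e\<in>H - all_K4_edges. v \<in> e}))
      + 9 / 2 * (\<Sum>v\<in>X - C. of_bool (v \<in> pendant))"
    by (simp only: sum.distrib sum_distrib_left of_nat_sum)
  also have "\<dots> \<le> 9 / 2 * (3 * real (card C)) + (\<Sum>e\<in>H - all_K4_edges. charge e) + 9 / 2 * real (card pendant)"
  proof -
    have "real (\<Sum>v\<in>X - C. corner_count v) \<le> 3 * real (card C)"
      using of_nat_mono[OF corners, where 'a = real] by simp
    then show ?thesis using rest pend by linarith
  qed
  finally have noncenter: "9 * real (card (X - C)) \<le> 27 / 2 * real (card C)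
      + (\<Sum>e\<in>H - all_K4_edges. charge e) + 9 / 2 * real (card pendant)" by simp
  have cX: "real (card X) = real (card (X - C)) + real (card C)"
    using CX by (metis card_Diff_subset card_mono finite le_add_diff_inverse2 of_nat_add)
  have sumH: "(\<Sum>e\<in>H. charge e) = (\<Sum>e\<in>H - all_K4_edges. charge e) + (\<Sum>e\<in>all_K4_edges. charge e)"
    by (rule sum.subset_diff[OF all_K4_edges_sub]) simp
  have K4s: "45 / 2 * real (card C) \<le> (\<Sum>e\<in>all_K4_edges. charge e)"
    using sum_charge_K4 by (simp add: C_def)
  \<comment> \<open>Each centre accounts for 27/2 at its corners and for its own 9, together the
    45/2 of its block. The faces supply 11/2 per pendant corner and 9/2 is spent, so one
    \<open>card pendant\<close> is left over.\<close>
  have "9 * real (card X) + 33 * real (card \<Phi>) + real (card pendant) \<le> 23 * real (card H)"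
    using noncenter cX sumH K4s sum_charge by linarith
  then have "9 * card X + 33 * card \<Phi> \<le> 23 * card H" by linarith
  then show ?thesis using euler by linarith
qed

end

section \<open>Energy of a mixing state\<close>

lemma deg_in_eq_vertex_degree:
  assumes "simple_graph E"
  shows "deg_in E v = vertex_degree E v"
proof -
  have "bij_betw (\<lambda>w. {v, w}) {w. adjacent E v w} {e\<in>E. v \<in> e}"
  proof (rule bij_betwI')
    show "\<exists>w\<in>{w. adjacent E v w}. e = {v, w}" if "e \<in> {e\<in>E. v \<in> e}" for e
    proof -
      have "card e = 2" using that assms by (auto simp: simple_graph_def)
      then obtain a b where "e = {a, b}" by (auto simp: card_2_iff)
      moreover have "v \<in> e" using that by simp
      ultimately obtain w where "e = {v, w}" by blast
      then show ?thesis using that by (auto simp: adjacent_def)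
    qed
  qed (auto simp: adjacent_def doubleton_eq_iff)
  then show ?thesis unfolding deg_in_def vertex_degree_def by (metis bij_betw_same_card)
qed

lemma sum_deg_in:
  fixes E :: "'v::finite set set"
  assumes "simple_graph E"
  shows "(\<Sum>v\<in>UNIV. deg_in E v) = 2 * card E"
  using assms by (simp add: handshake simple_graph_def)

section \<open>Entries of the matrix exponential\<close>

lemma matrix_pow_scale:
  fixes N :: "complex^'v^'v::finite"
  shows "matrix_pow (\<chi> a b. c * N $ a $ b) k $ a $ b = c ^ k * matrix_pow N k $ a $ b"
proof (induction k arbitrary: a)
  case (Suc k)
  then show ?case
    by (simp add: matrix_matrix_mult_def sum_distrib_left mult_ac)
qed simp

lemma matrix_pow_bound:
  fixes N :: "complex^'v^'v::finite"
  obtains C where "C \<ge> 0" "\<And>k a b. norm (matrix_pow N k $ a $ b) \<le> C ^ k"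
proof
  define C where "C = (\<Sum>a\<in>UNIV. \<Sum>b\<in>UNIV. norm (N $ a $ b))"
  show C0: "C \<ge> 0" by (simp add: C_def sum_nonneg)
  show "norm (matrix_pow N k $ a $ b) \<le> C ^ k" for k a b
  proof (induction k arbitrary: a)
    case 0
    then show ?case by (simp add: mat_def)
  next
    case (Suc k)
    have "norm (matrix_pow N (Suc k) $ a $ b) \<le> (\<Sum>c\<in>UNIV. norm (N $ a $ c) * norm (matrix_pow N k $ c $ b))"
      using norm_sum[of "\<lambda>c. N $ a $ c * matrix_pow N k $ c $ b" UNIV]
      by (simp add: matrix_matrix_mult_def norm_mult)
    also have "\<dots> \<le> (\<Sum>c\<in>UNIV. norm (N $ a $ c) * C ^ k)"
      using Suc by (intro sum_mono mult_left_mono) auto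
    also have "\<dots> = (\<Sum>c\<in>UNIV. norm (N $ a $ c)) * C ^ k" by (simp add: sum_distrib_right)
    also have "\<dots> \<le> C * C ^ k"
      unfolding C_def using C0
      by (intro mult_right_mono member_le_sum[of a UNIV "\<lambda>a. \<Sum>b\<in>UNIV. norm (N $ a $ b)"])
        (auto simp: sum_nonneg C_def)
    finally show ?case by simp
  qed
qed

lemma matrix_exp_entry:
  fixes A :: "complex^'v^'v::finite"
  shows "matrix_exp A $ a $ b = (\<Sum>k. matrix_pow A k $ a $ b / fact k)"
    and "summable (\<lambda>k. matrix_pow A k $ a $ b / fact k)"
proof -
  obtain C where C: "C \<ge> 0" "\<And>k a b. norm (matrix_pow A k $ a $ b) \<le> C ^ k"
    using matrix_pow_bound[where N = A] by blast
  have sm: "summable (\<lambda>k. matrix_pow A k $ a $ b / fact k)" for a b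
  proof (rule summable_comparison_test)
    show "\<exists>N. \<forall>k\<ge>N. norm (matrix_pow A k $ a $ b / fact k) \<le> inverse (fact k) * C ^ k"
      using C by (auto simp: norm_divide divide_simps)
    show "summable (\<lambda>k. inverse (fact k) * C ^ k)" by (rule summable_exp)
  qed
  then show "summable (\<lambda>k. matrix_pow A k $ a $ b / fact k)" .
  have "(\<lambda>k. matrix_pow A k /\<^sub>R fact k) sums (\<chi> a b. \<Sum>k. matrix_pow A k $ a $ b / fact k)"
    unfolding sums_def
  proof (intro vec_tendstoI)
    fix a b
    have "(\<lambda>k. matrix_pow A k $ a $ b / fact k) sums (\<Sum>k. matrix_pow A k $ a $ b / fact k)"
      using sm by (rule summable_sums)
    moreover have "(x /\<^sub>R fact k) = x / fact k" for x :: complex and k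
      by (simp add: scaleR_conv_of_real divide_inverse mult.commute)
    ultimately show "(\<lambda>n. (\<Sum>k<n. matrix_pow A k /\<^sub>R fact k) $ a $ b)
        \<longlonglongrightarrow> (\<chi> a b. \<Sum>k. matrix_pow A k $ a $ b / fact k) $ a $ b"
      by (simp add: sums_def)
  qed
  then show "matrix_exp A $ a $ b = (\<Sum>k. matrix_pow A k $ a $ b / fact k)"
    by (simp add: matrix_exp_def sums_iff)
qed

text \<open>The columns of \<open>U(z)\<close> solve \<open>w' = \<i> M w\<close>; for symmetric \<open>M\<close> the expression \<open>w(-z)\<^sup>T M w(z)\<close>
  is therefore constant in \<open>z\<close>, and for real \<open>z\<close> it is the energy of the state \<open>w(z)\<close>.\<close>

lemma energy_conservation:
  fixes M :: "real^'v^'v::finite" and u :: 'v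
  assumes sym: "\<And>a b. M $ a $ b = M $ b $ a"
  defines "W \<equiv> \<lambda>t a. transition_matrix M t $ a $ u"
  shows "(\<Sum>a\<in>UNIV. cnj (W t a) * (\<Sum>b\<in>UNIV. of_real (M $ a $ b) * W t b)) = of_real (M $ u $ u)"
proof -
  define N :: "complex^'v^'v" where "N = (\<chi> a b. of_real (M $ a $ b))"
  define c where "c a n = \<i> ^ n * matrix_pow N n $ a $ u / fact n" for a n
  define w where "w a z = (\<Sum>n. c a n * z ^ n)" for a z
  define D where "D a z = (\<Sum>b\<in>UNIV. N $ a $ b * w b z)" for a z
  have pow: "matrix_pow (\<chi> a b. (\<i> * z) * N $ a $ b) n $ a $ u / fact n = c a n * z ^ n" for a n z
    by (simp add: matrix_pow_scale c_def power_mult_distrib)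
  have sm: "summable (\<lambda>n. c a n * z ^ n)" for a z
    using matrix_exp_entry(2)[of "\<chi> a b. (\<i> * z) * N $ a $ b" a u] by (simp add: pow)
  have W: "W t a = w a (of_real t)" for a t
  proof -
    have "transition_matrix M t = matrix_exp (\<chi> a b. (\<i> * of_real t) * N $ a $ b)"
      by (simp add: transition_matrix_def N_def)
    then show ?thesis by (simp only: W_def matrix_exp_entry(1) pow w_def)
  qed
  \<comment> \<open>The differential equation on the level of coefficients.\<close>
  have diffs: "diffs (c a) n = (\<Sum>b\<in>UNIV. \<i> * N $ a $ b * c b n)" for a n
  proof -
    have "diffs (c a) n = \<i> * \<i> ^ n * matrix_pow N (Suc n) $ a $ u / fact n"
    proof -
      have "of_nat (Suc n) * (x / (of_nat (Suc n) * y)) = x / y" for x y :: complex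
        using of_nat_neq_0[where 'a = complex, of n] by (simp del: of_nat_Suc)
      then show ?thesis
        by (simp add: diffs_def c_def fact_Suc del: of_nat_Suc matrix_pow.simps)
    qed
    also have "matrix_pow N (Suc n) $ a $ u = (\<Sum>b\<in>UNIV. N $ a $ b * matrix_pow N n $ b $ u)"
      by (simp add: matrix_matrix_mult_def)
    also have "\<i> * \<i> ^ n * \<dots> / fact n = (\<Sum>b\<in>UNIV. \<i> * \<i> ^ n * (N $ a $ b * matrix_pow N n $ b $ u) / fact n)"
      by (simp add: sum_distrib_left sum_divide_distrib)
    also have "\<dots> = (\<Sum>b\<in>UNIV. \<i> * N $ a $ b * c b n)"
      by (rule sum.cong) (auto simp: c_def)
    finally show ?thesis .
  qed
  have deriv: "(w a has_field_derivative \<i> * D a z) (at z)" for a z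
  proof -
    have "(\<Sum>n. diffs (c a) n * z ^ n) = (\<Sum>n. \<Sum>b\<in>UNIV. \<i> * N $ a $ b * (c b n * z ^ n))"
      by (simp add: diffs sum_distrib_right mult.assoc)
    also have "\<dots> = (\<Sum>b\<in>UNIV. \<Sum>n. \<i> * N $ a $ b * (c b n * z ^ n))"
      by (rule suminf_sum) (rule summable_mult[OF sm])
    also have "\<dots> = (\<Sum>b\<in>UNIV. \<i> * N $ a $ b * w b z)"
      by (simp only: suminf_mult[OF sm] w_def)
    also have "\<dots> = \<i> * D a z"
      by (simp add: D_def sum_distrib_left mult.assoc)
    finally have "(\<Sum>n. diffs (c a) n * z ^ n) = \<i> * D a z" .
    moreover have "w a = (\<lambda>z. \<Sum>n. c a n * z ^ n)" by (rule ext) (rule w_def)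
    ultimately show ?thesis
      using termdiffs_strong_converges_everywhere[OF sm, of a z] by simp
  qed
  have deriv_neg: "((\<lambda>z. w a (- z)) has_field_derivative - (\<i> * D a (- z))) (at z)" for a z
    using DERIV_chain2[OF deriv[of a "- z"] DERIV_minus[OF DERIV_ident]] by simp
  have derivD: "(D a has_field_derivative (\<Sum>b\<in>UNIV. N $ a $ b * (\<i> * D b z))) (at z)" for a z
    unfolding D_def[abs_def] using deriv[unfolded D_def[abs_def]]
    by (intro DERIV_sum DERIV_cmult)
  \<comment> \<open>Conjugation is not complex differentiable, so \<open>w a (- z)\<close> takes its
    place. For real arguments it is the conjugate of \<open>w a z\<close> because \<open>N\<close>
    is real.\<close>
  define G where "G z = (\<Sum>a\<in>UNIV. w a (- z) * D a z)" for z
  have "(G has_field_derivative 0) (at z)" for z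
  proof -
    have "(G has_field_derivative (\<Sum>a\<in>UNIV. - (\<i> * D a (- z)) * D a z
        + (\<Sum>b\<in>UNIV. N $ a $ b * (\<i> * D b z)) * w a (- z))) (at z)"
      unfolding G_def[abs_def] by (intro DERIV_sum DERIV_mult deriv_neg derivD)
    moreover have "(\<Sum>a\<in>UNIV. (\<Sum>b\<in>UNIV. N $ a $ b * (\<i> * D b z)) * w a (- z))
        = (\<Sum>b\<in>UNIV. \<i> * D b (- z) * D b z)"
    proof -
      have "(\<Sum>a\<in>UNIV. (\<Sum>b\<in>UNIV. N $ a $ b * (\<i> * D b z)) * w a (- z))
          = (\<Sum>b\<in>UNIV. \<Sum>a\<in>UNIV. N $ a $ b * (\<i> * D b z) * w a (- z))"
        by (simp only: sum_distrib_right) (rule sum.swap)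
      also have "\<dots> = (\<Sum>b\<in>UNIV. \<Sum>a\<in>UNIV. \<i> * (N $ b $ a * w a (- z)) * D b z)"
        using sym by (intro sum.cong refl) (simp add: N_def)
      finally show ?thesis
        by (simp only: D_def[of _ "- z"] sum_distrib_left sum_distrib_right)
    qed
    ultimately show ?thesis by (simp add: sum_subtractf)
  qed
  then obtain k where "\<forall>z\<in>UNIV. G z = k"
    using has_field_derivative_zero_constant[OF convex_UNIV, of G] by blast
  then have const: "G z = G 0" for z by simp
  have w0: "w a 0 = of_bool (a = u)" for a
    unfolding w_def powser_zero by (simp add: c_def mat_def)
  have G0: "G 0 = N $ u $ u"
    by (simp add: G_def D_def w0)
  have real_pow: "cnj (matrix_pow N n $ a $ b) = matrix_pow N n $ a $ b" for n a b
    by (induction n arbitrary: a) (simp_all add: mat_def matrix_matrix_mult_def N_def)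
  have "cnj (w a (of_real t)) = w a (- of_real t)" for a
  proof -
    have "(\<lambda>n. cnj (c a n * of_real t ^ n)) sums cnj (w a (of_real t))"
      unfolding sums_cnj w_def using sm by (rule summable_sums)
    moreover have "cnj (c a n * of_real t ^ n) = c a n * (- of_real t) ^ n" for n
    proof -
      have "(- \<i>) ^ n * s ^ n = \<i> ^ n * (- s) ^ n" for s :: complex
        by (simp flip: power_mult_distrib)
      from this[of "of_real t"] show ?thesis
        by (simp add: c_def real_pow mult_ac)
    qed
    ultimately show ?thesis by (simp add: w_def sums_iff)
  qed
  then have "G (of_real t) = (\<Sum>a\<in>UNIV. cnj (W t a) * (\<Sum>b\<in>UNIV. of_real (M $ a $ b) * W t b))"
    by (simp add: G_def W D_def N_def)
  then show ?thesis using const G0 by (simp add: N_def)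
qed

section \<open>From energy to the degree bound\<close>

lemma adjacent_commute: "adjacent E a b \<longleftrightarrow> adjacent E b a"
  using adjacent_sym by blast

lemma adjacent_irrefl: "simple_graph E \<Longrightarrow> \<not> adjacent E a a"
  by (auto simp: simple_graph_def adjacent_def)

text \<open>The two matrices differ only in signs, so the absolute values of the entries of
  \<open>M\<close> form the signless Laplacian in both cases. Its row sums are twice the degrees,
  and r s <= (r^2 + s^2) / 2 bounds the conserved energy by twice the sum of the degrees weighted
  with the probabilities, which are at most 1/n + \<epsilon>.\<close>

lemma mixing_degree_bound:
  fixes E :: "'v::finite set set"
  assumes simple: "simple_graph E" and M: "M \<in> {laplacian E, signless_laplacian E}"
    and mix: "local_eps_uniform_mixing M u"
  shows "vertex_degree E u * CARD('v) \<le> 4 * card E"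
proof -
  define n where "n = real CARD('v)"
  have n: "n > 0" by (simp add: n_def)
  define Q where "Q a b = signless_laplacian E $ a $ b" for a b
  have Q: "Q a b = (if a = b then real (vertex_degree E a) else 0) + (if adjacent E a b then 1 else 0)" for a b
    by (simp add: Q_def signless_laplacian_def degree_matrix_def adjacency_matrix_def)
  have Qsym: "Q a b = Q b a" for a b
    using adjacent_commute[of E a b] by (auto simp: Q)
  have absM: "\<bar>M $ a $ b\<bar> = Q a b" for a b
    using M adjacent_irrefl[OF simple]
    by (auto simp: Q laplacian_def signless_laplacian_def degree_matrix_def adjacency_matrix_def)
  have Msym: "M $ a $ b = M $ b $ a" for a b
    using M adjacent_commute[of E a b]
    by (auto simp: laplacian_def signless_laplacian_def degree_matrix_def adjacency_matrix_def)
  have row: "(\<Sum>b\<in>UNIV. Q a b) = 2 * real (vertex_degree E a)" for a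
  proof -
    have "(\<Sum>b\<in>UNIV. if adjacent E a b then 1 else 0) = real (vertex_degree E a)"
      by (simp add: vertex_degree_def sum.If_cases)
    then show ?thesis by (simp add: Q sum.distrib)
  qed
  have Muu: "M $ u $ u = vertex_degree E u"
    using M adjacent_irrefl[OF simple]
    by (auto simp: laplacian_def signless_laplacian_def degree_matrix_def adjacency_matrix_def)
  have bound: "real (vertex_degree E u) \<le> 4 * card E * (1 / n + \<epsilon>)" if \<epsilon>: "\<epsilon> > 0" for \<epsilon>
  proof -
    obtain t where t: "norm ((transition_matrix M t *v axis u 1) * (matrix_cnj (transition_matrix M t) *v axis u 1)
              - (1 / n) *\<^sub>R 1) < \<epsilon>"
      using mix \<epsilon> by (auto simp: local_eps_uniform_mixing_def n_def)
    define W where "W a = transition_matrix M t $ a $ u" for a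
    define r where "r a = norm (W a)" for a
    have r2: "(r a)\<^sup>2 \<le> 1 / n + \<epsilon>" for a
    proof -
      have "(transition_matrix M t *v axis u 1) $ a = W a" "(matrix_cnj (transition_matrix M t) *v axis u 1) $ a = cnj (W a)"
        by (simp_all add: W_def matrix_cnj_def matrix_vector_mult_def axis_def if_distrib[of "\<lambda>x. _ * x"] cong: if_cong)
      then have "norm (W a * cnj (W a) - of_real (1 / n)) < \<epsilon>"
        using le_less_trans[OF Finite_Cartesian_Product.norm_nth_le[of _ a] t] by (simp add: of_real_def)
      moreover have "W a * cnj (W a) - of_real (1 / n) = of_real ((r a)\<^sup>2 - 1 / n)"
        by (simp add: r_def complex_norm_square flip: of_real_power)
      ultimately have "\<bar>(r a)\<^sup>2 - 1 / n\<bar> < \<epsilon>" by (metis norm_of_real)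
      then show ?thesis by linarith
    qed
    have "real (vertex_degree E u) = norm (complex_of_real (M $ u $ u))" by (simp add: Muu)
    also have "\<dots> = norm (\<Sum>a\<in>UNIV. cnj (W a) * (\<Sum>b\<in>UNIV. of_real (M $ a $ b) * W b))"
      using energy_conservation[OF Msym, where t = t and u = u] by (simp add: W_def)
    also have "\<dots> \<le> (\<Sum>a\<in>UNIV. r a * (\<Sum>b\<in>UNIV. Q a b * r b))"
      by (intro sum_norm_le) (auto simp: norm_mult r_def absM intro!: mult_left_mono sum_norm_le)
    also have "\<dots> \<le> (\<Sum>a\<in>UNIV. \<Sum>b\<in>UNIV. Q a b * ((r a)\<^sup>2 / 2) + Q a b * ((r b)\<^sup>2 / 2))"
      unfolding sum_distrib_left
    proof (intro sum_mono)
      fix a b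
      have "r a * r b \<le> (r a)\<^sup>2 / 2 + (r b)\<^sup>2 / 2"
        using sum_squares_bound[of "r a" "r b"] by simp
      then have "Q a b * (r a * r b) \<le> Q a b * ((r a)\<^sup>2 / 2 + (r b)\<^sup>2 / 2)"
        by (intro mult_left_mono) (auto simp: Q)
      then show "r a * (Q a b * r b) \<le> Q a b * ((r a)\<^sup>2 / 2) + Q a b * ((r b)\<^sup>2 / 2)"
        by (simp add: algebra_simps)
    qed
    also have "\<dots> = (\<Sum>a\<in>UNIV. \<Sum>b\<in>UNIV. Q a b * ((r a)\<^sup>2 / 2)) + (\<Sum>a\<in>UNIV. \<Sum>b\<in>UNIV. Q a b * ((r b)\<^sup>2 / 2))"
      by (simp add: sum.distrib)
    also have "(\<Sum>a\<in>UNIV. \<Sum>b\<in>UNIV. Q a b * ((r b)\<^sup>2 / 2)) = (\<Sum>b\<in>UNIV. \<Sum>a\<in>UNIV. Q b a * ((r b)\<^sup>2 / 2))"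
      by (subst sum.swap) (simp add: Qsym)
    also have "(\<Sum>a\<in>UNIV. \<Sum>b\<in>UNIV. Q a b * ((r a)\<^sup>2 / 2)) + (\<Sum>b\<in>UNIV. \<Sum>a\<in>UNIV. Q b a * ((r b)\<^sup>2 / 2))
        = (\<Sum>a\<in>UNIV. 2 * real (vertex_degree E a) * (r a)\<^sup>2)"
      by (simp add: row flip: sum_distrib_right sum.distrib)
    also have "\<dots> \<le> (\<Sum>a\<in>UNIV. 2 * real (vertex_degree E a) * (1 / n + \<epsilon>))"
      using r2 by (intro sum_mono mult_left_mono) auto
    also have "\<dots> = 2 * real (\<Sum>a\<in>UNIV. vertex_degree E a) * (1 / n + \<epsilon>)"
      by (simp add: sum_distrib_left sum_distrib_right)
    also have "(\<Sum>a\<in>UNIV. vertex_degree E a) = 2 * card E"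
      using sum_deg_in[OF simple] by (simp add: deg_in_eq_vertex_degree[OF simple])
    finally show ?thesis by simp
  qed
  have "real (vertex_degree E u) \<le> 4 * card E * (1 / n)"
  proof (rule field_le_epsilon)
    fix e :: real assume e: "e > 0"
    \<comment> \<open>The summand 1 in the denominator covers the graph without edges.\<close>
    have "real (vertex_degree E u) \<le> 4 * card E * (1 / n + e / (4 * card E + 1))"
      using bound[of "e / (4 * card E + 1)"] e by simp
    also have "\<dots> \<le> 4 * card E * (1 / n) + e"
      using e by (simp add: field_simps)
    finally show "real (vertex_degree E u) \<le> 4 * card E * (1 / n) + e" .
  qed
  then have "real (vertex_degree E u * CARD('v)) \<le> real (4 * card E)"
    using n by (simp add: n_def field_simps)
  then show ?thesis by linarith
qed

section \<open>Degrees of mixing vertices\<close>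

lemma cycle_free_mono: "cycle_free m E \<Longrightarrow> H \<subseteq> E \<Longrightarrow> cycle_free m H"
  unfolding cycle_free_def adjacent_def by blast

context drawing
begin

definition induced :: "'v set \<Rightarrow> 'v set set" where
  "induced X = {e\<in>E. e \<subseteq> X}"

text \<open>The first alternative is stable under gluing at a vertex and covers small graphs; for \<open>n \<ge> 11\<close>
  it still forces degrees at most 7 in the theorem below.\<close>

definition sparse :: "'v set \<Rightarrow> bool" where
  "sparse X \<longleftrightarrow> card (induced X) + 2 \<le> 2 * card X \<or> 5 * card (induced X) + 33 \<le> 12 * card X"

text \<open>Each forbidden configuration distributes the edges of a minimal counterexample over
  smaller induced subgraphs and few further edges. In every combination of the alternatives of
  \<open>sparse\<close> the bounds add up to one of the two again. What survives is a
  \<open>reduced_graph\<close>.\<close>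

lemma C5_free_sparse:
  assumes C5: "cycle_free 5 E"
  shows "X \<noteq> {} \<Longrightarrow> sparse X"
proof (induction "card X" arbitrary: X rule: less_induct)
  case less
  have IH: "sparse Y" if "Y \<subseteq> X" "Y \<noteq> {}" "Y \<noteq> X" for Y
    using less(1)[of Y] that by (simp add: psubset_card_mono psubsetI)
  show ?case
  proof (rule ccontr)
    assume dense: "\<not> sparse X"
    define H where "H = induced X"
    have H: "H \<subseteq> E" "\<And>e. e \<in> H \<Longrightarrow> e \<subseteq> X" by (auto simp: H_def induced_def)
    have simpleH: "simple_graph H" using simple H by (auto simp: simple_graph_def)
    have denseH: "\<not> card H + 2 \<le> 2 * card X" "\<not> 5 * card H + 33 \<le> 12 * card X"
      using dense by (auto simp: sparse_def H_def)
    have "card X \<noteq> 0" using less(2) by simp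
    moreover have "card X \<noteq> 1"
    proof
      assume "card X = 1"
      then have "\<not> e \<subseteq> X" if "e \<in> E" for e
        using card_mono[of X e] that simple by (auto simp: simple_graph_def)
      then have "H = {}" using H by blast
      then show False using denseH(1) \<open>card X = 1\<close> by simp
    qed
    ultimately have card_X: "card X \<ge> 2" by linarith
    have edge_cut: "card {e\<in>H. e \<inter> V \<noteq> {} \<and> \<not> e \<subseteq> V} \<ge> 3" if V: "V \<subseteq> X" "V \<noteq> {}" "V \<noteq> X" for V
    proof (rule ccontr)
      assume few: "\<not> ?thesis"
      have "H \<subseteq> induced V \<union> induced (X - V) \<union> {e\<in>H. e \<inter> V \<noteq> {} \<and> \<not> e \<subseteq> V}"
        using H by (auto simp: induced_def)
      then have "card H \<le> card (induced V \<union> induced (X - V) \<union> {e\<in>H. e \<inter> V \<noteq> {} \<and> \<not> e \<subseteq> V})"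
        by (intro card_mono) auto
      also have "\<dots> \<le> card (induced V) + card (induced (X - V)) + card {e\<in>H. e \<inter> V \<noteq> {} \<and> \<not> e \<subseteq> V}"
        by (intro order_trans[OF card_Un_le] add_mono card_Un_le) auto
      finally have "card H \<le> card (induced V) + card (induced (X - V)) + 2" using few by linarith
      moreover have "card X = card V + card (X - V)"
        using V(1) by (simp add: card_Diff_subset card_mono)
      moreover have "sparse V" "sparse (X - V)" using IH[of V] IH[of "X - V"] V by auto
      ultimately show False using denseH unfolding sparse_def by (elim disjE) linarith+
    qed
    \<comment> \<open>The shared vertex counts twice: for n1 + n2 = n + 1, (2 n1 - 2) + (2 n2 - 2)
      is again 2 n - 2.\<close>
    have vertex_cut: "\<exists>e\<in>H. \<not> e \<subseteq> V \<and> \<not> e \<subseteq> W" if VW: "V \<union> W = X" "V \<inter> W = {v}" "V \<noteq> {v}" "W \<noteq> {v}" for V W v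
    proof (rule ccontr)
      assume "\<not> ?thesis"
      then have "H \<subseteq> induced V \<union> induced W" using H by (auto simp: induced_def)
      then have "card H \<le> card (induced V \<union> induced W)" by (intro card_mono) auto
      also have "\<dots> \<le> card (induced V) + card (induced W)" by (rule card_Un_le)
      finally have "card H \<le> card (induced V) + card (induced W)" .
      moreover have "card X + 1 = card V + card W" using card_Un_Int[of V W] VW by simp
      moreover have "V \<noteq> {}" "W \<noteq> {}" "V \<noteq> X" "W \<noteq> X" using VW by auto
      moreover from this have "card V \<ge> 1" "card W \<ge> 1" by (simp_all add: Suc_leI card_gt_0_iff)
      moreover have "sparse V" "sparse W" using IH[of V] IH[of W] VW calculation by auto
      ultimately show False using denseH unfolding sparse_def by (elim disjE) linarith+
    qed
    \<comment> \<open>Two edges per deleted vertex are exactly the slope of the first alternative;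
      the second one, with slope 12/5, is steeper.\<close>
    have incident: "card {e\<in>H. e \<inter> Y \<noteq> {}} \<ge> 2 * card Y + 1" if Y: "Y \<subseteq> X" "Y \<noteq> {}" "Y \<noteq> X" for Y
    proof (rule ccontr)
      assume few: "\<not> ?thesis"
      have "H \<subseteq> induced (X - Y) \<union> {e\<in>H. e \<inter> Y \<noteq> {}}"
        using H by (auto simp: induced_def)
      then have "card H \<le> card (induced (X - Y) \<union> {e\<in>H. e \<inter> Y \<noteq> {}})" by (intro card_mono) auto
      also have "\<dots> \<le> card (induced (X - Y)) + card {e\<in>H. e \<inter> Y \<noteq> {}}" by (rule card_Un_le)
      finally have "card H \<le> card (induced (X - Y)) + 2 * card Y" using few by linarith
      moreover have "card X = card Y + card (X - Y)"
        using Y(1) by (simp add: card_Diff_subset card_mono)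
      moreover have "sparse (X - Y)" using IH[of "X - Y"] Y by auto
      ultimately show False using denseH unfolding sparse_def by (elim disjE) linarith+
    qed
    \<comment> \<open>Connectedness of an induced subgraph is not given; a component would be
      separated by an edge cut without edges.\<close>
    have conn: "(adjacent H)\<^sup>*\<^sup>* u v" if uv: "u \<in> X" "v \<in> X" for u v
    proof (rule ccontr)
      assume "\<not> ?thesis"
      then have "v \<notin> reach H u" by (simp add: reach_def)
      then have "reach H u \<noteq> X" using uv by blast
      moreover have "reach H u \<subseteq> X" using uv H by (intro reach_subset) auto
      moreover have "reach H u \<noteq> {}" using reach_self by blast
      ultimately have "card {e\<in>H. e \<inter> reach H u \<noteq> {} \<and> \<not> e \<subseteq> reach H u} \<ge> 3" using edge_cut by blast
      moreover have "{e\<in>H. e \<inter> reach H u \<noteq> {} \<and> \<not> e \<subseteq> reach H u} = {}"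
        using reach_closed[OF simpleH] by blast
      ultimately show False by (metis card.empty not_numeral_le_zero)
    qed
    obtain \<Phi> :: "complex set set" and L R where P: "plane_graph X H \<Phi> L R"
      using plane_structure[OF H less(2) conn] by blast
    have "reduced_graph X H \<Phi> L R"
      by (intro reduced_graph.intro P reduced_graph_axioms.intro cycle_free_mono[OF C5 H(1)] card_X edge_cut vertex_cut incident)
    then show False using reduced_graph.reduced_edges denseH(2) by blast
  qed
qed

end

section \<open>Numerical consequences\<close>

lemma less_of_mult_le:
  fixes d n q k :: nat
  assumes "d * n \<le> q" "q < k * n"
  shows "d < k"
  using assms by (meson le_less_trans mult_less_cancel2)

lemma real_le_of_mult_le:
  fixes d n q :: nat
  assumes "d * n \<le> q" "n > 0"
  shows "real d \<le> real q / real n"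
proof -
  have "real d * real n \<le> real q" using assms(1) by (metis of_nat_le_iff of_nat_mult)
  then show ?thesis using assms(2) by (simp add: pos_le_divide_eq)
qed

text \<open>For planar graphs the inequality is stated from n = 3 on: a single edge mixes and has
  degree 1, while 12 - 24/n is 0 for n = 2 and negative for n = 1.\<close>

theorem corollary21:
  fixes E :: "'v::finite set set" and M :: "real^'v^'v" and u :: 'v and n :: nat
  assumes "n = CARD('v)"
    and "simple_graph E" and "connected_graph E"
    and "M \<in> {laplacian E, signless_laplacian E}"
    and "local_eps_uniform_mixing M u"
  shows
    "((\<forall>k. k_cyclic k E \<longrightarrow>
         real (vertex_degree E u) \<le> 4 + 4 * (real k - 1) / real n
         \<and> (0 \<le> 4 * (int k - 1) \<and> 4 * (int k - 1) < int n \<longrightarrow> vertex_degree E u \<le> 4))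
      \<and> (tree E \<longrightarrow> vertex_degree E u \<le> 3)
      \<and> (unicyclic E \<longrightarrow> vertex_degree E u \<le> 4))
   \<and> (planar E \<longrightarrow>
        (n \<ge> 3 \<longrightarrow> real (vertex_degree E u) \<le> 12 - 24 / real n)
        \<and> (n \<le> 11 \<longrightarrow> vertex_degree E u \<le> 9)
        \<and> (12 \<le> n \<and> n \<le> 23 \<longrightarrow> vertex_degree E u \<le> 10)
        \<and> (n \<ge> 24 \<longrightarrow> vertex_degree E u \<le> 11))
   \<and> (planar E \<and> cycle_free 3 E \<and> n \<ge> 3 \<longrightarrow>
        real (vertex_degree E u) \<le> 8 - 16 / real n
        \<and> (n \<le> 7 \<longrightarrow> vertex_degree E u \<le> 5)
        \<and> (8 \<le> n \<and> n \<le> 15 \<longrightarrow> vertex_degree E u \<le> 6)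
        \<and> (n \<ge> 16 \<longrightarrow> vertex_degree E u \<le> 7))
   \<and> (planar E \<and> cycle_free 4 E \<and> n \<ge> 4 \<longrightarrow>
        real (vertex_degree E u) \<le> 60 / (7 * real n) * (real n - 2)
        \<and> (n \<le> 10 \<longrightarrow> vertex_degree E u \<le> 6)
        \<and> (11 \<le> n \<and> n \<le> 29 \<longrightarrow> vertex_degree E u \<le> 7)
        \<and> (n \<ge> 30 \<longrightarrow> vertex_degree E u \<le> 8))
   \<and> (planar E \<and> cycle_free 5 E \<and> n \<ge> 11 \<longrightarrow>
        real (vertex_degree E u) \<le> 4 / (5 * real n) * (12 * real n - 33)
        \<and> (n \<le> 16 \<longrightarrow> vertex_degree E u \<le> 7)
        \<and> (17 \<le> n \<and> n \<le> 43 \<longrightarrow> vertex_degree E u \<le> 8)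
        \<and> (n \<ge> 44 \<longrightarrow> vertex_degree E u \<le> 9))"
proof -
  let ?d = "vertex_degree E u"
  let ?e = "card E"
  note simple = assms(2)
  have bound: "?d * n \<le> 4 * ?e"
    using mixing_degree_bound[OF simple assms(4,5)] assms(1) by simp
  have n: "n > 0" using assms(1) by simp
  have d_n: "?d \<le> n"
    unfolding vertex_degree_def assms(1) by (rule card_mono) auto
  have conn: "(adjacent E)\<^sup>*\<^sup>* a b" for a b using assms(3) by (simp add: connected_graph_def)
  have one: "(\<forall>k. k_cyclic k E \<longrightarrow>
         real ?d \<le> 4 + 4 * (real k - 1) / real n
         \<and> (0 \<le> 4 * (int k - 1) \<and> 4 * (int k - 1) < int n \<longrightarrow> ?d \<le> 4))
      \<and> (tree E \<longrightarrow> ?d \<le> 3) \<and> (unicyclic E \<longrightarrow> ?d \<le> 4)"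
  proof (intro conjI allI impI)
    fix k assume "k_cyclic k E"
    then have e: "?e = n - 1 + k" by (simp add: k_cyclic_def assms(1))
    have "real ?d \<le> real (4 * ?e) / real n" by (rule real_le_of_mult_le[OF bound n])
    also have "\<dots> = 4 + 4 * (real k - 1) / real n"
      using n unfolding e by (simp add: of_nat_diff field_simps)
    finally show "real ?d \<le> 4 + 4 * (real k - 1) / real n" .
    assume "0 \<le> 4 * (int k - 1) \<and> 4 * (int k - 1) < int n"
    then have "int (4 * k) < int (n + 4)" by simp
    then have "4 * k < n + 4" by (simp only: of_nat_less_iff)
    then have "4 * ?e < 5 * n" unfolding e using n by simp
    then show "?d \<le> 4" using less_of_mult_le[OF bound, of 5] by linarith
  next
    assume "tree E"
    then have "4 * ?e < 4 * n" using n by (simp add: k_cyclic_def assms(1))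
    then show "?d \<le> 3" using less_of_mult_le[OF bound, of 4] by linarith
  next
    assume "unicyclic E"
    then have "4 * ?e < 5 * n" using n by (simp add: k_cyclic_def assms(1))
    then show "?d \<le> 4" using less_of_mult_le[OF bound, of 5] by linarith
  qed
  have draw: "\<exists>p g. drawing E p g" if "planar E"
    using that simple by (auto simp: planar_def drawing_def)
  have faces: "\<exists>(\<Phi> :: complex set set) L R. plane_graph UNIV E \<Phi> L R" if planar: "planar E"
  proof -
    obtain p g where "drawing E p g" using draw[OF planar] by blast
    then interpret drawing E p g .
    obtain \<Phi> :: "complex set set" and L R where "plane_graph UNIV E \<Phi> L R"
      by (rule plane_structure[of E UNIV]) (use conn in auto)
    then show ?thesis by blast
  qed
  have two: "(n \<ge> 3 \<longrightarrow> real ?d \<le> 12 - 24 / real n) \<and> (n \<le> 11 \<longrightarrow> ?d \<le> 9)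
        \<and> (12 \<le> n \<and> n \<le> 23 \<longrightarrow> ?d \<le> 10) \<and> (n \<ge> 24 \<longrightarrow> ?d \<le> 11)" if planar: "planar E"
  proof (cases "n \<ge> 3")
    case True
    obtain \<Phi> :: "complex set set" and L R where "plane_graph UNIV E \<Phi> L R" using faces[OF planar] by blast
    then have "?e + 6 \<le> 3 * n" using plane_graph.planar_edges True assms(1) by metis
    then have q: "?d * n \<le> 12 * n - 24" using bound by linarith
    have "real ?d \<le> real (12 * n - 24) / real n" by (rule real_le_of_mult_le[OF q n])
    also have "\<dots> = 12 - 24 / real n" using True by (simp add: of_nat_diff field_simps)
    finally have "real ?d \<le> 12 - 24 / real n" .
    moreover have "n \<le> 11 \<Longrightarrow> ?d < 10" by (rule less_of_mult_le[OF q]) (use True in linarith)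
    moreover have "n \<le> 23 \<Longrightarrow> ?d < 11" by (rule less_of_mult_le[OF q]) (use True in linarith)
    moreover have "?d < 12" by (rule less_of_mult_le[OF q]) (use True in linarith)
    ultimately show ?thesis by linarith
  next
    case False
    \<comment> \<open>For n <= 2 only the bound 9 is asserted.\<close>
    then show ?thesis using d_n by auto
  qed
  have three: "real ?d \<le> 8 - 16 / real n \<and> (n \<le> 7 \<longrightarrow> ?d \<le> 5)
        \<and> (8 \<le> n \<and> n \<le> 15 \<longrightarrow> ?d \<le> 6) \<and> (n \<ge> 16 \<longrightarrow> ?d \<le> 7)"
    if h: "planar E \<and> cycle_free 3 E \<and> n \<ge> 3"
  proof -
    have planar: "planar E" and C3: "cycle_free 3 E" and n3: "n \<ge> 3" using h by simp_all
    obtain \<Phi> :: "complex set set" and L R where "plane_graph UNIV E \<Phi> L R" using faces[OF planar] by blast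
    then have "?e + 4 \<le> 2 * n" using plane_graph.triangle_free_edges C3 n3 assms(1) by metis
    then have q: "?d * n \<le> 8 * n - 16" using bound by linarith
    have "real ?d \<le> real (8 * n - 16) / real n" by (rule real_le_of_mult_le[OF q n])
    also have "\<dots> = 8 - 16 / real n" using n3 by (simp add: of_nat_diff field_simps)
    finally have "real ?d \<le> 8 - 16 / real n" .
    moreover have "n \<le> 7 \<Longrightarrow> ?d < 6" by (rule less_of_mult_le[OF q]) (use n3 in linarith)
    moreover have "n \<le> 15 \<Longrightarrow> ?d < 7" by (rule less_of_mult_le[OF q]) (use n3 in linarith)
    moreover have "?d < 8" by (rule less_of_mult_le[OF q]) (use n3 in linarith)
    ultimately show ?thesis by linarith
  qed
  have four: "real ?d \<le> 60 / (7 * real n) * (real n - 2) \<and> (n \<le> 10 \<longrightarrow> ?d \<le> 6)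
        \<and> (11 \<le> n \<and> n \<le> 29 \<longrightarrow> ?d \<le> 7) \<and> (n \<ge> 30 \<longrightarrow> ?d \<le> 8)"
    if h: "planar E \<and> cycle_free 4 E \<and> n \<ge> 4"
  proof -
    have planar: "planar E" and C4: "cycle_free 4 E" and n4: "n \<ge> 4" using h by simp_all
    obtain \<Phi> :: "complex set set" and L R where "plane_graph UNIV E \<Phi> L R" using faces[OF planar] by blast
    then have "7 * ?e + 30 \<le> 15 * n" using plane_graph.C4_free_edges C4 n4 assms(1) by metis
    then have q: "7 * ?d * n \<le> 60 * n - 120" using bound by linarith
    have "real (7 * ?d) \<le> real (60 * n - 120) / real n" by (rule real_le_of_mult_le[OF q n])
    also have "\<dots> = 7 * (60 / (7 * real n) * (real n - 2))" using n4 by (simp add: of_nat_diff field_simps)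
    finally have "real ?d \<le> 60 / (7 * real n) * (real n - 2)"
      by (simp only: of_nat_mult of_nat_numeral mult_le_cancel_left_pos zero_less_numeral)
    moreover have "n \<le> 10 \<Longrightarrow> 7 * ?d < 49" by (rule less_of_mult_le[OF q]) (use n4 in linarith)
    moreover have "n \<le> 29 \<Longrightarrow> 7 * ?d < 56" by (rule less_of_mult_le[OF q]) (use n4 in linarith)
    moreover have "7 * ?d < 63" by (rule less_of_mult_le[OF q]) (use n4 in linarith)
    ultimately show ?thesis by linarith
  qed
  have five: "real ?d \<le> 4 / (5 * real n) * (12 * real n - 33) \<and> (n \<le> 16 \<longrightarrow> ?d \<le> 7)
        \<and> (17 \<le> n \<and> n \<le> 43 \<longrightarrow> ?d \<le> 8) \<and> (n \<ge> 44 \<longrightarrow> ?d \<le> 9)"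
    if h: "planar E \<and> cycle_free 5 E \<and> n \<ge> 11"
  proof -
    have planar: "planar E" and C5: "cycle_free 5 E" and n11: "n \<ge> 11" using h by simp_all
    obtain p g where D: "drawing E p g" using draw[OF planar] by blast
    then interpret drawing E p g .
    have "sparse UNIV" by (rule C5_free_sparse[OF C5]) simp
    then have "?e + 2 \<le> 2 * n \<or> 5 * ?e + 33 \<le> 12 * n"
      by (simp add: sparse_def induced_def assms(1))
    then have q: "5 * ?d * n \<le> 48 * n - 132 \<and> (n \<le> 16 \<longrightarrow> 5 * ?d < 40) \<and> (n \<le> 43 \<longrightarrow> 5 * ?d < 45) \<and> 5 * ?d < 50"
    proof
      assume "?e + 2 \<le> 2 * n"
      then have "?d * n \<le> 8 * n - 8" using bound by linarith
      \<comment> \<open>The degree has to be rounded first: at n = 11 the bound 8 n - 8 = 80 gives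
        only 5 * 80 = 400, above 48 * 11 - 132 = 396, whereas degree 7 gives 385.\<close>
      then have "?d < 8" by (rule less_of_mult_le) (use n11 in linarith)
      then have d7: "?d \<le> 7" by linarith
      then have "5 * ?d * n \<le> 35 * n" by simp
      then show ?thesis using n11 d7 by linarith
    next
      assume "5 * ?e + 33 \<le> 12 * n"
      then have q: "5 * ?d * n \<le> 48 * n - 132" using bound by linarith
      moreover have "n \<le> 16 \<Longrightarrow> 5 * ?d < 40" by (rule less_of_mult_le[OF q]) (use n11 in linarith)
      moreover have "n \<le> 43 \<Longrightarrow> 5 * ?d < 45" by (rule less_of_mult_le[OF q]) (use n11 in linarith)
      moreover have "5 * ?d < 50" by (rule less_of_mult_le[OF q]) (use n11 in linarith)
      ultimately show ?thesis by blast
    qed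
    then have "real (5 * ?d) \<le> real (48 * n - 132) / real n" by (intro real_le_of_mult_le n) simp
    also have "\<dots> = 5 * (4 / (5 * real n) * (12 * real n - 33))" using n11 by (simp add: of_nat_diff field_simps)
    finally have "real ?d \<le> 4 / (5 * real n) * (12 * real n - 33)"
      by (simp only: of_nat_mult of_nat_numeral mult_le_cancel_left_pos zero_less_numeral)
    then show ?thesis using q by linarith
  qed
  show ?thesis
    by (rule conjI[OF one conjI[OF impI[OF two] conjI[OF impI[OF three] conjI[OF impI[OF four] impI[OF five]]]]])
qed

end
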